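(* Fix a time level $n\ge2$, discrete solutions in $\mathbb S_h$ at levels $n-1,n-2$, and an initial pressure $p_h^{n,0}=p_h^{n-1}\in\mathbb P_h$. Let $\{(\mathbf E_h^{n,i},\mathbf H_h^{n,i},\mathbf u_h^{n,i},\xi_h^{n,i},p_h^{n,i})\}_{i\ge1}\subset\mathbb S_h$ be the sequence generated by the iterative decoupling scheme described in the context. Then for all $i\ge1$ $$\mathbf E_h^{n,i}=\mathbf E_h^{n,1}+\frac{L}{\sigma+\frac{3\epsilon}{2\tau}}\,\nabla\big(p_h^{n,i-1}-p_h^{n,0}\big),\qquad \mathbf H_h^{n,i}=\mathbf H_h^{n,1}.$$ Consequently the iterative decoupling scheme is algebraically equivalent to the reduced scheme described in the context: started from the same data at levels $n-1,n-2$ and the same $p_h^{n,0}$, the two schemes produce the same iterates $(\mathbf E_h^{n,i},\mathbf H_h^{n,i},\mathbf u_h^{n,i},\xi_h^{n,i},p_h^{n,i})$ for all $i\ge1$, where in the reduced scheme the electromagnetic iterates are recovered from the displayed formulas.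
   Context: Setting. $\Omega\subset\mathbb R^3$ is a bounded Lipschitz polyhedron with outward unit normal $\mathbf n$; $\partial\Omega=\overline{\Gamma_D^u}\cup\overline{\Gamma_N^u}$ with $\Gamma_D^u,\Gamma_N^u$ non-empty, disjoint boundary parts (relatively open in $\partial\Omega$). $(\cdot,\cdot)$ is the $L^2(\Omega)$ inner product, bold symbols denote $\mathbb R^3$-valued functions/spaces. Standing assumptions. $\epsilon,\sigma,\mu,G,\lambda,\alpha,\kappa,c_0>0$ and $0<L<\sqrt{\sigma\kappa}$; $\tau>0$ is the time step; $\mathbf h^n,\mathbf f^n\in\mathbf L^2(\Omega)$, $g^n\in L^2(\Omega)$ are the sources at $t_n=n\tau$. Finite elements. $\mathcal T_h$ is a shape-regular tetrahedral partition of $\Omega$. $P_j(K)$, $\widetilde P_j(K)$ are polynomials on $K$ of total degree $\le j$, resp. homogeneous of degree $j$; $\mathbf S_2(K)=\{\mathbf r\in\widetilde{\mathbf P}_2(K):\mathbf r(\mathbf x)\cdot\mathbf x=0\}$, $\mathbf R_2(K)=\mathbf P_1(K)\oplus\mathbf S_2(K)$. Then (conditions for all $K\in\mathcal T_h$) $\mathbb E_h=\{\mathbf D_h\in\mathbf L^2:\nabla\times\mathbf D_h\in\mathbf L^2,\ \mathbf D_h\times\mathbf n=\mathbf 0\text{ on }\partial\Omega,\ \mathbf D_h|_K\in\mathbf R_2(K)\}$, $\mathbb H_h=\{\mathbf B_h\in\mathbf L^2:\mathbf B_h|_K\in\mathbf P_1(K)\}$, $\mathbb U_h=\{\mathbf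 v_h\in\mathbf H^1\cap\mathbf C^0(\overline\Omega):\mathbf v_h=\mathbf 0\text{ on }\Gamma_D^u,\ \mathbf v_h|_K\in\mathbf P_2(K)\}$, $\mathbb W_h=\{w_h\in C^0(\overline\Omega):w_h|_K\in P_1(K)\}$, $\mathbb P_h=\{q_h\in H^1_0(\Omega)\cap C^0(\overline\Omega):q_h|_K\in P_2(K)\}$, $\mathbb S_h=\mathbb E_h\times\mathbb H_h\times\mathbb U_h\times\mathbb W_h\times\mathbb P_h$. The pair $(\mathbb U_h,\mathbb W_h)$ satisfies: there is $\tilde\beta>0$ independent of $h$ with $\tilde\beta\|w_h\|_{L^2}\le\sup_{\mathbf 0\ne\mathbf v_h\in\mathbb U_h}(\nabla\cdot\mathbf v_h,w_h)/\|\mathbf v_h\|_{H^1}$ for all $w_h\in\mathbb W_h$. Notation: $\bar\partial_t\chi_h^{n,i}:=(3\chi_h^{n,i}-4\chi_h^{n-1}+\chi_h^{n-2})/(2\tau)$, where $\chi_h^{n-1},\chi_h^{n-2}$ are the given previous-level solutions. Iterative decoupling scheme. For $i\ge1$: Step 1: given $p_h^{n,i-1}$, find $(\mathbf E_h^{n,i},\mathbf H_h^{n,i})\in\mathbb E_h\times\mathbb H_h$ with, for all $(\mathbf D_h,\mathbf B_h)\in\mathbb E_h\times\mathbb H_h$, $$\epsilon(\bar\partial_t\mathbf E_h^{n,i},\mathbf D_h)+\sigma(\mathbf E_h^{n,i},\mathbf D_h)-(\mathbf H_h^{n,i},\nabla\times\mathbf D_h)=L(\nabla p_h^{n,i-1},\mathbf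 D_h)+(\mathbf h^n,\mathbf D_h),\qquad \mu(\bar\partial_t\mathbf H_h^{n,i},\mathbf B_h)+(\nabla\times\mathbf E_h^{n,i},\mathbf B_h)=0.$$ Step 2: given $\mathbf E_h^{n,i}$, find $(\mathbf u_h^{n,i},\xi_h^{n,i},p_h^{n,i})\in\mathbb U_h\times\mathbb W_h\times\mathbb P_h$ with, for all $(\mathbf v_h,w_h,q_h)\in\mathbb U_h\times\mathbb W_h\times\mathbb P_h$, $$G(\nabla\mathbf u_h^{n,i},\nabla\mathbf v_h)-(\xi_h^{n,i},\nabla\cdot\mathbf v_h)=(\mathbf f^n,\mathbf v_h),\qquad (\nabla\cdot\mathbf u_h^{n,i},w_h)+\lambda^{-1}(\xi_h^{n,i},w_h)-\alpha\lambda^{-1}(p_h^{n,i},w_h)=0,$$ $$(c_0+\alpha^2\lambda^{-1})(\bar\partial_tp_h^{n,i},q_h)-\alpha\lambda^{-1}(\bar\partial_t\xi_h^{n,i},q_h)+\kappa(\nabla p_h^{n,i},\nabla q_h)=L(\mathbf E_h^{n,i},\nabla q_h)+(g^n,q_h).$$ Reduced scheme. Initial electromagnetic solve: $(\mathbf E_h^{n,1},\mathbf H_h^{n,1})\in\mathbb E_h\times\mathbb H_h$ is the solution of the Step 1 equations with $i=1$ (i.e. with $p_h^{n,0}$ on the right). Reduced poroelastic iteration: for $i\ge1$, $(\mathbf u_h^{n,i},\xi_h^{n,i},p_h^{n,i})\in\mathbb U_h\times\mathbb W_h\times\mathbb P_h$ satisfies, for all $(\mathbf v_h,w_h,q_h)\in\mathbb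 U_h\times\mathbb W_h\times\mathbb P_h$, the first two equations of Step 2 together with $$(c_0+\alpha^2\lambda^{-1})(\bar\partial_tp_h^{n,i},q_h)-\alpha\lambda^{-1}(\bar\partial_t\xi_h^{n,i},q_h)+\kappa(\nabla p_h^{n,i},\nabla q_h)=L(\mathbf E_h^{n,1},\nabla q_h)+\frac{L^2}{\sigma+\frac{3\epsilon}{2\tau}}(\nabla p_h^{n,i-1}-\nabla p_h^{n,0},\nabla q_h)+(g^n,q_h).$$ The electromagnetic iterates of the reduced scheme are then defined by $\mathbf E_h^{n,i}=\mathbf E_h^{n,1}+\frac{L}{\sigma+3\epsilon/(2\tau)}\nabla(p_h^{n,i-1}-p_h^{n,0})$ and $\mathbf H_h^{n,i}=\mathbf H_h^{n,1}$. *)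

theory Defs
  imports "HOL-Analysis.Analysis"
begin

type_synonym scalar_field = "real^3 \<Rightarrow> real"
type_synonym vector_field = "real^3 \<Rightarrow> real^3"

section \<open>Domain and mesh\<close>

text \<open>Near every boundary point, up to a rigid motion, the domain is the strict epigraph of a
  Lipschitz function of two variables.\<close>

definition lipschitz_domain :: "(real^3) set \<Rightarrow> bool" where
  "lipschitz_domain \<Omega> \<longleftrightarrow> open \<Omega> \<and> connected \<Omega> \<and> \<Omega> \<noteq> {} \<and>
     (\<forall>x\<in>frontier \<Omega>. \<exists>r>0. \<exists>Q :: real^3 \<Rightarrow> real^3. \<exists>\<zeta> :: real^2 \<Rightarrow> real. \<exists>M.
        orthogonal_transformation Q \<and> M-lipschitz_on UNIV \<zeta> \<and>
        \<Omega> \<inter> ball x r = {y \<in> ball x r. \<zeta> (vector [Q (y - x) $ 1, Q (y - x) $ 2]) < Q (y - x) $ 3})"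

text \<open>A polyhedron need not be convex, so the library's \<open>polyhedron\<close> (a finite intersection of
  half-spaces) is not the right notion here.\<close>

definition bounded_lipschitz_polyhedron :: "(real^3) set \<Rightarrow> bool" where
  "bounded_lipschitz_polyhedron \<Omega> \<longleftrightarrow> bounded \<Omega> \<and> lipschitz_domain \<Omega> \<and>
     (\<exists>\<F>. finite \<F> \<and> (\<forall>P\<in>\<F>. polytope P) \<and> closure \<Omega> = \<Union>\<F>)"

definition boundary_parts :: "(real^3) set \<Rightarrow> (real^3) set \<Rightarrow> (real^3) set \<Rightarrow> bool" where
  "boundary_parts \<Omega> \<Gamma>D \<Gamma>N \<longleftrightarrow> \<Gamma>D \<noteq> {} \<and> \<Gamma>N \<noteq> {} \<and> \<Gamma>D \<inter> \<Gamma>N = {} \<and>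
     openin (top_of_set (frontier \<Omega>)) \<Gamma>D \<and> openin (top_of_set (frontier \<Omega>)) \<Gamma>N \<and>
     frontier \<Omega> = closure \<Gamma>D \<union> closure \<Gamma>N"

definition tetrahedral_partition :: "(real^3) set \<Rightarrow> (real^3) set set \<Rightarrow> bool" where
  "tetrahedral_partition \<Omega> \<T> \<longleftrightarrow> triangulation \<T> \<and> (\<forall>K\<in>\<T>. 3 simplex K) \<and> \<Union>\<T> = closure \<Omega>"

definition mesh_size :: "(real^3) set set \<Rightarrow> real" where
  "mesh_size \<T> = Max (diameter ` \<T>)"

definition inradius :: "(real^3) set \<Rightarrow> real" where
  "inradius K = Sup {r. 0 \<le> r \<and> (\<exists>x. cball x r \<subseteq> K)}"

definition shape_regular :: "real \<Rightarrow> (real^3) set set \<Rightarrow> bool" where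
  "shape_regular \<gamma> \<T> \<longleftrightarrow> (\<forall>K\<in>\<T>. diameter K \<le> \<gamma> * inradius K)"


section \<open>Lebesgue and Sobolev spaces\<close>

text \<open>Elements of \<open>L\<^sup>2(\<Omega>)\<close> are represented by functions on the whole space; values outside
  \<open>\<Omega>\<close> are irrelevant and equality is equality almost everywhere in \<open>\<Omega>\<close>.\<close>

definition L2 :: "(real^3) set \<Rightarrow> (real^3 \<Rightarrow> 'a::euclidean_space) set" where
  "L2 \<Omega> = {f. f \<in> borel_measurable (lebesgue_on \<Omega>) \<and>
              integrable (lebesgue_on \<Omega>) (\<lambda>x. (norm (f x))\<^sup>2)}"

definition ip :: "(real^3) set \<Rightarrow> (real^3 \<Rightarrow> 'a::euclidean_space) \<Rightarrow> (real^3 \<Rightarrow> 'a) \<Rightarrow> real" where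
  "ip \<Omega> f g = (LINT x|lebesgue_on \<Omega>. f x \<bullet> g x)"

definition L2_norm :: "(real^3) set \<Rightarrow> (real^3 \<Rightarrow> 'a::euclidean_space) \<Rightarrow> real" where
  "L2_norm \<Omega> f = sqrt (ip \<Omega> f f)"

definition eq_ae :: "(real^3) set \<Rightarrow> (real^3 \<Rightarrow> 'a::euclidean_space) \<Rightarrow> (real^3 \<Rightarrow> 'a) \<Rightarrow> bool" where
  "eq_ae \<Omega> f g \<longleftrightarrow> (AE x in lebesgue_on \<Omega>. f x = g x)"

definition pderiv_at :: "3 \<Rightarrow> scalar_field \<Rightarrow> scalar_field" where
  "pderiv_at i f x = frechet_derivative f (at x) (axis i 1)"

primrec C_k :: "nat \<Rightarrow> scalar_field \<Rightarrow> bool" where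
  "C_k 0 f \<longleftrightarrow> continuous_on UNIV f"
| "C_k (Suc k) f \<longleftrightarrow> f differentiable_on UNIV \<and> (\<forall>i. C_k k (pderiv_at i f))"

definition smooth :: "scalar_field \<Rightarrow> bool" where
  "smooth f \<longleftrightarrow> (\<forall>k. C_k k f)"

definition smooth_vec :: "vector_field \<Rightarrow> bool" where
  "smooth_vec \<phi> \<longleftrightarrow> (\<forall>i. smooth (\<lambda>x. \<phi> x $ i))"

definition test_fun :: "(real^3) set \<Rightarrow> scalar_field set" where
  "test_fun \<Omega> = {\<phi>. smooth \<phi> \<and> compact (closure {x. \<phi> x \<noteq> 0}) \<and> closure {x. \<phi> x \<noteq> 0} \<subseteq> \<Omega>}"

definition test_vec :: "(real^3) set \<Rightarrow> vector_field set" where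
  "test_vec \<Omega> = {\<phi>. \<forall>i. (\<lambda>x. \<phi> x $ i) \<in> test_fun \<Omega>}"

definition classical_grad :: "scalar_field \<Rightarrow> vector_field" where
  "classical_grad f x = (\<chi> i. pderiv_at i f x)"

definition classical_curl :: "vector_field \<Rightarrow> vector_field" where
  "classical_curl \<phi> x = vector
     [pderiv_at 2 (\<lambda>y. \<phi> y $ 3) x - pderiv_at 3 (\<lambda>y. \<phi> y $ 2) x,
      pderiv_at 3 (\<lambda>y. \<phi> y $ 1) x - pderiv_at 1 (\<lambda>y. \<phi> y $ 3) x,
      pderiv_at 1 (\<lambda>y. \<phi> y $ 2) x - pderiv_at 2 (\<lambda>y. \<phi> y $ 1) x]"

definition is_weak_grad :: "(real^3) set \<Rightarrow> scalar_field \<Rightarrow> vector_field \<Rightarrow> bool" where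
  "is_weak_grad \<Omega> f g \<longleftrightarrow> g \<in> L2 \<Omega> \<and>
     (\<forall>\<phi>\<in>test_fun \<Omega>. \<forall>i. ip \<Omega> f (pderiv_at i \<phi>) = - ip \<Omega> (\<lambda>x. g x $ i) \<phi>)"

definition is_weak_curl :: "(real^3) set \<Rightarrow> vector_field \<Rightarrow> vector_field \<Rightarrow> bool" where
  "is_weak_curl \<Omega> D C \<longleftrightarrow> C \<in> L2 \<Omega> \<and>
     (\<forall>\<phi>\<in>test_vec \<Omega>. ip \<Omega> D (classical_curl \<phi>) = ip \<Omega> C \<phi>)"

text \<open>Weak derivatives are unique only almost everywhere; these pick a representative.\<close>

definition wgrad :: "(real^3) set \<Rightarrow> scalar_field \<Rightarrow> vector_field" where
  "wgrad \<Omega> f = (SOME g. is_weak_grad \<Omega> f g)"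

definition wcurl :: "(real^3) set \<Rightarrow> vector_field \<Rightarrow> vector_field" where
  "wcurl \<Omega> D = (SOME C. is_weak_curl \<Omega> D C)"

definition wgrad_vec :: "(real^3) set \<Rightarrow> vector_field \<Rightarrow> real^3 \<Rightarrow> real^3^3" where
  "wgrad_vec \<Omega> v x = (\<chi> i. wgrad \<Omega> (\<lambda>y. v y $ i) x)"

definition wdiv :: "(real^3) set \<Rightarrow> vector_field \<Rightarrow> scalar_field" where
  "wdiv \<Omega> v x = (\<Sum>i\<in>UNIV. wgrad \<Omega> (\<lambda>y. v y $ i) x $ i)"

definition H1 :: "(real^3) set \<Rightarrow> scalar_field set" where
  "H1 \<Omega> = {f \<in> L2 \<Omega>. \<exists>g. is_weak_grad \<Omega> f g}"

definition H1_vec :: "(real^3) set \<Rightarrow> vector_field set" where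
  "H1_vec \<Omega> = {v. \<forall>i. (\<lambda>x. v x $ i) \<in> H1 \<Omega>}"

definition H1_norm_vec :: "(real^3) set \<Rightarrow> vector_field \<Rightarrow> real" where
  "H1_norm_vec \<Omega> v = sqrt ((L2_norm \<Omega> v)\<^sup>2 + (L2_norm \<Omega> (wgrad_vec \<Omega> v))\<^sup>2)"

text \<open>Closure of the test functions in the \<open>H\<^sup>1\<close>-norm.\<close>

definition H1_0 :: "(real^3) set \<Rightarrow> scalar_field set" where
  "H1_0 \<Omega> = {f \<in> H1 \<Omega>. \<exists>\<phi> :: nat \<Rightarrow> scalar_field. (\<forall>k. \<phi> k \<in> test_fun \<Omega>) \<and>
      (\<lambda>k. L2_norm \<Omega> (\<lambda>x. \<phi> k x - f x)) \<longlonglongrightarrow> 0 \<and>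
      (\<lambda>k. L2_norm \<Omega> (\<lambda>x. classical_grad (\<phi> k) x - wgrad \<Omega> f x)) \<longlonglongrightarrow> 0}"

definition H_curl :: "(real^3) set \<Rightarrow> vector_field set" where
  "H_curl \<Omega> = {D \<in> L2 \<Omega>. \<exists>C. is_weak_curl \<Omega> D C}"

text \<open>The tangential trace of \<open>D \<in> H(curl)\<close> is, as usual, the functional given by Green's formula:
  for smooth \<open>D\<close> the expression below is the boundary integral of \<open>(n \<times> D) \<bullet> \<phi>\<close>,
  \<open>n\<close> being the outward unit normal. Smooth functions on the closure of \<open>\<Omega>\<close> are
  restrictions of smooth functions on the whole space.\<close>

definition tangential_trace :: "(real^3) set \<Rightarrow> vector_field \<Rightarrow> vector_field \<Rightarrow> real" where
  "tangential_trace \<Omega> D \<phi> = ip \<Omega> (wcurl \<Omega> D) \<phi> - ip \<Omega> D (classical_curl \<phi>)"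

definition zero_tangential_trace :: "(real^3) set \<Rightarrow> vector_field \<Rightarrow> bool" where
  "zero_tangential_trace \<Omega> D \<longleftrightarrow> (\<forall>\<phi>. smooth_vec \<phi> \<longrightarrow> tangential_trace \<Omega> D \<phi> = 0)"


section \<open>Polynomials and finite element spaces\<close>

definition monomial :: "(3 \<Rightarrow> nat) \<Rightarrow> scalar_field" where
  "monomial a x = (\<Prod>i\<in>UNIV. (x $ i) ^ a i)"

definition poly_deg_le :: "nat \<Rightarrow> scalar_field set" where
  "poly_deg_le j = {p. \<exists>c. p = (\<lambda>x. \<Sum>a\<in>{a. (\<Sum>i\<in>UNIV. a i) \<le> j}. c a * monomial a x)}"

definition poly_hom :: "nat \<Rightarrow> scalar_field set" where
  "poly_hom j = {p. \<exists>c. p = (\<lambda>x. \<Sum>a\<in>{a. (\<Sum>i\<in>UNIV. a i) = j}. c a * monomial a x)}"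

definition poly_deg_le_vec :: "nat \<Rightarrow> vector_field set" where
  "poly_deg_le_vec j = {r. \<forall>i. (\<lambda>x. r x $ i) \<in> poly_deg_le j}"

definition poly_hom_vec :: "nat \<Rightarrow> vector_field set" where
  "poly_hom_vec j = {r. \<forall>i. (\<lambda>x. r x $ i) \<in> poly_hom j}"

definition S2 :: "(real^3) set \<Rightarrow> vector_field set" where
  "S2 K = {r \<in> poly_hom_vec 2. \<forall>x\<in>K. r x \<bullet> x = 0}"

definition R2 :: "(real^3) set \<Rightarrow> vector_field set" where
  "R2 K = {r. \<exists>a\<in>poly_deg_le_vec 1. \<exists>b\<in>S2 K. r = (\<lambda>x. a x + b x)}"

definition E_space :: "(real^3) set \<Rightarrow> (real^3) set set \<Rightarrow> vector_field set" where
  "E_space \<Omega> \<T> = {D \<in> H_curl \<Omega>. zero_tangential_trace \<Omega> D \<and> (\<forall>K\<in>\<T>. \<exists>r\<in>R2 K. eq_ae K D r)}"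

definition H_space :: "(real^3) set \<Rightarrow> (real^3) set set \<Rightarrow> vector_field set" where
  "H_space \<Omega> \<T> = {B \<in> L2 \<Omega>. \<forall>K\<in>\<T>. \<exists>r\<in>poly_deg_le_vec 1. eq_ae K B r}"

definition U_space :: "(real^3) set \<Rightarrow> (real^3) set \<Rightarrow> (real^3) set set \<Rightarrow> vector_field set" where
  "U_space \<Omega> \<Gamma>D \<T> = {v \<in> H1_vec \<Omega>. continuous_on (closure \<Omega>) v \<and> (\<forall>x\<in>\<Gamma>D. v x = 0) \<and>
     (\<forall>K\<in>\<T>. \<exists>r\<in>poly_deg_le_vec 2. \<forall>x\<in>K. v x = r x)}"

definition W_space :: "(real^3) set \<Rightarrow> (real^3) set set \<Rightarrow> scalar_field set" where
  "W_space \<Omega> \<T> = {w. continuous_on (closure \<Omega>) w \<and>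
     (\<forall>K\<in>\<T>. \<exists>r\<in>poly_deg_le 1. \<forall>x\<in>K. w x = r x)}"

definition P_space :: "(real^3) set \<Rightarrow> (real^3) set set \<Rightarrow> scalar_field set" where
  "P_space \<Omega> \<T> = {q \<in> H1_0 \<Omega>. continuous_on (closure \<Omega>) q \<and>
     (\<forall>K\<in>\<T>. \<exists>r\<in>poly_deg_le 2. \<forall>x\<in>K. q x = r x)}"

text \<open>The supremum is taken in the extended reals, so it is meaningful without a separate proof that
  the set of quotients is non-empty and bounded.\<close>

definition inf_sup :: "(real^3) set \<Rightarrow> (real^3) set \<Rightarrow> (real^3) set set \<Rightarrow> real \<Rightarrow> bool" where
  "inf_sup \<Omega> \<Gamma>D \<T> \<beta> \<longleftrightarrow> (\<forall>w\<in>W_space \<Omega> \<T>.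
     ereal (\<beta> * L2_norm \<Omega> w) \<le>
       (SUP v\<in>{v \<in> U_space \<Omega> \<Gamma>D \<T>. \<exists>x\<in>closure \<Omega>. v x \<noteq> 0}.
          ereal (ip \<Omega> (wdiv \<Omega> v) w / H1_norm_vec \<Omega> v)))"

text \<open>A family of meshes indexed by mesh sizes \<open>h \<in> \<H>\<close>; the constants \<open>\<gamma>\<close> and
  \<open>\<beta>\<close> do not depend on \<open>h\<close>.\<close>

definition stable_mesh_family ::
  "(real^3) set \<Rightarrow> (real^3) set \<Rightarrow> real set \<Rightarrow> (real \<Rightarrow> (real^3) set set) \<Rightarrow> bool" where
  "stable_mesh_family \<Omega> \<Gamma>D \<H> \<T> \<longleftrightarrow>
     (\<forall>h\<in>\<H>. tetrahedral_partition \<Omega> (\<T> h) \<and> mesh_size (\<T> h) = h) \<and>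
     (\<exists>\<gamma>>0. \<forall>h\<in>\<H>. shape_regular \<gamma> (\<T> h)) \<and>
     (\<exists>\<beta>>0. \<forall>h\<in>\<H>. inf_sup \<Omega> \<Gamma>D (\<T> h) \<beta>)"


section \<open>The two schemes\<close>

record coeffs =
  c_eps :: real
  c_sigma :: real
  c_mu :: real
  c_G :: real
  c_lam :: real
  c_alpha :: real
  c_kappa :: real
  c_0 :: real
  c_L :: real
  c_tau :: real

definition admissible :: "coeffs \<Rightarrow> bool" where
  "admissible c \<longleftrightarrow> c_eps c > 0 \<and> c_sigma c > 0 \<and> c_mu c > 0 \<and> c_G c > 0 \<and> c_lam c > 0 \<and>
     c_alpha c > 0 \<and> c_kappa c > 0 \<and> c_0 c > 0 \<and> c_tau c > 0 \<and>
     0 < c_L c \<and> c_L c < sqrt (c_sigma c * c_kappa c)"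

record fields =
  f_E :: vector_field
  f_H :: vector_field
  f_u :: vector_field
  f_xi :: scalar_field
  f_p :: scalar_field

definition S_space :: "(real^3) set \<Rightarrow> (real^3) set \<Rightarrow> (real^3) set set \<Rightarrow> fields set" where
  "S_space \<Omega> \<Gamma>D \<T> = {s. f_E s \<in> E_space \<Omega> \<T> \<and> f_H s \<in> H_space \<Omega> \<T> \<and>
     f_u s \<in> U_space \<Omega> \<Gamma>D \<T> \<and> f_xi s \<in> W_space \<Omega> \<T> \<and> f_p s \<in> P_space \<Omega> \<T>}"

definition same_fields :: "(real^3) set \<Rightarrow> fields \<Rightarrow> fields \<Rightarrow> bool" where
  "same_fields \<Omega> s s' \<longleftrightarrow> eq_ae \<Omega> (f_E s) (f_E s') \<and> eq_ae \<Omega> (f_H s) (f_H s') \<and>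
     (\<forall>x\<in>closure \<Omega>. f_u s x = f_u s' x \<and> f_xi s x = f_xi s' x \<and> f_p s x = f_p s' x)"

definition bdf2 ::
  "real \<Rightarrow> (real^3 \<Rightarrow> 'a::real_vector) \<Rightarrow> (real^3 \<Rightarrow> 'a) \<Rightarrow> (real^3 \<Rightarrow> 'a) \<Rightarrow> real^3 \<Rightarrow> 'a" where
  "bdf2 \<tau> f f1 f2 x = (1 / (2 * \<tau>)) *\<^sub>R (3 *\<^sub>R f x - 4 *\<^sub>R f1 x + f2 x)"

text \<open>In the following, \<open>o1\<close> and \<open>o2\<close> are the solutions at the levels \<open>n - 1\<close> and
  \<open>n - 2\<close>, and \<open>hn\<close>, \<open>fn\<close>, \<open>gn\<close> are the sources at level \<open>n\<close>.\<close>

definition em_step ::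
  "(real^3) set \<Rightarrow> (real^3) set set \<Rightarrow> coeffs \<Rightarrow> fields \<Rightarrow> fields \<Rightarrow> vector_field \<Rightarrow>
   scalar_field \<Rightarrow> vector_field \<Rightarrow> vector_field \<Rightarrow> bool" where
  "em_step \<Omega> \<T> c o1 o2 hn pprev E H \<longleftrightarrow>
     E \<in> E_space \<Omega> \<T> \<and> H \<in> H_space \<Omega> \<T> \<and>
     (\<forall>D\<in>E_space \<Omega> \<T>.
        c_eps c * ip \<Omega> (bdf2 (c_tau c) E (f_E o1) (f_E o2)) D + c_sigma c * ip \<Omega> E D
          - ip \<Omega> H (wcurl \<Omega> D)
        = c_L c * ip \<Omega> (wgrad \<Omega> pprev) D + ip \<Omega> hn D) \<and>
     (\<forall>B\<in>H_space \<Omega> \<T>.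
        c_mu c * ip \<Omega> (bdf2 (c_tau c) H (f_H o1) (f_H o2)) B + ip \<Omega> (wcurl \<Omega> E) B = 0)"

definition elasticity_eqs ::
  "(real^3) set \<Rightarrow> (real^3) set \<Rightarrow> (real^3) set set \<Rightarrow> coeffs \<Rightarrow> vector_field \<Rightarrow>
   vector_field \<Rightarrow> scalar_field \<Rightarrow> scalar_field \<Rightarrow> bool" where
  "elasticity_eqs \<Omega> \<Gamma>D \<T> c fn u xi p \<longleftrightarrow>
     (\<forall>v\<in>U_space \<Omega> \<Gamma>D \<T>.
        c_G c * ip \<Omega> (wgrad_vec \<Omega> u) (wgrad_vec \<Omega> v) - ip \<Omega> xi (wdiv \<Omega> v) = ip \<Omega> fn v) \<and>
     (\<forall>w\<in>W_space \<Omega> \<T>.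
        ip \<Omega> (wdiv \<Omega> u) w + (1 / c_lam c) * ip \<Omega> xi w - (c_alpha c / c_lam c) * ip \<Omega> p w = 0)"

text \<open>Left-hand side of the pressure equation, which both schemes share.\<close>

definition pressure_lhs ::
  "(real^3) set \<Rightarrow> coeffs \<Rightarrow> fields \<Rightarrow> fields \<Rightarrow> scalar_field \<Rightarrow> scalar_field \<Rightarrow> scalar_field \<Rightarrow> real" where
  "pressure_lhs \<Omega> c o1 o2 xi p q =
     (c_0 c + (c_alpha c)\<^sup>2 / c_lam c) * ip \<Omega> (bdf2 (c_tau c) p (f_p o1) (f_p o2)) q
     - (c_alpha c / c_lam c) * ip \<Omega> (bdf2 (c_tau c) xi (f_xi o1) (f_xi o2)) q
     + c_kappa c * ip \<Omega> (wgrad \<Omega> p) (wgrad \<Omega> q)"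

text \<open>Iterates are indexed by \<open>i \<ge> 1\<close>; at \<open>i = 0\<close> there is only the initial pressure
  \<open>p0\<close>, and the entry \<open>s 0\<close> of a sequence is never used.\<close>

definition pressure :: "scalar_field \<Rightarrow> (nat \<Rightarrow> fields) \<Rightarrow> nat \<Rightarrow> scalar_field" where
  "pressure p0 s i = (if i = 0 then p0 else f_p (s i))"

definition iterative_scheme ::
  "(real^3) set \<Rightarrow> (real^3) set \<Rightarrow> (real^3) set set \<Rightarrow> coeffs \<Rightarrow> fields \<Rightarrow> fields \<Rightarrow>
   vector_field \<Rightarrow> vector_field \<Rightarrow> scalar_field \<Rightarrow> scalar_field \<Rightarrow> (nat \<Rightarrow> fields) \<Rightarrow> bool" where
  "iterative_scheme \<Omega> \<Gamma>D \<T> c o1 o2 hn fn gn p0 s \<longleftrightarrow> (\<forall>i\<ge>1.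
     em_step \<Omega> \<T> c o1 o2 hn (pressure p0 s (i - 1)) (f_E (s i)) (f_H (s i)) \<and>
     f_u (s i) \<in> U_space \<Omega> \<Gamma>D \<T> \<and> f_xi (s i) \<in> W_space \<Omega> \<T> \<and> f_p (s i) \<in> P_space \<Omega> \<T> \<and>
     elasticity_eqs \<Omega> \<Gamma>D \<T> c fn (f_u (s i)) (f_xi (s i)) (f_p (s i)) \<and>
     (\<forall>q\<in>P_space \<Omega> \<T>.
        pressure_lhs \<Omega> c o1 o2 (f_xi (s i)) (f_p (s i)) q
        = c_L c * ip \<Omega> (f_E (s i)) (wgrad \<Omega> q) + ip \<Omega> gn q))"

definition em_recovery ::
  "(real^3) set \<Rightarrow> coeffs \<Rightarrow> scalar_field \<Rightarrow> (nat \<Rightarrow> fields) \<Rightarrow> nat \<Rightarrow> bool" where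
  "em_recovery \<Omega> c p0 s i \<longleftrightarrow>
     eq_ae \<Omega> (f_E (s i))
       (\<lambda>x. f_E (s 1) x + (c_L c / (c_sigma c + 3 * c_eps c / (2 * c_tau c))) *\<^sub>R
              wgrad \<Omega> (\<lambda>y. pressure p0 s (i - 1) y - p0 y) x) \<and>
     eq_ae \<Omega> (f_H (s i)) (f_H (s 1))"

text \<open>Note that \<open>f_E (s i) \<in> E_space \<Omega> \<T>\<close> is not imposed for \<open>i \<ge> 2\<close>: these fields are
  merely defined by the recovery formulas.\<close>

definition reduced_scheme ::
  "(real^3) set \<Rightarrow> (real^3) set \<Rightarrow> (real^3) set set \<Rightarrow> coeffs \<Rightarrow> fields \<Rightarrow> fields \<Rightarrow>
   vector_field \<Rightarrow> vector_field \<Rightarrow> scalar_field \<Rightarrow> scalar_field \<Rightarrow> (nat \<Rightarrow> fields) \<Rightarrow> bool" where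
  "reduced_scheme \<Omega> \<Gamma>D \<T> c o1 o2 hn fn gn p0 s \<longleftrightarrow>
     em_step \<Omega> \<T> c o1 o2 hn p0 (f_E (s 1)) (f_H (s 1)) \<and>
     (\<forall>i\<ge>1.
        f_u (s i) \<in> U_space \<Omega> \<Gamma>D \<T> \<and> f_xi (s i) \<in> W_space \<Omega> \<T> \<and> f_p (s i) \<in> P_space \<Omega> \<T> \<and>
        elasticity_eqs \<Omega> \<Gamma>D \<T> c fn (f_u (s i)) (f_xi (s i)) (f_p (s i)) \<and>
        (\<forall>q\<in>P_space \<Omega> \<T>.
           pressure_lhs \<Omega> c o1 o2 (f_xi (s i)) (f_p (s i)) q
           = c_L c * ip \<Omega> (f_E (s 1)) (wgrad \<Omega> q)
             + (c_L c)\<^sup>2 / (c_sigma c + 3 * c_eps c / (2 * c_tau c)) *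
               ip \<Omega> (\<lambda>x. wgrad \<Omega> (pressure p0 s (i - 1)) x - wgrad \<Omega> p0 x) (wgrad \<Omega> q)
             + ip \<Omega> gn q) \<and>
        em_recovery \<Omega> c p0 s i)"

end

theory Submission
  imports Defs
begin

text \<open>Gradients of discrete pressures lie in the edge element space (they are curl free, piecewise of
  degree one, and their tangential trace vanishes because pressures are \<open>H\<^sup>1\<close>-limits of test
  functions). Hence, for two iterates of the electromagnetic step with pressures \<open>p\<close> and \<open>p'\<close>,
  the field \<open>E' - E - \<theta> \<nabla>(p' - p)\<close> with \<open>\<theta> = L / (\<sigma> + 3\<epsilon>/(2\<tau>))\<close> solves the homogeneous
  problem together with \<open>H' - H\<close>, and testing with these two fields shows that both vanish. Inserting
  the resulting formula for \<open>E\<close> into the pressure equation gives the reduced scheme. Equality of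
  the iterates then follows from unique solvability of the two steps.

  Weak derivatives are arbitrary representatives, so all of this rests on their uniqueness almost
  everywhere, that is, on the fundamental lemma of the calculus of variations.\<close>

section \<open>Smooth functions\<close>

text \<open>The constant \<theta> comes from the time discretisation: in the difference of two
  iterates the old levels and the sources cancel, the BDF2 quotient leaves 3/(2\<tau>) times the
  difference, and the electric field carries the total coefficient \<sigma> + 3\<epsilon>/(2\<tau>).
  A pressure gradient, being curl free, produces no magnetic response. From the reduced to the
  iterative scheme there is an extra obstacle: for i \<ge> 2 the electric fields are merely defined
  by a formula, so their membership in \<open>E_space\<close> must be derived. This requires
  invariance of that space under equality almost everywhere in \<Omega>; since elements are closed
  and may touch the boundary, the Lipschitz property is used to place their interiors inside
  \<Omega>. Smoothness is defined by iterated partial derivatives, and the tools are derived for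
  this notion: symmetry of second derivatives makes gradients weakly curl free, and explicit bump
  functions drive the fundamental lemma.\<close>

lemma pderiv_at_eqI: "(f has_derivative F) (at x) \<Longrightarrow> pderiv_at i f x = F (axis i 1)"
  by (simp add: pderiv_at_def frechet_derivative_at [symmetric])

lemma differentiable_onUNIV_D: "f differentiable_on UNIV \<Longrightarrow> f differentiable (at x)"
  by (simp add: differentiable_on_def)

lemma has_derivative_frechet:
  "f differentiable_on UNIV \<Longrightarrow> (f has_derivative frechet_derivative f (at x)) (at x)"
  using differentiable_onUNIV_D frechet_derivative_works by blast

text \<open>Reduces partial derivatives to one-variable calculus, so that the mean value theorem
  \<open>MVT2\<close> can be applied along coordinate lines.\<close>

lemma has_real_derivative_along_axis:
  assumes "f differentiable_on UNIV"
  shows "((\<lambda>s. f (x + s *\<^sub>R axis i 1)) has_real_derivative pderiv_at i f (x + s *\<^sub>R axis i 1)) (at s)"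
proof -
  let ?F = "frechet_derivative f (at (x + s *\<^sub>R axis i 1))"
  have F: "(f has_derivative ?F) (at (x + s *\<^sub>R axis i 1))"
    using assms by (rule has_derivative_frechet)
  have "((\<lambda>s. x + s *\<^sub>R axis i 1) has_derivative (\<lambda>h. h *\<^sub>R axis i 1)) (at s)"
    by (auto intro!: derivative_eq_intros)
  from has_derivative_compose [OF this F]
  have "((\<lambda>s. f (x + s *\<^sub>R axis i 1)) has_derivative (\<lambda>h. ?F (h *\<^sub>R axis i 1))) (at s)" .
  moreover have "?F (h *\<^sub>R axis i 1) = pderiv_at i f (x + s *\<^sub>R axis i 1) * h" for h
    using linear_scale [OF has_derivative_linear [OF F]] by (simp add: pderiv_at_def)
  ultimately show ?thesis
    by (simp add: has_field_derivative_def)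
qed

lemma pderiv_at_add:
  assumes "f differentiable_on UNIV" "g differentiable_on UNIV"
  shows "pderiv_at i (\<lambda>x. f x + g x) = (\<lambda>x. pderiv_at i f x + pderiv_at i g x)"
proof
  fix x
  show "pderiv_at i (\<lambda>x. f x + g x) x = pderiv_at i f x + pderiv_at i g x"
    using pderiv_at_eqI [OF has_derivative_add [OF has_derivative_frechet [OF assms(1)] has_derivative_frechet [OF assms(2)]]]
    by (simp add: pderiv_at_def)
qed

lemma pderiv_at_cmult:
  assumes "f differentiable_on UNIV"
  shows "pderiv_at i (\<lambda>x. c * f x) = (\<lambda>x. c * pderiv_at i f x)"
proof
  fix x
  show "pderiv_at i (\<lambda>x. c * f x) x = c * pderiv_at i f x"
    using pderiv_at_eqI [OF has_derivative_mult_right [OF has_derivative_frechet [OF assms(1)]]]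
    by (simp add: pderiv_at_def)
qed

lemma pderiv_at_mult:
  assumes "f differentiable_on UNIV" "g differentiable_on UNIV"
  shows "pderiv_at i (\<lambda>x. f x * g x) = (\<lambda>x. f x * pderiv_at i g x + pderiv_at i f x * g x)"
proof
  fix x
  show "pderiv_at i (\<lambda>x. f x * g x) x = f x * pderiv_at i g x + pderiv_at i f x * g x"
    using pderiv_at_eqI [OF has_derivative_mult [OF has_derivative_frechet [OF assms(1)] has_derivative_frechet [OF assms(2)]]]
    by (simp add: pderiv_at_def)
qed

lemma pderiv_at_const: "pderiv_at i (\<lambda>x. c) = (\<lambda>x. 0)"
  using pderiv_at_eqI [OF has_derivative_const [of c]] by auto

lemma C_k_continuous: "C_k k f \<Longrightarrow> continuous_on UNIV f"
  by (cases k) (auto intro: differentiable_imp_continuous_on)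

lemma C_k_SucD: "C_k (Suc k) f \<Longrightarrow> C_k k f"
  by (induction k arbitrary: f) (auto intro: differentiable_imp_continuous_on)

lemma C_k_add: "C_k k f \<Longrightarrow> C_k k g \<Longrightarrow> C_k k (\<lambda>x. f x + g x)"
  by (induction k arbitrary: f g)
     (auto intro: continuous_on_add simp: pderiv_at_add)

lemma C_k_mult: "C_k k f \<Longrightarrow> C_k k g \<Longrightarrow> C_k k (\<lambda>x. f x * g x)"
proof (induction k arbitrary: f g)
  case (Suc k)
  then show ?case
    using C_k_SucD [OF Suc.prems(1)] C_k_SucD [OF Suc.prems(2)]
    by (auto simp: pderiv_at_mult intro!: C_k_add)
qed (auto intro: continuous_on_mult)

lemma C_k_const: "C_k k (\<lambda>x. c)"
  by (induction k arbitrary: c) (auto simp: pderiv_at_const)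

lemma smooth_continuous: "smooth f \<Longrightarrow> continuous_on UNIV f"
  using C_k_continuous smooth_def by blast

lemma smooth_differentiable: "smooth f \<Longrightarrow> f differentiable_on UNIV"
  unfolding smooth_def by (metis C_k.simps(2))

lemma smooth_pderiv: "smooth f \<Longrightarrow> smooth (pderiv_at i f)"
  unfolding smooth_def by (metis C_k.simps(2))

lemma smooth_add: "smooth f \<Longrightarrow> smooth g \<Longrightarrow> smooth (\<lambda>x. f x + g x)"
  by (simp add: smooth_def C_k_add)

lemma smooth_mult: "smooth f \<Longrightarrow> smooth g \<Longrightarrow> smooth (\<lambda>x. f x * g x)"
  by (simp add: smooth_def C_k_mult)

lemma smooth_const: "smooth (\<lambda>x. c)"
  by (simp add: smooth_def C_k_const)

lemma smooth_cmult: "smooth f \<Longrightarrow> smooth (\<lambda>x. c * f x)"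
  using smooth_mult [OF smooth_const] .

lemma smooth_diff: "smooth f \<Longrightarrow> smooth g \<Longrightarrow> smooth (\<lambda>x. f x - g x)"
  using smooth_add [of f "\<lambda>x. (-1) * g x"] smooth_cmult [of g "-1"] by simp

lemma smooth_sum: "(\<And>a. a \<in> A \<Longrightarrow> smooth (f a)) \<Longrightarrow> smooth (\<lambda>x. \<Sum>a\<in>A. f a x)"
  by (induction A rule: infinite_finite_induct) (auto intro: smooth_const smooth_add)

lemma smooth_prod: "(\<And>a. a \<in> A \<Longrightarrow> smooth (f a)) \<Longrightarrow> smooth (\<lambda>x. \<Prod>a\<in>A. f a x)"
  by (induction A rule: infinite_finite_induct) (auto intro: smooth_const smooth_mult)

lemma smooth_power: "smooth f \<Longrightarrow> smooth (\<lambda>x. f x ^ n)"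
  by (induction n) (auto intro: smooth_const smooth_mult)

text \<open>By the chain rule a partial derivative of a function of \<open>x $ j\<close> is the next
  member of the sequence, up to a constant factor. This gives smoothness of the coordinates and of
  the functions built from exp(-1/t).\<close>

lemma smooth_of_derivative_sequence:
  assumes "\<And>n t. (d n has_real_derivative d (Suc n) t) (at t)"
  shows "smooth (\<lambda>x. d n (x $ j))"
proof -
  have D: "((\<lambda>x. d n (x $ j)) has_derivative (\<lambda>h. d (Suc n) (x $ j) * (h $ j))) (at x)" for n x
  proof -
    have 1: "((\<lambda>x::real^3. x $ j) has_derivative (\<lambda>h. h $ j)) (at x)"
      by (rule bounded_linear_imp_has_derivative) (rule bounded_linear_vec_nth)
    have 2: "(d n has_derivative (*) (d (Suc n) (x $ j))) (at (x $ j))"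
      using assms [of n "x $ j"] by (simp add: has_field_derivative_def)
    show ?thesis
      using has_derivative_compose [OF 1 2] by (simp add: comp_def)
  qed
  then have diff: "(\<lambda>x. d n (x $ j)) differentiable_on UNIV" for n
    unfolding differentiable_on_def differentiable_def by blast
  have pd: "pderiv_at i (\<lambda>x. d n (x $ j)) = (\<lambda>x. axis i 1 $ j * d (Suc n) (x $ j))" for n i
    using pderiv_at_eqI [OF D] by (auto simp: mult.commute)
  \<comment> \<open>The factor \<open>c\<close> absorbs the entries \<open>axis i 1 $ j\<close>
    produced by each differentiation; without it the induction on \<open>k\<close> would not
    close.\<close>
  have "C_k k (\<lambda>x. c * d n (x $ j))" for k c n
  proof (induction k arbitrary: c n)
    case 0
    show ?case
      by (simp add: continuous_on_mult_left differentiable_imp_continuous_on diff)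
  next
    case (Suc k)
    show ?case
      using Suc [of "c * (axis _ 1 $ j)" "Suc n"] differentiable_on_mult [OF differentiable_on_const diff]
      by (simp add: pderiv_at_cmult [OF diff] pd mult.assoc)
  qed
  from this [of _ 1] show ?thesis
    by (simp add: smooth_def)
qed

lemma smooth_component: "smooth (\<lambda>x. x $ j)"
proof -
  define d :: "nat \<Rightarrow> real \<Rightarrow> real" where "d = (\<lambda>n. if n = 0 then (\<lambda>t. t) else if n = 1 then (\<lambda>t. 1) else (\<lambda>t. 0))"
  have "(d n has_real_derivative d (Suc n) t) (at t)" for n t
    by (auto simp: d_def)
  from smooth_of_derivative_sequence [of d, OF this, of 0 j] show ?thesis
    by (simp add: d_def)
qed

subsection \<open>Symmetry of second partial derivatives\<close>

text \<open>The second difference is the increment over [0, t] of the first difference in direction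
  \<open>j\<close>, regarded as a function along \<open>axis i 1\<close>. One mean value theorem
  produces \<open>a\<close>; a second one, applied to \<open>pderiv_at i f\<close> along
  \<open>axis j 1\<close>, produces \<open>b\<close>.\<close>

lemma second_difference_mvt:
  assumes f: "f differentiable_on UNIV" and fi: "pderiv_at i f differentiable_on UNIV" and "t > 0"
  obtains a b where "0 < a" "a < t" "0 < b" "b < t"
    "f (x + t *\<^sub>R axis i 1 + t *\<^sub>R axis j 1) - f (x + t *\<^sub>R axis i 1) - f (x + t *\<^sub>R axis j 1) + f x
      = t * t * pderiv_at j (pderiv_at i f) (x + a *\<^sub>R axis i 1 + b *\<^sub>R axis j 1)"
proof -
  let ?g = "\<lambda>s. f ((x + t *\<^sub>R axis j 1) + s *\<^sub>R axis i 1) - f (x + s *\<^sub>R axis i 1)"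
  let ?g' = "\<lambda>s. pderiv_at i f ((x + t *\<^sub>R axis j 1) + s *\<^sub>R axis i 1) - pderiv_at i f (x + s *\<^sub>R axis i 1)"
  have "(?g has_real_derivative ?g' s) (at s)" for s
    by (intro DERIV_diff has_real_derivative_along_axis f)
  then obtain a where a: "0 < a" "a < t" "?g t - ?g 0 = (t - 0) * ?g' a"
    using MVT2 [of 0 t ?g ?g'] \<open>t > 0\<close> by blast
  let ?h = "\<lambda>s. pderiv_at i f ((x + a *\<^sub>R axis i 1) + s *\<^sub>R axis j 1)"
  let ?h' = "\<lambda>s. pderiv_at j (pderiv_at i f) ((x + a *\<^sub>R axis i 1) + s *\<^sub>R axis j 1)"
  have "(?h has_real_derivative ?h' s) (at s)" for s
    by (intro has_real_derivative_along_axis fi)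
  then obtain b where b: "0 < b" "b < t" "?h t - ?h 0 = (t - 0) * ?h' b"
    using MVT2 [of 0 t ?h ?h'] \<open>t > 0\<close> by blast
  show ?thesis
  proof (rule that [OF a(1,2) b(1,2)])
    have "?g' a = t * ?h' b"
      using b(3) by (simp add: algebra_simps)
    then show "f (x + t *\<^sub>R axis i 1 + t *\<^sub>R axis j 1) - f (x + t *\<^sub>R axis i 1) - f (x + t *\<^sub>R axis j 1) + f x
      = t * t * pderiv_at j (pderiv_at i f) (x + a *\<^sub>R axis i 1 + b *\<^sub>R axis j 1)"
      using a(3) by (simp add: algebra_simps)
  qed
qed

text \<open>Schwarz's theorem: \<Delta> is symmetric in its two directions, while \<Delta> divided
  by the squared step tends to either mixed derivative, by continuity of these.\<close>

lemma pderiv_at_commute: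
  assumes "C_k 2 f"
  shows "pderiv_at i (pderiv_at j f) x = pderiv_at j (pderiv_at i f) x"
proof -
  have f: "f differentiable_on UNIV" and fi: "\<And>i. pderiv_at i f differentiable_on UNIV"
    and cont: "\<And>i j. continuous_on UNIV (pderiv_at j (pderiv_at i f))"
    using assms by (auto simp: numeral_2_eq_2)
  have near: "((\<lambda>n. x + a n *\<^sub>R axis k 1 + b n *\<^sub>R axis l 1) \<longlonglongrightarrow> x)"
    if "\<And>n. 0 < a n \<and> a n < inverse (Suc n)" "\<And>n. 0 < b n \<and> b n < inverse (Suc n)"
    for a b :: "nat \<Rightarrow> real" and k l :: 3
  proof -
    have "a \<longlonglongrightarrow> 0" "b \<longlonglongrightarrow> 0"
      using that
      by (auto simp: less_imp_le
          intro!: tendsto_sandwich [OF _ _ tendsto_const LIMSEQ_inverse_real_of_nat] always_eventually)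
    then have "((\<lambda>n. x + a n *\<^sub>R axis k 1 + b n *\<^sub>R axis l 1) \<longlonglongrightarrow> x + 0 *\<^sub>R axis k 1 + 0 *\<^sub>R axis l 1)"
      by (intro tendsto_intros)
    then show ?thesis by simp
  qed
  define t :: "nat \<Rightarrow> real" where "t n = inverse (real (Suc n))" for n
  have t: "t n > 0" for n by (simp add: t_def)
  define \<Delta> where "\<Delta> i j n = f (x + t n *\<^sub>R axis i 1 + t n *\<^sub>R axis j 1) - f (x + t n *\<^sub>R axis i 1)
    - f (x + t n *\<^sub>R axis j 1) + f x" for i j n
  have lim: "(\<lambda>n. \<Delta> i j n / (t n * t n)) \<longlonglongrightarrow> pderiv_at j (pderiv_at i f) x" for i j
  proof -
    have "\<exists>a b. 0 < a \<and> a < t n \<and> 0 < b \<and> b < t n \<and>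
      \<Delta> i j n = t n * t n * pderiv_at j (pderiv_at i f) (x + a *\<^sub>R axis i 1 + b *\<^sub>R axis j 1)" for n
      unfolding \<Delta>_def by (rule second_difference_mvt [OF f fi t]) blast
    then obtain a b where ab: "\<And>n. 0 < a n \<and> a n < t n" "\<And>n. 0 < b n \<and> b n < t n"
      "\<And>n. \<Delta> i j n = t n * t n * pderiv_at j (pderiv_at i f) (x + a n *\<^sub>R axis i 1 + b n *\<^sub>R axis j 1)"
      by metis
    have "(\<lambda>n. pderiv_at j (pderiv_at i f) (x + a n *\<^sub>R axis i 1 + b n *\<^sub>R axis j 1)) \<longlonglongrightarrow> pderiv_at j (pderiv_at i f) x"
      by (rule continuous_on_tendsto_compose [OF cont near]) (use ab in \<open>simp_all add: t_def\<close>)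
    moreover have "\<Delta> i j n / (t n * t n) = pderiv_at j (pderiv_at i f) (x + a n *\<^sub>R axis i 1 + b n *\<^sub>R axis j 1)" for n
      unfolding ab(3) using t [of n] by simp
    ultimately show ?thesis by simp
  qed
  have "\<Delta> i j = \<Delta> j i"
    by (simp add: fun_eq_iff \<Delta>_def add.assoc add.commute add.left_commute)
  then show ?thesis
    using lim [of i j] lim [of j i] LIMSEQ_unique [of "\<lambda>n. \<Delta> i j n / (t n * t n)"] by simp
qed

section \<open>Integration by parts\<close>

lemma integral_lborel_translate:
  fixes f :: "real^3 \<Rightarrow> real"
  assumes "f \<in> borel_measurable borel"
  shows "(LINT x|lborel. f (c + x)) = (LINT x|lborel. f x)"
  using integral_distr [of "(+) c" lborel borel f] assms unfolding lborel_distr_plus by simp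

lemma integrable_lborel_compact_support:
  fixes f :: "real^3 \<Rightarrow> real"
  assumes "continuous_on UNIV f" "compact K" "\<And>x. x \<notin> K \<Longrightarrow> f x = 0"
  shows "integrable lborel f"
proof -
  have "set_integrable lborel K f"
    unfolding set_integrable_def
    by (rule borel_integrable_compact [OF assms(2) continuous_on_subset [OF assms(1) subset_UNIV]])
  moreover have "(\<lambda>x. indicator K x *\<^sub>R f x) = f"
    using assms(3) by (auto simp: indicator_def fun_eq_iff)
  ultimately show ?thesis
    by (simp add: set_integrable_def)
qed

lemma pderiv_at_zero_outside:
  assumes "closed K" "\<And>x. x \<notin> K \<Longrightarrow> f x = 0" "x \<notin> K"
  shows "pderiv_at i f x = 0"
proof -
  have "(f has_derivative (\<lambda>h. 0)) (at x)"
    by (rule has_derivative_transform_within_open [of "\<lambda>x. 0" _ _ _ "- K"]) (use assms in auto)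
  then show ?thesis
    by (rule pderiv_at_eqI)
qed

text \<open>Difference quotients integrate to zero by translation invariance.\<close>

lemma integral_pderiv_compact_support:
  assumes f: "f differentiable_on UNIV" and cont: "continuous_on UNIV (pderiv_at i f)"
    and K: "compact K" "\<And>x. x \<notin> K \<Longrightarrow> f x = 0"
  shows "(LINT x|lborel. pderiv_at i f x) = 0"
proof -
  define e :: "real^3" where "e = axis i 1"
  define t where "t n = inverse (real (Suc n))" for n
  define s where "s n x = (f (t n *\<^sub>R e + x) - f x) / t n" for n x
  have fc: "continuous_on UNIV f"
    using f by (rule differentiable_imp_continuous_on)
  have fm: "f \<in> borel_measurable borel"
    using fc by (rule borel_measurable_continuous_onI)
  have dm: "pderiv_at i f \<in> borel_measurable borel"
    using cont by (rule borel_measurable_continuous_onI)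
  have zero: "x \<notin> K \<Longrightarrow> pderiv_at i f x = 0" for x
    by (rule pderiv_at_zero_outside [OF compact_imp_closed]) (use K in auto)
  obtain B where B: "\<And>x. \<bar>pderiv_at i f x\<bar> \<le> B"
  proof -
    have "bounded (pderiv_at i f ` K)"
      using cont K(1) by (intro compact_imp_bounded compact_continuous_image) (auto intro: continuous_on_subset)
    then obtain B where "\<And>x. x \<in> K \<Longrightarrow> \<bar>pderiv_at i f x\<bar> \<le> B"
      by (auto simp: bounded_iff)
    then have "\<bar>pderiv_at i f x\<bar> \<le> max B 0" for x
      using zero [of x] by (cases "x \<in> K") (simp_all add: le_max_iff_disj)
    then show ?thesis by (rule that)
  qed
  obtain R where R: "K \<subseteq> ball 0 R"
    using bounded_subset_ballD [OF compact_imp_bounded [OF K(1)]] by blast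
  have t01: "0 < t n" "t n \<le> 1" for n
    by (auto simp: t_def field_simps)
  have mvt: "\<exists>\<xi>. 0 < \<xi> \<and> \<xi> < t n \<and> s n x = pderiv_at i f (x + \<xi> *\<^sub>R e)" for n x
  proof -
    obtain \<xi> where "0 < \<xi>" "\<xi> < t n"
      "f (x + t n *\<^sub>R e) - f (x + 0 *\<^sub>R e) = (t n - 0) * pderiv_at i f (x + \<xi> *\<^sub>R e)"
      using MVT2 [of 0 "t n" "\<lambda>s. f (x + s *\<^sub>R e)" "\<lambda>s. pderiv_at i f (x + s *\<^sub>R e)"]
        t01 [of n] has_real_derivative_along_axis [OF f] unfolding e_def by blast
    then have "s n x = pderiv_at i f (x + \<xi> *\<^sub>R e)"
      using t01 [of n] by (simp add: s_def add.commute [of _ x])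
    with \<open>0 < \<xi>\<close> \<open>\<xi> < t n\<close> show ?thesis
      by blast
  qed
  have "(\<lambda>n. integral\<^sup>L lborel (s n)) \<longlonglongrightarrow> integral\<^sup>L lborel (pderiv_at i f)"
  proof (rule integral_dominated_convergence)
    \<comment> \<open>\<open>s n x\<close> is a value of the partial derivative at a point within
      distance \<open>t n \<le> 1\<close> of \<open>x\<close>. It is therefore bounded by
      \<open>B\<close>, and it vanishes outside the ball of radius \<open>R + 1\<close>.\<close>
    show "integrable lborel (\<lambda>x. B * indicator (cball 0 (R + 1)) x :: real)"
      by (intro integrable_mult_right integrable_real_indicator emeasure_lborel_cball_finite) simp
    show "AE x in lborel. (\<lambda>n. s n x) \<longlonglongrightarrow> pderiv_at i f x"
    proof (intro AE_I2)
      fix x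
      obtain \<xi> where \<xi>: "\<And>n. 0 < \<xi> n \<and> \<xi> n < t n \<and> s n x = pderiv_at i f (x + \<xi> n *\<^sub>R e)"
        using mvt [of _ x] by metis
      have "t \<longlonglongrightarrow> 0"
        unfolding t_def by (rule LIMSEQ_inverse_real_of_nat)
      then have "\<xi> \<longlonglongrightarrow> 0"
        by (rule tendsto_sandwich [OF _ _ tendsto_const, rotated 2])
           (use \<xi> in \<open>auto intro!: always_eventually less_imp_le\<close>)
      then have "(\<lambda>n. x + \<xi> n *\<^sub>R e) \<longlonglongrightarrow> x + 0 *\<^sub>R e"
        by (intro tendsto_intros)
      then have "(\<lambda>n. pderiv_at i f (x + \<xi> n *\<^sub>R e)) \<longlonglongrightarrow> pderiv_at i f x"
        by (intro continuous_on_tendsto_compose [OF cont]) auto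
      then show "(\<lambda>n. s n x) \<longlonglongrightarrow> pderiv_at i f x"
        using \<xi> by simp
    qed
    show "AE x in lborel. norm (s n x) \<le> B * indicator (cball 0 (R + 1)) x" for n
    proof (intro AE_I2)
      fix x
      obtain \<xi> where \<xi>: "0 < \<xi>" "\<xi> < t n" "s n x = pderiv_at i f (x + \<xi> *\<^sub>R e)"
        using mvt by blast
      show "norm (s n x) \<le> B * indicator (cball 0 (R + 1)) x"
      proof (cases "x \<in> cball 0 (R + 1)")
        case True
        then show ?thesis using B \<xi>(3) by simp
      next
        case False
        have "norm x \<le> norm (x + \<xi> *\<^sub>R e) + norm (\<xi> *\<^sub>R e)"
          using norm_triangle_ineq4 [of "x + \<xi> *\<^sub>R e" "\<xi> *\<^sub>R e"] by simp
        moreover have "norm (\<xi> *\<^sub>R e) \<le> 1"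
          using \<xi> t01 [of n] by (simp add: e_def)
        ultimately have "x + \<xi> *\<^sub>R e \<notin> K"
          using False R by (auto simp: subset_iff)
        then show ?thesis
          using zero \<xi>(3) False by simp
      qed
    qed
  next
    have "continuous_on UNIV (s n)" for n
      unfolding s_def [abs_def] using t01(1) [of n]
      by (intro continuous_on_divide continuous_on_diff continuous_on_compose2 [OF fc] continuous_intros fc) auto
    from borel_measurable_continuous_onI [OF this] show "s n \<in> borel_measurable lborel" for n
      by simp
    show "pderiv_at i f \<in> borel_measurable lborel"
      using dm by simp
  qed
  moreover have "integral\<^sup>L lborel (s n) = 0" for n
  proof -
    have fi: "integrable lborel f"
      using fc K by (rule integrable_lborel_compact_support)
    have fi': "integrable lborel (\<lambda>x. f (t n *\<^sub>R e + x))"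
    proof (rule integrable_lborel_compact_support)
      show "continuous_on UNIV (\<lambda>x. f (t n *\<^sub>R e + x))"
        by (intro continuous_on_compose2 [OF fc] continuous_intros) auto
      show "compact ((+) (- (t n *\<^sub>R e)) ` K)"
        using K(1) by (rule compact_translation)
      fix x assume x: "x \<notin> (+) (- (t n *\<^sub>R e)) ` K"
      have "t n *\<^sub>R e + x \<notin> K"
      proof
        assume "t n *\<^sub>R e + x \<in> K"
        then have "- (t n *\<^sub>R e) + (t n *\<^sub>R e + x) \<in> (+) (- (t n *\<^sub>R e)) ` K"
          by (rule imageI)
        with x show False by simp
      qed
      then show "f (t n *\<^sub>R e + x) = 0"
        by (rule K(2))
    qed
    show ?thesis
      using fi fi' integral_lborel_translate [OF fm, of "t n *\<^sub>R e"]
      unfolding s_def [abs_def] by simp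
  qed
  ultimately show ?thesis
    by (simp add: LIMSEQ_const_iff)
qed

text \<open>Lets inner products over a domain be computed on the whole space with
  \<open>lborel\<close>, the setting of the translation argument.\<close>

lemma integral_lebesgue_on_eq_lborel:
  fixes f :: "real^3 \<Rightarrow> real"
  assumes "open U" "f \<in> borel_measurable borel" "\<And>x. x \<notin> U \<Longrightarrow> f x = 0"
  shows "(LINT x|lebesgue_on U. f x) = (LINT x|lborel. f x)"
proof -
  have "(\<lambda>x. indicator U x *\<^sub>R f x) = f"
    using assms(3) by (auto simp: indicator_def fun_eq_iff)
  then show ?thesis
    using assms by (simp add: integral_restrict_space integral_completion)
qed

section \<open>Test functions and integration by parts against them\<close>

lemma test_fun_smooth: "\<phi> \<in> test_fun U \<Longrightarrow> smooth \<phi>"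
  by (simp add: test_fun_def)

lemma test_funE:
  assumes "\<phi> \<in> test_fun U"
  obtains K where "smooth \<phi>" "compact K" "K \<subseteq> U" "\<And>x. x \<notin> K \<Longrightarrow> \<phi> x = 0"
proof (rule that)
  show "smooth \<phi>" "compact (closure {x. \<phi> x \<noteq> 0})" "closure {x. \<phi> x \<noteq> 0} \<subseteq> U"
    using assms by (simp_all add: test_fun_def)
  show "\<phi> x = 0" if "x \<notin> closure {x. \<phi> x \<noteq> 0}" for x
    using that closure_subset [of "{x. \<phi> x \<noteq> 0}"] by blast
qed

lemma test_funI:
  assumes "smooth \<phi>" "compact K" "K \<subseteq> U" "\<And>x. x \<notin> K \<Longrightarrow> \<phi> x = 0"
  shows "\<phi> \<in> test_fun U"
proof -
  have sub: "{x. \<phi> x \<noteq> 0} \<subseteq> K"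
    using assms(4) by blast
  have "closure {x. \<phi> x \<noteq> 0} \<subseteq> K"
    using sub compact_imp_closed [OF assms(2)] by (rule closure_minimal)
  moreover have "compact (closure {x. \<phi> x \<noteq> 0})"
    using bounded_subset [OF compact_imp_bounded [OF assms(2)] sub] by (simp add: compact_closure)
  ultimately show ?thesis
    using assms(1,3) by (auto simp: test_fun_def)
qed

lemma test_fun_pderiv:
  assumes "\<phi> \<in> test_fun U"
  shows "pderiv_at i \<phi> \<in> test_fun U"
  using assms
proof (rule test_funE)
  fix K assume K: "smooth \<phi>" "compact K" "K \<subseteq> U" "\<And>x. x \<notin> K \<Longrightarrow> \<phi> x = 0"
  show ?thesis
    by (rule test_funI [OF smooth_pderiv [OF K(1)] K(2,3)])
       (rule pderiv_at_zero_outside [OF compact_imp_closed [OF K(2)] K(4)])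
qed

lemma test_fun_mono: "\<phi> \<in> test_fun U \<Longrightarrow> U \<subseteq> V \<Longrightarrow> \<phi> \<in> test_fun V"
  by (auto simp: test_fun_def)

lemma test_fun_add:
  assumes "\<phi> \<in> test_fun U" "\<psi> \<in> test_fun U"
  shows "(\<lambda>x. \<phi> x + \<psi> x) \<in> test_fun U"
proof -
  obtain K where K: "smooth \<phi>" "compact K" "K \<subseteq> U" "\<And>x. x \<notin> K \<Longrightarrow> \<phi> x = 0"
    using assms(1) by (rule test_funE) blast
  obtain L where L: "smooth \<psi>" "compact L" "L \<subseteq> U" "\<And>x. x \<notin> L \<Longrightarrow> \<psi> x = 0"
    using assms(2) by (rule test_funE) blast
  show ?thesis
    by (rule test_funI [OF smooth_add [OF K(1) L(1)] compact_Un [OF K(2) L(2)]]) (use K L in auto)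
qed

lemma test_fun_mult:
  assumes "\<phi> \<in> test_fun U" "smooth \<psi>"
  shows "(\<lambda>x. \<psi> x * \<phi> x) \<in> test_fun U"
  using assms(1) by (rule test_funE) (rule test_funI [OF smooth_mult [OF assms(2)]], auto)

lemma test_fun_diff: 
  assumes "\<phi> \<in> test_fun U" "\<psi> \<in> test_fun U"
  shows "(\<lambda>x. \<phi> x - \<psi> x) \<in> test_fun U"
  using test_fun_add [OF assms(1) test_fun_mult [OF assms(2) smooth_const [of "-1"]]] by simp

lemma zero_test_fun: "(\<lambda>x. 0) \<in> test_fun U"
  by (rule test_funI [OF smooth_const, of "{}"]) auto

text \<open>The product inherits compact support from \<phi>, and its partial derivative integrates
  to zero. The factor \<open>f\<close> may be nonzero at the boundary, as is the case for
  polynomials on an element and for the smooth fields that test a tangential trace.\<close>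

lemma integral_by_parts_test_fun:
  assumes U: "open U" and \<phi>: "\<phi> \<in> test_fun U"
    and f: "f differentiable_on UNIV" "continuous_on UNIV (pderiv_at i f)"
  shows "(LINT x|lebesgue_on U. f x * pderiv_at i \<phi> x) = - (LINT x|lebesgue_on U. pderiv_at i f x * \<phi> x)"
proof -
  obtain K where \<phi>s: "smooth \<phi>" and K: "compact K" "K \<subseteq> U" "\<And>x. x \<notin> K \<Longrightarrow> \<phi> x = 0"
    using \<phi> by (rule test_funE) blast
  have fc: "continuous_on UNIV f" and \<phi>c: "continuous_on UNIV \<phi>" "continuous_on UNIV (pderiv_at i \<phi>)"
    using f(1) \<phi>s by (auto intro: differentiable_imp_continuous_on smooth_continuous smooth_pderiv)
  have zero: "x \<notin> K \<Longrightarrow> pderiv_at i \<phi> x = 0" for x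
    by (rule pderiv_at_zero_outside [OF compact_imp_closed [OF K(1)] K(3)])
  have eq: "pderiv_at i (\<lambda>x. f x * \<phi> x) = (\<lambda>x. f x * pderiv_at i \<phi> x + pderiv_at i f x * \<phi> x)"
    by (rule pderiv_at_mult [OF f(1) smooth_differentiable [OF \<phi>s]])
  have c1: "continuous_on UNIV (\<lambda>x. f x * pderiv_at i \<phi> x)"
    and c2: "continuous_on UNIV (\<lambda>x. pderiv_at i f x * \<phi> x)"
    using fc f(2) \<phi>c by (auto intro!: continuous_intros)
  have "(LINT x|lborel. f x * pderiv_at i \<phi> x + pderiv_at i f x * \<phi> x) = 0"
    using integral_pderiv_compact_support [of "\<lambda>x. f x * \<phi> x" i K] continuous_on_add [OF c1 c2] K(1,3)
      differentiable_on_mult [OF f(1) smooth_differentiable [OF \<phi>s]]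
    unfolding eq by simp
  moreover have "integrable lborel (\<lambda>x. f x * pderiv_at i \<phi> x)" "integrable lborel (\<lambda>x. pderiv_at i f x * \<phi> x)"
    using zero K(3) by (auto intro!: integrable_lborel_compact_support [OF c1 K(1)] integrable_lborel_compact_support [OF c2 K(1)])
  ultimately have "(LINT x|lborel. f x * pderiv_at i \<phi> x) = - (LINT x|lborel. pderiv_at i f x * \<phi> x)"
    by simp
  moreover have "(LINT x|lebesgue_on U. f x * pderiv_at i \<phi> x) = (LINT x|lborel. f x * pderiv_at i \<phi> x)"
    using K(2) zero c1 by (intro integral_lebesgue_on_eq_lborel U borel_measurable_continuous_onI) auto
  moreover have "(LINT x|lebesgue_on U. pderiv_at i f x * \<phi> x) = (LINT x|lborel. pderiv_at i f x * \<phi> x)"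
    using K(2,3) c2 by (intro integral_lebesgue_on_eq_lborel U borel_measurable_continuous_onI) auto
  ultimately show ?thesis
    by simp
qed

section \<open>The fundamental lemma of the calculus of variations\<close>

text \<open>These functions are closed under differentiation, which yields smoothness at \<open>0\<close>.\<close>

definition flat_poly :: "real poly \<Rightarrow> real \<Rightarrow> real" where
  "flat_poly p t = (if t > 0 then poly p (1 / t) * exp (- 1 / t) else 0)"

text \<open>After the substitution 1/t this is the fact that the exponential outgrows every
  polynomial.\<close>

lemma flat_poly_tendsto_0: "(flat_poly p \<longlongrightarrow> 0) (at_right 0)"
proof -
  have "((\<lambda>x. poly p x / exp x) \<longlongrightarrow> 0) at_top"
  proof -
    have "((\<lambda>x. \<Sum>i\<le>degree p. coeff p i * (x ^ i / exp x)) \<longlongrightarrow> (\<Sum>i\<le>degree p. coeff p i * 0)) at_top"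
      by (intro tendsto_intros tendsto_power_div_exp_0)
    then show ?thesis
      by (simp add: poly_altdef sum_divide_distrib)
  qed
  from filterlim_compose [OF this filterlim_inverse_at_top_right]
  have "((\<lambda>t. poly p (inverse t) / exp (inverse t)) \<longlongrightarrow> 0) (at_right 0)" .
  then show ?thesis
    by (rule Lim_transform_eventually)
       (auto simp: flat_poly_def eventually_at_right_field field_simps exp_minus intro!: exI [of _ 1])
qed

text \<open>Differentiating p(1/t) exp(-1/t) replaces the polynomial p by X^2 (p - p'), where both
  terms come from the inner derivative of 1/t. Only t = 0 needs a limit.\<close>

lemma flat_poly_has_derivative:
  "(flat_poly p has_real_derivative flat_poly ([:0, 0, 1:] * (p - pderiv p)) t) (at t)"
proof (cases t "0 :: real" rule: linorder_cases)
  case less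
  then have "((\<lambda>t. 0) has_real_derivative flat_poly ([:0, 0, 1:] * (p - pderiv p)) t) (at t)"
    by (simp add: flat_poly_def)
  then show ?thesis
    by (rule has_field_derivative_transform_within_open [where S = "{..<0}"])
       (use less in \<open>auto simp: flat_poly_def\<close>)
next
  case greater
  have "((\<lambda>t. poly p (1 / t) * exp (- 1 / t)) has_real_derivative
      poly (pderiv p) (1 / t) * (- 1 / t\<^sup>2) * exp (- 1 / t) + poly p (1 / t) * (exp (- 1 / t) * (1 / t\<^sup>2))) (at t)"
    using greater by (auto intro!: derivative_eq_intros DERIV_chain' [OF _ poly_DERIV] simp: power2_eq_square)
  moreover have "poly (pderiv p) (1 / t) * (- 1 / t\<^sup>2) * exp (- 1 / t) + poly p (1 / t) * (exp (- 1 / t) * (1 / t\<^sup>2))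
      = flat_poly ([:0, 0, 1:] * (p - pderiv p)) t"
    using greater by (simp add: flat_poly_def power2_eq_square field_simps)
  ultimately have "((\<lambda>t. poly p (1 / t) * exp (- 1 / t)) has_real_derivative
      flat_poly ([:0, 0, 1:] * (p - pderiv p)) t) (at t)"
    by simp
  then show ?thesis
    by (rule has_field_derivative_transform_within_open [where S = "{0<..}"])
       (use greater in \<open>auto simp: flat_poly_def\<close>)
next
  case equal
  have "((\<lambda>h. flat_poly p h / h) \<longlongrightarrow> 0) (at 0)"
  proof -
    \<comment> \<open>Division by h multiplies the polynomial by X, so the difference quotient at 0
      is again a function of the same family.\<close>
    have "((\<lambda>h. flat_poly p h / h) \<longlongrightarrow> 0) (at_right 0)"
      by (rule Lim_transform_eventually [OF flat_poly_tendsto_0 [of "[:0, 1:] * p"]])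
         (auto simp: flat_poly_def)
    moreover have "((\<lambda>h. flat_poly p h / h) \<longlongrightarrow> 0) (at_left 0)"
      by (rule Lim_transform_eventually [OF tendsto_const])
         (auto simp: flat_poly_def eventually_at_left_field intro!: exI [of _ "-1"])
    ultimately show ?thesis
      by (simp add: filterlim_at_split)
  qed
  then show ?thesis
    using equal by (simp add: DERIV_def flat_poly_def)
qed

section \<open>Smooth bumps that approximate indicators of boxes\<close>

lemma flat_poly_one: "flat_poly 1 t = (if t > 0 then exp (- 1 / t) else 0)"
  by (simp add: flat_poly_def)

lemma smooth_flat_one: "smooth (\<lambda>x. flat_poly 1 (c * (x $ j) + a))"
proof -
  \<comment> \<open>\<open>q n\<close> is the polynomial belonging to the n-th derivative of
    exp(-1/t); the inner affine map contributes the power \<open>c ^ n\<close> in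
    \<open>d\<close>.\<close>
  define q where "q = rec_nat (1 :: real poly) (\<lambda>n p. [:0, 0, 1:] * (p - pderiv p))"
  define d where "d n t = c ^ n * flat_poly (q n) (c * t + a)" for n t
  have "(d n has_real_derivative d (Suc n) t) (at t)" for n t
  proof -
    have "((\<lambda>t. c * t + a) has_real_derivative c) (at t)"
      by (auto intro!: derivative_eq_intros)
    from DERIV_cmult [OF DERIV_chain2 [OF flat_poly_has_derivative [of "q n"] this], of "c ^ n"]
    show ?thesis
      by (simp add: d_def [abs_def] q_def algebra_simps)
  qed
  from smooth_of_derivative_sequence [of d, OF this, of 0 j] show ?thesis
    by (simp add: d_def q_def)
qed

text \<open>Each factor is exp(-1/(n r)), with r the signed distance of a coordinate from one end of
  its interval: zero for r \<le> 0, and tending to 1 with n for r > 0. The product is a smooth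
  function with values in [0, 1] that tends pointwise to the indicator of the open box.\<close>

definition box_bump :: "real^3 \<Rightarrow> real^3 \<Rightarrow> nat \<Rightarrow> scalar_field" where
  "box_bump a b n x =
     (\<Prod>j\<in>UNIV. flat_poly 1 (real n * (x $ j - a $ j)) * flat_poly 1 (real n * (b $ j - x $ j)))"

lemma box_bump_bounds: "0 \<le> box_bump a b n x" "box_bump a b n x \<le> 1"
  unfolding box_bump_def
  by (auto intro!: prod_nonneg prod_le_1 mult_le_one simp: flat_poly_one)

lemma box_bump_outside:
  assumes "x \<notin> box a b"
  shows "box_bump a b n x = 0"
proof -
  obtain j where "x $ j \<le> a $ j \<or> b $ j \<le> x $ j"
    using assms by (auto simp: mem_box_cart not_less)
  then have "real n * (x $ j - a $ j) \<le> 0 \<or> real n * (b $ j - x $ j) \<le> 0"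
    by (auto intro: mult_nonneg_nonpos)
  then have "flat_poly 1 (real n * (x $ j - a $ j)) * flat_poly 1 (real n * (b $ j - x $ j)) = 0"
    by (auto simp: flat_poly_one)
  then show ?thesis
    unfolding box_bump_def by (intro prod_zero) auto
qed

lemma smooth_box_bump: "smooth (box_bump a b n)"
proof -
  have "smooth (\<lambda>x. flat_poly 1 (real n * (x $ j - a $ j)))"
    "smooth (\<lambda>x. flat_poly 1 (real n * (b $ j - x $ j)))" for j
    using smooth_flat_one [of "real n" j "- (real n * a $ j)"] smooth_flat_one [of "- real n" j "real n * b $ j"]
    by (simp_all add: right_diff_distrib add.commute)
  then show ?thesis
    unfolding box_bump_def [abs_def] by (intro smooth_prod smooth_mult)
qed

lemma box_bump_limit: "(\<lambda>n. box_bump a b n x) \<longlonglongrightarrow> indicator (box a b) x"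
proof (cases "x \<in> box a b")
  case True
  have *: "(\<lambda>n. flat_poly 1 (real n * s)) \<longlonglongrightarrow> 1" if "s > 0" for s
  proof -
    have "(\<lambda>n. exp (- (1 / s) * inverse (real n))) \<longlonglongrightarrow> exp (- (1 / s) * 0)"
      by (intro tendsto_intros lim_inverse_n)
    then have "(\<lambda>n. exp (- (1 / s) * inverse (real n))) \<longlonglongrightarrow> 1" by simp
    then show ?thesis
      by (rule Lim_transform_eventually)
         (use that in \<open>auto simp: flat_poly_one field_simps eventually_sequentially intro!: exI [of _ 1]\<close>)
  qed
  have "(\<lambda>n. \<Prod>j\<in>(UNIV::3 set). flat_poly 1 (real n * (x $ j - a $ j)) * flat_poly 1 (real n * (b $ j - x $ j)))
      \<longlonglongrightarrow> (\<Prod>j\<in>(UNIV::3 set). 1 * 1)"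
    by (intro tendsto_intros *) (use True in \<open>auto simp: mem_box_cart\<close>)
  then show ?thesis
    using True by (simp add: box_bump_def)
qed (simp add: box_bump_outside)

text \<open>Open boxes form an intersection-stable generator of the Borel sets. Inside one box,
  vanishing integrals thus extend from boxes to all Borel sets, and a density is determined by its
  integrals. A countable cover of \<open>U\<close> by closed boxes finishes the argument.\<close>

lemma ae_zero_of_box_integrals:
  fixes f :: "real^3 \<Rightarrow> real"
  assumes U: "open U" and f: "integrable lborel f"
    and box0: "\<And>a b. cbox a b \<subseteq> U \<Longrightarrow> (LINT x:box a b|lborel. f x) = 0"
  shows "AE x in lborel. x \<in> U \<longrightarrow> f x = 0"
proof -
  have fS: "set_integrable lborel S f" if "S \<in> sets borel" for S
    using that f unfolding set_integrable_def by (intro integrable_mult_indicator) simp_all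
  have on_box: "AE x in lborel. indicator (box a b) x *\<^sub>R f x = 0" if ab: "cbox a b \<subseteq> U" for a b
  proof (rule density_unique_real)
    let ?B = "box a b"
    show "integrable lborel (\<lambda>x. indicator ?B x *\<^sub>R f x)"
      using fS [of ?B] by (simp add: set_integrable_def)
    have "(LINT x:(A \<inter> ?B)|lborel. f x) = 0" if "A \<in> sigma_sets UNIV (range (\<lambda>(a, b). box a b))" for A
    proof -
      have "Int_stable (range (\<lambda>(a, b). box a b :: (real^3) set))"
        by (auto simp: Int_stable_def box_Int_box)
      moreover have "range (\<lambda>(a, b). box a b :: (real^3) set) \<subseteq> Pow UNIV"
        by simp
      ultimately show ?thesis using that
      proof (induction rule: sigma_sets_induct_disjoint)
      case (basic A)
      then obtain c d where cd: "A \<inter> ?B = box c d"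
        by (auto simp: box_Int_box)
      \<comment> \<open>If \<open>box c d\<close> is empty, \<open>cbox c d\<close> may still be a
        non-empty degenerate box that leaves \<open>U\<close>, where \<open>box0\<close> says
        nothing; but then the integral is trivially zero.\<close>
      show ?case
      proof (cases "box c d = {}")
        case False
        have sub: "box c d \<subseteq> box a b"
          using cd by blast
        then have "cbox c d \<subseteq> cbox a b"
          using False closure_mono [OF sub] closure_box [of c d] closure_minimal [OF box_subset_cbox closed_cbox, of a b]
          by (metis subset_trans)
        then show ?thesis
          using box0 ab cd by simp
      qed (simp add: cd set_lebesgue_integral_def)
    next
      case (compl A)
      then have A: "A \<in> sets borel" by (simp add: borel_eq_box)
      have "(LINT x:?B|lborel. f x) = (LINT x:(A \<inter> ?B) \<union> ((UNIV - A) \<inter> ?B)|lborel. f x)"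
        by (rule arg_cong [where f = "\<lambda>S. LINT x:S|lborel. f x"]) auto
      also have "\<dots> = (LINT x:(A \<inter> ?B)|lborel. f x) + (LINT x:((UNIV - A) \<inter> ?B)|lborel. f x)"
        by (intro set_integral_Un fS) (use A in auto)
      finally show ?case
        using compl box0 [OF ab] by simp
    next
      case (union A)
      then have "A i \<in> sets borel" for i by (auto simp: borel_eq_box)
      then have A: "A i \<inter> ?B \<in> sets lborel" for i by simp
      have "(LINT x:(\<Union>i. A i \<inter> ?B)|lborel. f x) = (\<Sum>i. LINT x:(A i \<inter> ?B)|lborel. f x)"
        using union(1) A sets.countable_UN' [of UNIV "\<lambda>i. A i \<inter> ?B" lborel]
        by (intro lebesgue_integral_countable_add fS) (auto simp: disjoint_family_on_def)
      then show ?case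
        using union(3) by simp
      qed (auto simp: set_lebesgue_integral_def)
    qed
    then have "(LINT x:(A \<inter> ?B)|lborel. f x) = 0" if "A \<in> sets borel" for A
      using that by (simp add: borel_eq_box)
    then show "(LINT x:A|lborel. indicator ?B x *\<^sub>R f x) = (LINT x:A|lborel. 0)" if "A \<in> sets lborel" for A
      using that by (simp add: set_lebesgue_integral_def indicator_inter_arith mult.assoc)
  qed auto
  obtain \<D> where \<D>: "countable \<D>" "\<D> \<subseteq> Pow U" "\<And>X. X \<in> \<D> \<Longrightarrow> \<exists>a b. X = cbox a b" "\<Union>\<D> = U"
    using open_countable_Union_open_cbox [OF U] by metis
  have "AE x in lborel. x \<in> X \<longrightarrow> f x = 0" if "X \<in> \<D>" for X
  proof -
    obtain a b where X: "X = cbox a b" "cbox a b \<subseteq> U"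
      using \<D>(2,3) \<open>X \<in> \<D>\<close> by (metis PowD subsetD)
    \<comment> \<open>The cover consists of closed boxes while \<open>on_box\<close> concerns open
      ones; the faces in between form a null set.\<close>
    have "negligible (cbox a b - box a b)"
      by (rule negligible_frontier_interval)
    then have "AE x in lebesgue. x \<notin> cbox a b - box a b"
      unfolding negligible_iff_null_sets by (rule AE_not_in)
    then have "AE x in lborel. x \<notin> cbox a b - box a b"
      unfolding AE_completion_iff .
    then show ?thesis
      using on_box [OF X(2)] by eventually_elim (auto simp: X(1) indicator_def split: if_splits)
  qed
  then have "AE x in lborel. \<forall>X\<in>\<D>. x \<in> X \<longrightarrow> f x = 0"
    by (intro AE_ball_countable [OF \<D>(1), THEN iffD2] ballI)
  then show ?thesis
    by eventually_elim (use \<D>(4) in blast)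
qed

text \<open>The bumps \<open>box_bump a b n\<close> are admissible test functions whenever the
  closed box lies in \<open>U\<close>, and dominated convergence turns the hypothesis on them into
  vanishing box integrals.\<close>

lemma fundamental_lemma:
  fixes f :: scalar_field
  assumes U: "open U" and f: "integrable (lebesgue_on U) f"
    and test: "\<And>\<phi>. \<phi> \<in> test_fun U \<Longrightarrow> (LINT x|lebesgue_on U. f x * \<phi> x) = 0"
  shows "AE x in lebesgue_on U. f x = 0"
proof -
  have U': "U \<in> sets lebesgue" using U by simp
  \<comment> \<open>The box argument works with Borel sets, whereas \<open>f\<close> is Lebesgue
    measurable and relevant on \<open>U\<close> only: \<open>F\<close> extends it by zero and
    \<open>g\<close> is a Borel representative of \<open>F\<close>.\<close>
  define F where "F x = indicator U x *\<^sub>R f x" for x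
  have F: "integrable lebesgue F"
    using f U' unfolding F_def by (simp add: integrable_restrict_space)
  then obtain g where g: "g \<in> borel_measurable lborel" "AE x in lborel. F x = g x"
    using completion_ex_borel_measurable_real [of F lborel] by auto
  have ae: "AE x in lebesgue. F x = g x"
    using g(2) by (rule AE_completion)
  have "integrable lebesgue g"
    using F integrable_cong_AE [OF _ _ ae] g(1) measurable_completion borel_measurable_integrable by blast
  then have gi: "integrable lborel g"
    using g(1) integrable_completion by blast
  have "AE x in lborel. x \<in> U \<longrightarrow> g x = 0"
  proof (rule ae_zero_of_box_integrals [OF U gi])
    fix a b assume ab: "cbox a b \<subseteq> U"
    have bm: "box_bump a b n \<in> borel_measurable lborel" for n
      using smooth_box_bump by (simp add: borel_measurable_continuous_onI smooth_continuous)
    have "(LINT x|lborel. g x * box_bump a b n x) = 0" for n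
    proof -
      have "(LINT x|lborel. g x * box_bump a b n x) = (LINT x|lebesgue. g x * box_bump a b n x)"
        using g(1) bm by (simp add: integral_completion)
      also have "\<dots> = (LINT x|lebesgue. F x * box_bump a b n x)"
        using ae borel_measurable_integrable [OF F] measurable_completion [OF g(1)] measurable_completion [OF bm]
        by (intro integral_cong_AE borel_measurable_times) auto
      also have "\<dots> = (LINT x|lebesgue_on U. f x * box_bump a b n x)"
        using U' by (simp add: integral_restrict_space F_def mult.assoc)
      also have "\<dots> = 0"
        using ab box_subset_cbox [of a b]
        by (intro test test_funI [OF smooth_box_bump, of "cbox a b"] box_bump_outside) auto
      finally show ?thesis .
    qed
    moreover have "(\<lambda>n. LINT x|lborel. g x * box_bump a b n x) \<longlonglongrightarrow> (LINT x|lborel. g x * indicator (box a b) x)"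
    proof (rule integral_dominated_convergence)
      show "integrable lborel (\<lambda>x. norm (g x))"
        using gi by simp
      show "AE x in lborel. norm (g x * box_bump a b n x) \<le> norm (g x)" for n
        using box_bump_bounds [of a b n] by (simp add: abs_mult mult_left_le)
      show "AE x in lborel. (\<lambda>n. g x * box_bump a b n x) \<longlonglongrightarrow> g x * indicator (box a b) x"
        by (intro AE_I2 tendsto_intros box_bump_limit)
    qed (use g(1) bm in \<open>auto intro!: borel_measurable_times\<close>)
    ultimately show "(LINT x:box a b|lborel. g x) = 0"
      by (simp add: set_lebesgue_integral_def mult.commute LIMSEQ_const_iff)
  qed
  then have "AE x in lebesgue. x \<in> U \<longrightarrow> g x = 0"
    by (rule AE_completion)
  then have "AE x in lebesgue. x \<in> U \<longrightarrow> f x = 0"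
    using ae by eventually_elim (auto simp: F_def)
  then show ?thesis
    using U' by (simp add: AE_restrict_space_iff)
qed

section \<open>The space of square integrable functions\<close>

lemma L2_measurable: "f \<in> L2 \<Omega> \<Longrightarrow> f \<in> borel_measurable (lebesgue_on \<Omega>)"
  and L2_integrable_square: "f \<in> L2 \<Omega> \<Longrightarrow> integrable (lebesgue_on \<Omega>) (\<lambda>x. (norm (f x))\<^sup>2)"
  by (simp_all add: L2_def)

lemma integrable_inner_L2:
  assumes "f \<in> L2 \<Omega>" "g \<in> L2 \<Omega>"
  shows "integrable (lebesgue_on \<Omega>) (\<lambda>x. f x \<bullet> g x)"
proof (rule Bochner_Integration.integrable_bound)
  show "integrable (lebesgue_on \<Omega>) (\<lambda>x. (norm (f x))\<^sup>2 + (norm (g x))\<^sup>2)"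
    using assms by (intro Bochner_Integration.integrable_add L2_integrable_square)
  show "(\<lambda>x. f x \<bullet> g x) \<in> borel_measurable (lebesgue_on \<Omega>)"
    using assms by (intro borel_measurable_inner L2_measurable)
  show "AE x in lebesgue_on \<Omega>. norm (f x \<bullet> g x) \<le> norm ((norm (f x))\<^sup>2 + (norm (g x))\<^sup>2)"
  proof (rule AE_I2)
    fix x
    have "\<bar>f x \<bullet> g x\<bar> \<le> norm (f x) * norm (g x)"
      by (rule Cauchy_Schwarz_ineq2)
    also have "\<dots> \<le> (norm (f x))\<^sup>2 + (norm (g x))\<^sup>2"
      using sum_squares_bound [of "norm (f x)" "norm (g x)"] mult_nonneg_nonneg [OF norm_ge_zero norm_ge_zero, of "f x" "g x"]
      by linarith
    finally show "norm (f x \<bullet> g x) \<le> norm ((norm (f x))\<^sup>2 + (norm (g x))\<^sup>2)"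
      by simp
  qed
qed

lemma L2_add:
  assumes "f \<in> L2 \<Omega>" "g \<in> L2 \<Omega>"
  shows "(\<lambda>x. f x + g x) \<in> L2 \<Omega>"
proof -
  have "(norm (f x + g x))\<^sup>2 = (norm (f x))\<^sup>2 + 2 * (f x \<bullet> g x) + (norm (g x))\<^sup>2" for x
    by (simp add: power2_norm_eq_inner inner_add inner_commute)
  moreover have "integrable (lebesgue_on \<Omega>) (\<lambda>x. (norm (f x))\<^sup>2 + 2 * (f x \<bullet> g x) + (norm (g x))\<^sup>2)"
    using assms
    by (intro Bochner_Integration.integrable_add L2_integrable_square integrable_mult_right integrable_inner_L2)
  moreover have "(\<lambda>x. f x + g x) \<in> borel_measurable (lebesgue_on \<Omega>)"
    using assms by (intro borel_measurable_add L2_measurable)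
  ultimately show ?thesis
    by (simp add: L2_def)
qed

lemma L2_scaleR: "f \<in> L2 \<Omega> \<Longrightarrow> (\<lambda>x. c *\<^sub>R f x) \<in> L2 \<Omega>"
  by (simp add: L2_def power_mult_distrib borel_measurable_scaleR)

lemma L2_diff:
  assumes "f \<in> L2 \<Omega>" "g \<in> L2 \<Omega>"
  shows "(\<lambda>x. f x - g x) \<in> L2 \<Omega>"
  using L2_add [OF assms(1) L2_scaleR [OF assms(2), of "-1"]] by simp

lemma L2_zero: "(\<lambda>x. 0) \<in> L2 \<Omega>"
  by (simp add: L2_def)

lemma L2_component:
  fixes f :: "real^3 \<Rightarrow> 'a::euclidean_space^'n"
  assumes "f \<in> L2 \<Omega>"
  shows "(\<lambda>x. f x $ i) \<in> L2 \<Omega>"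
proof -
  have m: "(\<lambda>x. f x $ i) \<in> borel_measurable (lebesgue_on \<Omega>)"
    using measurable_compose [OF L2_measurable [OF assms] borel_measurable_continuous_onI, of "\<lambda>v. v $ i"]
    by (simp add: continuous_on_component)
  moreover have "integrable (lebesgue_on \<Omega>) (\<lambda>x. (norm (f x $ i))\<^sup>2)"
  proof (rule Bochner_Integration.integrable_bound [OF L2_integrable_square [OF assms]])
    show "(\<lambda>x. (norm (f x $ i))\<^sup>2) \<in> borel_measurable (lebesgue_on \<Omega>)"
      using m by simp
    show "AE x in lebesgue_on \<Omega>. norm ((norm (f x $ i))\<^sup>2) \<le> norm ((norm (f x))\<^sup>2)"
      by (auto intro!: AE_I2 power_mono Finite_Cartesian_Product.norm_nth_le)
  qed
  ultimately show ?thesis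
    by (simp add: L2_def)
qed

lemma L2_vecI:
  fixes f :: "real^3 \<Rightarrow> 'a::euclidean_space^'n"
  assumes "\<And>i. (\<lambda>x. f x $ i) \<in> L2 \<Omega>"
  shows "f \<in> L2 \<Omega>"
proof -
  have "(\<lambda>x. f x \<bullet> b) \<in> borel_measurable (lebesgue_on \<Omega>)" if b: "b \<in> Basis" for b
  proof -
    obtain i u where "b = axis i u"
      using b unfolding Basis_vec_def by blast
    then show ?thesis
      using L2_measurable [OF assms [of i]] by (simp add: inner_axis)
  qed
  then have "f \<in> borel_measurable (lebesgue_on \<Omega>)"
    by (subst borel_measurable_euclidean_space) auto
  moreover have "(norm (f x))\<^sup>2 = (\<Sum>i\<in>UNIV. (norm (f x $ i))\<^sup>2)" for x
    by (simp add: power2_norm_eq_inner inner_vec_def)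
  moreover have "integrable (lebesgue_on \<Omega>) (\<lambda>x. \<Sum>i\<in>UNIV. (norm (f x $ i))\<^sup>2)"
    by (intro Bochner_Integration.integrable_sum L2_integrable_square assms)
  ultimately show ?thesis
    by (simp add: L2_def)
qed

lemma L2_sum: "(\<And>i. i \<in> I \<Longrightarrow> f i \<in> L2 \<Omega>) \<Longrightarrow> (\<lambda>x. \<Sum>i\<in>I. f i x) \<in> L2 \<Omega>"
  by (induction I rule: infinite_finite_induct) (auto intro: L2_zero L2_add)

lemma L2_continuous:
  assumes "bounded \<Omega>" "continuous_on (closure \<Omega>) f" "\<Omega> \<in> sets lebesgue"
  shows "f \<in> L2 \<Omega>"
proof -
  have "compact (f ` closure \<Omega>)"
    using assms by (intro compact_continuous_image) auto
  then obtain B where B: "\<And>x. x \<in> closure \<Omega> \<Longrightarrow> norm (f x) \<le> B"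
    using compact_imp_bounded bounded_iff by (metis imageI)
  have m: "f \<in> borel_measurable (lebesgue_on \<Omega>)"
    using assms closure_subset
    by (intro continuous_imp_measurable_on_sets_lebesgue) (auto intro: continuous_on_subset)
  have "\<Omega> \<in> lmeasurable"
    using assms by (simp add: bounded_set_imp_lmeasurable)
  then have "finite_measure (lebesgue_on \<Omega>)"
    by (rule finite_measure_lebesgue_on)
  then have "integrable (lebesgue_on \<Omega>) (\<lambda>x. (norm (f x))\<^sup>2)"
  proof (rule finite_measure.integrable_const_bound)
    show "AE x in lebesgue_on \<Omega>. norm ((norm (f x))\<^sup>2) \<le> B\<^sup>2"
      using B closure_subset [of \<Omega>] by (intro AE_I2) (auto intro!: power_mono)
  qed (use m in simp)
  then show ?thesis
    using m by (simp add: L2_def)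
qed

lemma ip_commute: "ip \<Omega> f g = ip \<Omega> g f"
  by (simp add: ip_def inner_commute)

lemma ip_add_left:
  "f \<in> L2 \<Omega> \<Longrightarrow> g \<in> L2 \<Omega> \<Longrightarrow> k \<in> L2 \<Omega> \<Longrightarrow> ip \<Omega> (\<lambda>x. f x + g x) k = ip \<Omega> f k + ip \<Omega> g k"
  by (simp add: ip_def inner_add integrable_inner_L2)

lemma ip_diff_left:
  "f \<in> L2 \<Omega> \<Longrightarrow> g \<in> L2 \<Omega> \<Longrightarrow> k \<in> L2 \<Omega> \<Longrightarrow> ip \<Omega> (\<lambda>x. f x - g x) k = ip \<Omega> f k - ip \<Omega> g k"
  by (simp add: ip_def inner_diff integrable_inner_L2)

lemma ip_scaleR_left: "ip \<Omega> (\<lambda>x. c *\<^sub>R f x) k = c * ip \<Omega> f k"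
  by (simp add: ip_def)

lemma ip_add_right:
  "f \<in> L2 \<Omega> \<Longrightarrow> g \<in> L2 \<Omega> \<Longrightarrow> k \<in> L2 \<Omega> \<Longrightarrow> ip \<Omega> k (\<lambda>x. f x + g x) = ip \<Omega> k f + ip \<Omega> k g"
  by (simp add: ip_def inner_add integrable_inner_L2)

lemma ip_diff_right:
  "f \<in> L2 \<Omega> \<Longrightarrow> g \<in> L2 \<Omega> \<Longrightarrow> k \<in> L2 \<Omega> \<Longrightarrow> ip \<Omega> k (\<lambda>x. f x - g x) = ip \<Omega> k f - ip \<Omega> k g"
  by (simp add: ip_def inner_diff integrable_inner_L2)

lemma ip_scaleR_right: "ip \<Omega> k (\<lambda>x. c *\<^sub>R f x) = c * ip \<Omega> k f"
  by (simp add: ip_def)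

lemma ip_zero_left: "ip \<Omega> (\<lambda>x. 0) k = 0" and ip_zero_right: "ip \<Omega> k (\<lambda>x. 0) = 0"
  by (simp_all add: ip_def)

lemma ip_cong:
  "(\<And>x. x \<in> \<Omega> \<Longrightarrow> f x = f' x) \<Longrightarrow> (\<And>x. x \<in> \<Omega> \<Longrightarrow> g x = g' x) \<Longrightarrow> ip \<Omega> f g = ip \<Omega> f' g'"
  unfolding ip_def by (intro Bochner_Integration.integral_cong) auto

lemma ip_cong_ae:
  assumes "eq_ae \<Omega> f f'" "eq_ae \<Omega> g g'" "f \<in> L2 \<Omega>" "f' \<in> L2 \<Omega>" "g \<in> L2 \<Omega>" "g' \<in> L2 \<Omega>"
  shows "ip \<Omega> f g = ip \<Omega> f' g'"
  unfolding ip_def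
proof (rule integral_cong_AE)
  show "AE x in lebesgue_on \<Omega>. f x \<bullet> g x = f' x \<bullet> g' x"
    using assms(1,2) unfolding eq_ae_def by eventually_elim simp
qed (intro borel_measurable_inner L2_measurable assms)+

lemma ip_vec:
  fixes f g :: "real^3 \<Rightarrow> 'a::euclidean_space^'n"
  assumes "f \<in> L2 \<Omega>" "g \<in> L2 \<Omega>"
  shows "ip \<Omega> f g = (\<Sum>i\<in>UNIV. ip \<Omega> (\<lambda>x. f x $ i) (\<lambda>x. g x $ i))"
  unfolding ip_def inner_vec_def
  by (intro Bochner_Integration.integral_sum integrable_inner_L2 L2_component assms)

lemma ip_sum_right:
  assumes "k \<in> L2 \<Omega>" "\<And>i. i \<in> I \<Longrightarrow> f i \<in> L2 \<Omega>"
  shows "ip \<Omega> k (\<lambda>x. \<Sum>i\<in>I. f i x) = (\<Sum>i\<in>I. ip \<Omega> k (f i))"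
  unfolding ip_def inner_sum_right
  by (intro Bochner_Integration.integral_sum integrable_inner_L2 assms)

lemma ip_self_nonneg: "0 \<le> ip \<Omega> f f"
  by (simp add: ip_def)

lemma ip_self_eq_0:
  assumes "f \<in> L2 \<Omega>" "ip \<Omega> f f = 0"
  shows "eq_ae \<Omega> f (\<lambda>x. 0)"
  using assms integral_nonneg_eq_0_iff_AE [OF integrable_inner_L2 [OF assms(1,1)]]
  by (simp add: ip_def eq_ae_def)

text \<open>The quadratic polynomial t -> |f + t g|^2 is nonnegative. Its value at the minimiser
  gives the bound; if its leading coefficient vanishes, the linear term must vanish as well.\<close>

lemma ip_Cauchy_Schwarz:
  assumes f: "f \<in> L2 \<Omega>" and g: "g \<in> L2 \<Omega>"
  shows "\<bar>ip \<Omega> f g\<bar> \<le> L2_norm \<Omega> f * L2_norm \<Omega> g"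
proof -
  have *: "0 \<le> ip \<Omega> g g * t\<^sup>2 + (2 * ip \<Omega> f g) * t + ip \<Omega> f f" for t
  proof -
    have "ip \<Omega> (\<lambda>x. f x + t *\<^sub>R g x) (\<lambda>x. f x + t *\<^sub>R g x) = ip \<Omega> g g * t\<^sup>2 + (2 * ip \<Omega> f g) * t + ip \<Omega> f f"
      using f g L2_scaleR [OF g, of t]
      by (simp add: ip_add_left ip_add_right L2_add ip_scaleR_left ip_scaleR_right ip_commute [of _ g f]
          power2_eq_square algebra_simps)
    then show ?thesis
      using ip_self_nonneg [of \<Omega> "\<lambda>x. f x + t *\<^sub>R g x"] by simp
  qed
  have "(ip \<Omega> f g)\<^sup>2 \<le> ip \<Omega> f f * ip \<Omega> g g"
  proof (cases "ip \<Omega> g g = 0")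
    case True
    have "ip \<Omega> f g = 0"
    proof (rule ccontr)
      assume "ip \<Omega> f g \<noteq> 0"
      \<comment> \<open>At the chosen argument the remaining affine function takes the value
        -1.\<close>
      then show False
        using * [of "- (ip \<Omega> f f + 1) / (2 * ip \<Omega> f g)"] True by (simp add: field_simps)
    qed
    then show ?thesis using True by simp
  next
    case False
    then have "ip \<Omega> g g > 0"
      using ip_self_nonneg [of \<Omega> g] by simp
    then show ?thesis
      using * [of "- ip \<Omega> f g / ip \<Omega> g g"] by (simp add: field_simps power2_eq_square)
  qed
  then have "sqrt ((ip \<Omega> f g)\<^sup>2) \<le> sqrt (ip \<Omega> f f * ip \<Omega> g g)"
    by (rule real_sqrt_le_mono)
  then show ?thesis
    by (simp add: L2_norm_def real_sqrt_mult)
qed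

lemma eq_ae_refl: "eq_ae \<Omega> f f"
  by (simp add: eq_ae_def)

lemma eq_ae_sym: "eq_ae \<Omega> f g \<Longrightarrow> eq_ae \<Omega> g f"
  by (simp add: eq_ae_def eq_commute)

lemma eq_ae_trans: "eq_ae \<Omega> f g \<Longrightarrow> eq_ae \<Omega> g k \<Longrightarrow> eq_ae \<Omega> f k"
  unfolding eq_ae_def by (erule (1) eventually_elim2) simp

lemma eq_ae_add: "eq_ae \<Omega> f f' \<Longrightarrow> eq_ae \<Omega> g g' \<Longrightarrow> eq_ae \<Omega> (\<lambda>x. f x + g x) (\<lambda>x. f' x + g' x)"
  unfolding eq_ae_def by (erule (1) eventually_elim2) simp

lemma eq_ae_diff: "eq_ae \<Omega> f f' \<Longrightarrow> eq_ae \<Omega> g g' \<Longrightarrow> eq_ae \<Omega> (\<lambda>x. f x - g x) (\<lambda>x. f' x - g' x)"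
  unfolding eq_ae_def by (erule (1) eventually_elim2) simp

lemma eq_ae_scaleR: "eq_ae \<Omega> f f' \<Longrightarrow> eq_ae \<Omega> (\<lambda>x. c *\<^sub>R f x) (\<lambda>x. c *\<^sub>R f' x)"
  unfolding eq_ae_def by (erule eventually_mono) simp

lemma eq_ae_componentI:
  fixes f g :: "real^3 \<Rightarrow> 'a::euclidean_space^'n"
  assumes "\<And>i. eq_ae \<Omega> (\<lambda>x. f x $ i) (\<lambda>x. g x $ i)"
  shows "eq_ae \<Omega> f g"
proof -
  have "AE x in lebesgue_on \<Omega>. \<forall>i\<in>UNIV. f x $ i = g x $ i"
    using assms by (intro AE_finite_allI) (auto simp: eq_ae_def)
  then show ?thesis
    unfolding eq_ae_def by eventually_elim (simp add: vec_eq_iff)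
qed

lemma eq_ae_subset:
  assumes "eq_ae \<Omega> f g" "\<Omega> \<in> sets lebesgue" "S \<in> sets lebesgue" "S \<subseteq> \<Omega>"
  shows "eq_ae S f g"
proof -
  have "AE x in lebesgue. x \<in> \<Omega> \<longrightarrow> f x = g x"
    using assms by (simp add: eq_ae_def AE_restrict_space_iff)
  then have "AE x in lebesgue. x \<in> S \<longrightarrow> f x = g x"
    by eventually_elim (use assms(4) in auto)
  then show ?thesis
    using assms by (simp add: eq_ae_def AE_restrict_space_iff)
qed

text \<open>Measurability survives a change on a null set because Lebesgue measure is complete. This
  makes fields that are known only through an almost everywhere formula accessible to the inner
  product lemmas.\<close>

lemma L2_eq_ae:
  assumes "eq_ae \<Omega> f g" "f \<in> L2 \<Omega>" "\<Omega> \<in> sets lebesgue"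
  shows "g \<in> L2 \<Omega>"
proof -
  have ae: "AE x in lebesgue_on \<Omega>. f x = g x"
    using assms by (simp add: eq_ae_def)
  have "(\<lambda>x. indicator \<Omega> x *\<^sub>R f x) \<in> borel_measurable lebesgue"
    using L2_measurable [OF assms(2)] assms(3) by (simp add: borel_measurable_restrict_space_iff)
  moreover have "AE x in lebesgue. x \<in> \<Omega> \<longrightarrow> f x = g x"
    using ae assms by (simp add: AE_restrict_space_iff)
  then have "AE x in lebesgue. indicator \<Omega> x *\<^sub>R f x = indicator \<Omega> x *\<^sub>R g x"
    by eventually_elim (auto simp: indicator_def)
  ultimately have "(\<lambda>x. indicator \<Omega> x *\<^sub>R g x) \<in> borel_measurable lebesgue"
    by (rule borel_measurable_AE)
  then have g: "g \<in> borel_measurable (lebesgue_on \<Omega>)"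
    using assms(3) by (simp add: borel_measurable_restrict_space_iff)
  moreover have "integrable (lebesgue_on \<Omega>) (\<lambda>x. (norm (g x))\<^sup>2)"
  proof (rule integrable_cong_AE_imp [OF L2_integrable_square [OF assms(2)]])
    show "AE x in lebesgue_on \<Omega>. (norm (f x))\<^sup>2 = (norm (g x))\<^sup>2"
      using ae by eventually_elim simp
  qed (use g in simp)
  ultimately show ?thesis
    by (simp add: L2_def)
qed

section \<open>Weak derivatives\<close>

text \<open>Kept separate from the mesh so that the same results can be interpreted both for
  \<Omega> and for the interior of a mesh element.\<close>

locale bounded_open =
  fixes \<Omega> :: "(real^3) set"
  assumes open_domain: "open \<Omega>" and bounded_domain: "bounded \<Omega>"
begin

lemma measurable_domain: "\<Omega> \<in> sets lebesgue"
  using open_domain by simp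

lemma L2_of_continuous: "continuous_on (closure \<Omega>) f \<Longrightarrow> f \<in> L2 \<Omega>"
  using L2_continuous bounded_domain measurable_domain by blast

lemma L2_smooth: "smooth f \<Longrightarrow> f \<in> L2 \<Omega>"
  by (meson L2_of_continuous smooth_continuous continuous_on_subset subset_UNIV)

lemma L2_test_fun: "\<phi> \<in> test_fun U \<Longrightarrow> \<phi> \<in> L2 \<Omega>"
  by (simp add: L2_smooth test_fun_smooth)

lemma L2_smooth_vec: "smooth_vec \<phi> \<Longrightarrow> \<phi> \<in> L2 \<Omega>"
  by (intro L2_vecI L2_smooth) (simp add: smooth_vec_def)

lemma test_vec_smooth_vec: "\<phi> \<in> test_vec U \<Longrightarrow> smooth_vec \<phi>"
  by (auto simp: test_vec_def smooth_vec_def intro: test_fun_smooth)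

lemma ip_test_fun_eq_0_imp:
  assumes "f \<in> L2 \<Omega>" "\<And>\<phi>. \<phi> \<in> test_fun \<Omega> \<Longrightarrow> ip \<Omega> f \<phi> = 0"
  shows "eq_ae \<Omega> f (\<lambda>x. 0)"
  unfolding eq_ae_def
proof (rule fundamental_lemma [OF open_domain])
  \<comment> \<open>On a bounded domain the constant 1 is square integrable, so \<open>f\<close> is
    integrable as its product with 1.\<close>
  show "integrable (lebesgue_on \<Omega>) f"
    using integrable_inner_L2 [OF assms(1) L2_smooth [OF smooth_const [of 1]]] by simp
qed (use assms(2) in \<open>simp add: ip_def\<close>)

lemma eq_ae_if_ip_test_fun:
  assumes "f \<in> L2 \<Omega>" "g \<in> L2 \<Omega>" "\<And>\<phi>. \<phi> \<in> test_fun \<Omega> \<Longrightarrow> ip \<Omega> f \<phi> = ip \<Omega> g \<phi>"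
  shows "eq_ae \<Omega> f g"
proof -
  have "eq_ae \<Omega> (\<lambda>x. f x - g x) (\<lambda>x. 0)"
    using assms by (intro ip_test_fun_eq_0_imp) (simp_all add: L2_diff ip_diff_left L2_test_fun)
  then show ?thesis
    by (simp add: eq_ae_def)
qed

lemma is_weak_grad_unique:
  assumes "is_weak_grad \<Omega> f g" "is_weak_grad \<Omega> f g'"
  shows "eq_ae \<Omega> g g'"
proof (rule eq_ae_componentI, rule eq_ae_if_ip_test_fun)
  fix i
  show "(\<lambda>x. g x $ i) \<in> L2 \<Omega>" "(\<lambda>x. g' x $ i) \<in> L2 \<Omega>"
    using assms by (simp_all add: is_weak_grad_def L2_component)
  fix \<phi> assume "\<phi> \<in> test_fun \<Omega>"
  then show "ip \<Omega> (\<lambda>x. g x $ i) \<phi> = ip \<Omega> (\<lambda>x. g' x $ i) \<phi>"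
    using assms unfolding is_weak_grad_def by (metis neg_equal_iff_equal)
qed

lemma is_weak_grad_cong:
  assumes "\<And>x. x \<in> \<Omega> \<Longrightarrow> f x = f' x"
  shows "is_weak_grad \<Omega> f g = is_weak_grad \<Omega> f' g"
proof -
  have "ip \<Omega> f k = ip \<Omega> f' k" for k
    by (rule ip_cong) (use assms in auto)
  then show ?thesis
    by (simp add: is_weak_grad_def)
qed

text \<open>Both functions have the same set of weak gradients, so \<open>SOME\<close> picks the
  same representative. The result is an equality of functions and not only one almost
  everywhere.\<close>

lemma wgrad_cong: "(\<And>x. x \<in> \<Omega> \<Longrightarrow> f x = f' x) \<Longrightarrow> wgrad \<Omega> f = wgrad \<Omega> f'"
  using is_weak_grad_cong [of f f'] by (simp add: wgrad_def)

lemma is_weak_grad_wgrad: "f \<in> H1 \<Omega> \<Longrightarrow> is_weak_grad \<Omega> f (wgrad \<Omega> f)"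
  unfolding wgrad_def H1_def using someI_ex [of "is_weak_grad \<Omega> f"] by blast

lemma L2_wgrad: "f \<in> H1 \<Omega> \<Longrightarrow> wgrad \<Omega> f \<in> L2 \<Omega>"
  using is_weak_grad_wgrad is_weak_grad_def by blast

lemma is_weak_grad_diff:
  assumes "f \<in> L2 \<Omega>" "f' \<in> L2 \<Omega>" "is_weak_grad \<Omega> f g" "is_weak_grad \<Omega> f' g'"
  shows "is_weak_grad \<Omega> (\<lambda>x. f x - f' x) (\<lambda>x. g x - g' x)"
  using assms L2_component [of g \<Omega>] L2_component [of g' \<Omega>]
  by (simp add: is_weak_grad_def L2_diff ip_diff_left L2_test_fun [OF test_fun_pderiv] L2_test_fun)

lemma H1_diff: "f \<in> H1 \<Omega> \<Longrightarrow> g \<in> H1 \<Omega> \<Longrightarrow> (\<lambda>x. f x - g x) \<in> H1 \<Omega>"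
  unfolding H1_def using L2_diff is_weak_grad_diff by blast

lemma wgrad_diff:
  assumes "f \<in> H1 \<Omega>" "g \<in> H1 \<Omega>"
  shows "eq_ae \<Omega> (wgrad \<Omega> (\<lambda>x. f x - g x)) (\<lambda>x. wgrad \<Omega> f x - wgrad \<Omega> g x)"
  using assms
  by (intro is_weak_grad_unique [OF is_weak_grad_wgrad is_weak_grad_diff] H1_diff is_weak_grad_wgrad)
     (simp_all add: H1_def)

section \<open>Weak and classical curls\<close>

lemma smooth_vec_classical_curl: "smooth_vec \<phi> \<Longrightarrow> smooth_vec (classical_curl \<phi>)"
  unfolding smooth_vec_def classical_curl_def forall_3
  by (simp add: vector_3 smooth_diff smooth_pderiv)

lemma test_vec_classical_curl: "\<phi> \<in> test_vec U \<Longrightarrow> classical_curl \<phi> \<in> test_vec U"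
  unfolding test_vec_def classical_curl_def mem_Collect_eq forall_3
  by (simp add: vector_3 test_fun_diff test_fun_pderiv)

lemma L2_classical_curl: "smooth_vec \<phi> \<Longrightarrow> classical_curl \<phi> \<in> L2 \<Omega>"
  by (simp add: L2_smooth_vec smooth_vec_classical_curl)

lemma is_weak_curl_unique:
  assumes "is_weak_curl \<Omega> D C" "is_weak_curl \<Omega> D C'"
  shows "eq_ae \<Omega> C C'"
proof (rule eq_ae_componentI, rule eq_ae_if_ip_test_fun)
  fix i
  show "(\<lambda>x. C x $ i) \<in> L2 \<Omega>" "(\<lambda>x. C' x $ i) \<in> L2 \<Omega>"
    using assms by (simp_all add: is_weak_curl_def L2_component)
  fix \<phi> assume \<phi>: "\<phi> \<in> test_fun \<Omega>"
  \<comment> \<open>A scalar test function placed in slot \<open>i\<close> isolates the i-th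
    component of the weak curl.\<close>
  have "(\<lambda>x. axis i (\<phi> x)) \<in> test_vec \<Omega>"
    unfolding test_vec_def
  proof (intro CollectI allI)
    show "(\<lambda>x. axis i (\<phi> x) $ j) \<in> test_fun \<Omega>" for j
      using \<phi> zero_test_fun by (cases "j = i") (simp_all add: axis_def)
  qed
  then have "ip \<Omega> C (\<lambda>x. axis i (\<phi> x)) = ip \<Omega> C' (\<lambda>x. axis i (\<phi> x))"
    using assms unfolding is_weak_curl_def by metis
  then show "ip \<Omega> (\<lambda>x. C x $ i) \<phi> = ip \<Omega> (\<lambda>x. C' x $ i) \<phi>"
    by (simp add: ip_def inner_axis)
qed

lemma is_weak_curl_wcurl: "D \<in> H_curl \<Omega> \<Longrightarrow> is_weak_curl \<Omega> D (wcurl \<Omega> D)"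
  unfolding wcurl_def H_curl_def using someI_ex [of "is_weak_curl \<Omega> D"] by blast

lemma L2_wcurl: "D \<in> H_curl \<Omega> \<Longrightarrow> wcurl \<Omega> D \<in> L2 \<Omega>"
  using is_weak_curl_wcurl is_weak_curl_def by blast

lemma is_weak_curl_add_scaled:
  assumes "D \<in> L2 \<Omega>" "D' \<in> L2 \<Omega>" "is_weak_curl \<Omega> D C" "is_weak_curl \<Omega> D' C'"
  shows "is_weak_curl \<Omega> (\<lambda>x. D x + c *\<^sub>R D' x) (\<lambda>x. C x + c *\<^sub>R C' x)"
  using assms L2_scaleR [of D' \<Omega> c] L2_scaleR [of C' \<Omega> c]
  by (simp add: is_weak_curl_def L2_add ip_add_left ip_scaleR_left L2_classical_curl
      L2_smooth_vec test_vec_smooth_vec)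

lemma is_weak_curl_eq_ae:
  assumes "eq_ae \<Omega> D D'" "D \<in> L2 \<Omega>" "is_weak_curl \<Omega> D C"
  shows "is_weak_curl \<Omega> D' C"
proof -
  have "ip \<Omega> D (classical_curl \<phi>) = ip \<Omega> D' (classical_curl \<phi>)" if "\<phi> \<in> test_vec \<Omega>" for \<phi>
    using that L2_eq_ae [OF assms(1,2) measurable_domain]
    by (intro ip_cong_ae assms eq_ae_refl) (auto intro: L2_classical_curl test_vec_smooth_vec)
  then show ?thesis
    using assms(3) by (simp add: is_weak_curl_def)
qed

lemma H_curl_add_scaled:
  "D \<in> H_curl \<Omega> \<Longrightarrow> D' \<in> H_curl \<Omega> \<Longrightarrow> (\<lambda>x. D x + c *\<^sub>R D' x) \<in> H_curl \<Omega>"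
  unfolding H_curl_def using is_weak_curl_add_scaled L2_add L2_scaleR by blast

lemma H_curl_eq_ae: "eq_ae \<Omega> D D' \<Longrightarrow> D \<in> H_curl \<Omega> \<Longrightarrow> D' \<in> H_curl \<Omega>"
  unfolding H_curl_def using is_weak_curl_eq_ae L2_eq_ae measurable_domain by blast

lemma wcurl_add_scaled:
  assumes "D \<in> H_curl \<Omega>" "D' \<in> H_curl \<Omega>"
  shows "eq_ae \<Omega> (wcurl \<Omega> (\<lambda>x. D x + c *\<^sub>R D' x)) (\<lambda>x. wcurl \<Omega> D x + c *\<^sub>R wcurl \<Omega> D' x)"
  using assms
  by (intro is_weak_curl_unique [OF is_weak_curl_wcurl is_weak_curl_add_scaled] H_curl_add_scaled is_weak_curl_wcurl)
     (simp_all add: H_curl_def)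

lemma wcurl_eq_ae:
  assumes "eq_ae \<Omega> D D'" "D \<in> H_curl \<Omega>"
  shows "eq_ae \<Omega> (wcurl \<Omega> D) (wcurl \<Omega> D')"
  using assms H_curl_eq_ae is_weak_curl_wcurl is_weak_curl_eq_ae is_weak_curl_unique H_curl_def
  by (metis (no_types, lifting) mem_Collect_eq)

text \<open>The six mixed second derivatives cancel in pairs by their symmetry. Both orthogonality
  relations between gradients and curls below rest on this cancellation.\<close>

lemma divergence_classical_curl:
  assumes "smooth_vec \<phi>"
  shows "(\<Sum>i\<in>UNIV. pderiv_at i (\<lambda>x. classical_curl \<phi> x $ i) x) = 0"
proof -
  have s: "smooth (\<lambda>x. \<phi> x $ i)" for i
    using assms by (simp add: smooth_vec_def)
  have diff: "pderiv_at i (\<lambda>x. pderiv_at j (\<lambda>x. \<phi> x $ k) x - pderiv_at l (\<lambda>x. \<phi> x $ m) x) x =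
      pderiv_at i (pderiv_at j (\<lambda>x. \<phi> x $ k)) x - pderiv_at i (pderiv_at l (\<lambda>x. \<phi> x $ m)) x" for i j k l m
    using pderiv_at_eqI [OF has_derivative_diff [OF has_derivative_frechet has_derivative_frechet],
        OF smooth_differentiable [OF smooth_pderiv [OF s]] smooth_differentiable [OF smooth_pderiv [OF s]]]
    by (simp add: pderiv_at_def)
  have comm: "pderiv_at i (pderiv_at j (\<lambda>x. \<phi> x $ k)) x = pderiv_at j (pderiv_at i (\<lambda>x. \<phi> x $ k)) x" for i j k
    using s [of k] by (intro pderiv_at_commute) (simp add: smooth_def)
  show ?thesis
    using comm [of 1 2 3] comm [of 1 3 2] comm [of 2 3 1]
    by (simp add: sum_3 classical_curl_def vector_3 diff)
qed

text \<open>The components of the curl of a test field are test functions, so the weak gradient can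
  be moved onto them; what remains is \<open>f\<close> paired with a divergence of a curl.\<close>

lemma is_weak_curl_wgrad:
  assumes f: "f \<in> H1 \<Omega>"
  shows "is_weak_curl \<Omega> (wgrad \<Omega> f) (\<lambda>x. 0)"
proof -
  have "ip \<Omega> (wgrad \<Omega> f) (classical_curl \<phi>) = 0" if \<phi>: "\<phi> \<in> test_vec \<Omega>" for \<phi>
  proof -
    let ?\<psi> = "\<lambda>i x. classical_curl \<phi> x $ i"
    have \<psi>: "?\<psi> i \<in> test_fun \<Omega>" for i
      using test_vec_classical_curl [OF \<phi>] by (simp add: test_vec_def)
    have "ip \<Omega> (wgrad \<Omega> f) (classical_curl \<phi>) = (\<Sum>i\<in>UNIV. ip \<Omega> (\<lambda>x. wgrad \<Omega> f x $ i) (?\<psi> i))"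
      by (intro ip_vec L2_wgrad f L2_classical_curl test_vec_smooth_vec [OF \<phi>])
    also have "\<dots> = (\<Sum>i\<in>UNIV. - ip \<Omega> f (pderiv_at i (?\<psi> i)))"
      using is_weak_grad_wgrad [OF f] \<psi> by (simp add: is_weak_grad_def)
    also have "\<dots> = - ip \<Omega> f (\<lambda>x. \<Sum>i\<in>UNIV. pderiv_at i (?\<psi> i) x)"
      using f by (subst ip_sum_right) (auto simp: H1_def sum_negf intro!: L2_test_fun test_fun_pderiv \<psi>)
    also have "\<dots> = 0"
      using divergence_classical_curl [OF test_vec_smooth_vec [OF \<phi>]] by (simp add: ip_zero_right)
    finally show ?thesis .
  qed
  then show ?thesis
    by (simp add: is_weak_curl_def L2_zero ip_zero_left)
qed

lemma wgrad_in_H_curl: "f \<in> H1 \<Omega> \<Longrightarrow> wgrad \<Omega> f \<in> H_curl \<Omega>"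
  unfolding H_curl_def using L2_wgrad is_weak_curl_wgrad by blast

lemma wcurl_wgrad: "f \<in> H1 \<Omega> \<Longrightarrow> eq_ae \<Omega> (wcurl \<Omega> (wgrad \<Omega> f)) (\<lambda>x. 0)"
  by (intro is_weak_curl_unique [OF is_weak_curl_wcurl is_weak_curl_wgrad] wgrad_in_H_curl)

text \<open>Here \<psi> may be nonzero on the boundary; the compact support needed for integration
  by parts comes from \<phi> instead.\<close>

lemma ip_classical_grad_curl:
  assumes \<phi>: "\<phi> \<in> test_fun \<Omega>" and \<psi>: "smooth_vec \<psi>"
  shows "ip \<Omega> (classical_grad \<phi>) (classical_curl \<psi>) = 0"
proof -
  let ?c = "\<lambda>i x. classical_curl \<psi> x $ i"
  have c: "smooth (?c i)" for i
    using smooth_vec_classical_curl [OF \<psi>] by (simp add: smooth_vec_def)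
  have g: "classical_grad \<phi> \<in> L2 \<Omega>"
    by (rule L2_vecI) (simp add: classical_grad_def L2_test_fun [OF test_fun_pderiv [OF \<phi>]])
  have "ip \<Omega> (classical_grad \<phi>) (classical_curl \<psi>) = (\<Sum>i\<in>UNIV. ip \<Omega> (\<lambda>x. classical_grad \<phi> x $ i) (?c i))"
    by (intro ip_vec g L2_classical_curl \<psi>)
  also have "\<dots> = (\<Sum>i\<in>UNIV. - ip \<Omega> \<phi> (pderiv_at i (?c i)))"
  proof (rule sum.cong [OF refl])
    fix i
    show "ip \<Omega> (\<lambda>x. classical_grad \<phi> x $ i) (?c i) = - ip \<Omega> \<phi> (pderiv_at i (?c i))"
      using integral_by_parts_test_fun [OF open_domain \<phi> smooth_differentiable [OF c] smooth_continuous [OF smooth_pderiv [OF c]]]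
      by (simp add: ip_def classical_grad_def mult.commute)
  qed
  also have "\<dots> = - ip \<Omega> \<phi> (\<lambda>x. \<Sum>i\<in>UNIV. pderiv_at i (?c i) x)"
    by (subst ip_sum_right) (auto simp: sum_negf intro!: L2_test_fun [OF \<phi>] L2_smooth smooth_pderiv c)
  also have "\<dots> = 0"
    using divergence_classical_curl [OF \<psi>] by (simp add: ip_zero_right)
  finally show ?thesis .
qed

text \<open>As the curl of the gradient vanishes, the trace functional reduces to minus the pairing
  of the gradient with the curl of \<psi>. This is zero for gradients of test functions and is
  continuous in the \<open>L2_norm\<close> of the gradient, by Cauchy-Schwarz.\<close>

lemma zero_tangential_trace_wgrad:
  assumes f: "f \<in> H1_0 \<Omega>"
  shows "zero_tangential_trace \<Omega> (wgrad \<Omega> f)"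
  unfolding zero_tangential_trace_def
proof (intro allI impI)
  fix \<psi> assume \<psi>: "smooth_vec \<psi>"
  have H1: "f \<in> H1 \<Omega>"
    using f by (simp add: H1_0_def)
  obtain \<phi> where \<phi>: "\<And>k. \<phi> k \<in> test_fun \<Omega>"
    "(\<lambda>k. L2_norm \<Omega> (\<lambda>x. classical_grad (\<phi> k) x - wgrad \<Omega> f x)) \<longlonglongrightarrow> 0"
    using f by (auto simp: H1_0_def)
  let ?e = "\<lambda>k x. classical_grad (\<phi> k) x - wgrad \<Omega> f x"
  let ?c = "classical_curl \<psi>"
  have g: "classical_grad (\<phi> k) \<in> L2 \<Omega>" for k
    by (rule L2_vecI) (simp add: classical_grad_def L2_test_fun [OF test_fun_pderiv [OF \<phi>(1)]])
  have "\<bar>ip \<Omega> (wgrad \<Omega> f) ?c\<bar> \<le> L2_norm \<Omega> (?e k) * L2_norm \<Omega> ?c" for k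
    using ip_Cauchy_Schwarz [OF L2_diff [OF g L2_wgrad [OF H1]] L2_classical_curl [OF \<psi>]]
    by (simp add: ip_diff_left g L2_wgrad [OF H1] L2_classical_curl [OF \<psi>] ip_classical_grad_curl [OF \<phi>(1) \<psi>])
  moreover have "(\<lambda>k. L2_norm \<Omega> (?e k) * L2_norm \<Omega> ?c) \<longlonglongrightarrow> 0 * L2_norm \<Omega> ?c"
    by (intro tendsto_intros \<phi>(2))
  ultimately have "\<bar>ip \<Omega> (wgrad \<Omega> f) ?c\<bar> \<le> 0"
    by (intro LIMSEQ_le_const [of "\<lambda>k. L2_norm \<Omega> (?e k) * L2_norm \<Omega> ?c" 0]) auto
  moreover have "ip \<Omega> (wcurl \<Omega> (wgrad \<Omega> f)) \<psi> = ip \<Omega> (\<lambda>x. 0) \<psi>"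
    by (intro ip_cong_ae wcurl_wgrad H1 eq_ae_refl L2_zero L2_wcurl wgrad_in_H_curl L2_smooth_vec \<psi>)
  ultimately show "tangential_trace \<Omega> (wgrad \<Omega> f) \<psi> = 0"
    by (simp add: tangential_trace_def ip_zero_left)
qed

lemma tangential_trace_add_scaled:
  assumes "D \<in> H_curl \<Omega>" "D' \<in> H_curl \<Omega>" "smooth_vec \<phi>"
  shows "tangential_trace \<Omega> (\<lambda>x. D x + c *\<^sub>R D' x) \<phi> = tangential_trace \<Omega> D \<phi> + c * tangential_trace \<Omega> D' \<phi>"
proof -
  have L: "D \<in> L2 \<Omega>" "D' \<in> L2 \<Omega>"
    using assms by (simp_all add: H_curl_def)
  have "ip \<Omega> (wcurl \<Omega> (\<lambda>x. D x + c *\<^sub>R D' x)) \<phi> = ip \<Omega> (\<lambda>x. wcurl \<Omega> D x + c *\<^sub>R wcurl \<Omega> D' x) \<phi>"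
    using assms by (intro ip_cong_ae wcurl_add_scaled eq_ae_refl L2_add L2_scaleR L2_wcurl L2_smooth_vec H_curl_add_scaled)
  then show ?thesis
    using assms L
    by (simp add: tangential_trace_def ip_add_left ip_scaleR_left L2_scaleR L2_wcurl L2_smooth_vec
        L2_classical_curl algebra_simps)
qed

lemma tangential_trace_eq_ae:
  assumes "eq_ae \<Omega> D D'" "D \<in> H_curl \<Omega>" "smooth_vec \<phi>"
  shows "tangential_trace \<Omega> D \<phi> = tangential_trace \<Omega> D' \<phi>"
proof -
  have D': "D' \<in> H_curl \<Omega>"
    using assms H_curl_eq_ae by blast
  have "ip \<Omega> (wcurl \<Omega> D) \<phi> = ip \<Omega> (wcurl \<Omega> D') \<phi>"
    using assms D' by (intro ip_cong_ae wcurl_eq_ae eq_ae_refl L2_wcurl L2_smooth_vec)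
  moreover have "ip \<Omega> D (classical_curl \<phi>) = ip \<Omega> D' (classical_curl \<phi>)"
    using assms D' by (intro ip_cong_ae eq_ae_refl L2_classical_curl) (simp_all add: H_curl_def)
  ultimately show ?thesis
    by (simp add: tangential_trace_def)
qed

end

section \<open>Polynomials\<close>

lemma finite_exponents: "finite {a :: 3 \<Rightarrow> nat. (\<Sum>i\<in>UNIV. a i) \<le> j}"
proof (rule finite_subset)
  show "{a :: 3 \<Rightarrow> nat. (\<Sum>i\<in>UNIV. a i) \<le> j} \<subseteq> UNIV \<rightarrow>\<^sub>E {..j}"
  proof
    fix a :: "3 \<Rightarrow> nat" assume "a \<in> {a. (\<Sum>i\<in>UNIV. a i) \<le> j}"
    then have "a i \<le> j" for i
      using member_le_sum [of i UNIV a] by simp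
    then show "a \<in> UNIV \<rightarrow>\<^sub>E {..j}" by auto
  qed
qed (simp add: finite_PiE)

lemma poly_deg_le_I: "(\<And>x. p x = (\<Sum>a\<in>{a. (\<Sum>i\<in>UNIV. a i) \<le> j}. c a * monomial a x)) \<Longrightarrow> p \<in> poly_deg_le j"
  unfolding poly_deg_le_def by blast

lemma poly_deg_le_add_scaled:
  assumes "p \<in> poly_deg_le j" "q \<in> poly_deg_le j"
  shows "(\<lambda>x. p x + c * q x) \<in> poly_deg_le j"
proof -
  let ?A = "{a :: 3 \<Rightarrow> nat. (\<Sum>i\<in>UNIV. a i) \<le> j}"
  obtain cp where p: "p = (\<lambda>x. \<Sum>a\<in>?A. cp a * monomial a x)"
    using assms(1) unfolding poly_deg_le_def by blast
  obtain cq where q: "q = (\<lambda>x. \<Sum>a\<in>?A. cq a * monomial a x)"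
    using assms(2) unfolding poly_deg_le_def by blast
  show ?thesis
  proof (rule poly_deg_le_I)
    show "p x + c * q x = (\<Sum>a\<in>?A. (cp a + c * cq a) * monomial a x)" for x
      unfolding p q sum_distrib_left sum.distrib [symmetric] by (rule sum.cong) (simp_all add: algebra_simps)
  qed
qed

lemma poly_hom_I: "(\<And>x. p x = (\<Sum>a\<in>{a. (\<Sum>i\<in>UNIV. a i) = j}. c a * monomial a x)) \<Longrightarrow> p \<in> poly_hom j"
  unfolding poly_hom_def by blast

lemma poly_hom_add_scaled:
  assumes "p \<in> poly_hom j" "q \<in> poly_hom j"
  shows "(\<lambda>x. p x + c * q x) \<in> poly_hom j"
proof -
  let ?A = "{a :: 3 \<Rightarrow> nat. (\<Sum>i\<in>UNIV. a i) = j}"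
  obtain cp where p: "p = (\<lambda>x. \<Sum>a\<in>?A. cp a * monomial a x)"
    using assms(1) unfolding poly_hom_def by blast
  obtain cq where q: "q = (\<lambda>x. \<Sum>a\<in>?A. cq a * monomial a x)"
    using assms(2) unfolding poly_hom_def by blast
  show ?thesis
  proof (rule poly_hom_I)
    show "p x + c * q x = (\<Sum>a\<in>?A. (cp a + c * cq a) * monomial a x)" for x
      unfolding p q sum_distrib_left sum.distrib [symmetric] by (rule sum.cong) (simp_all add: algebra_simps)
  qed
qed

lemma poly_deg_le_zero: "(\<lambda>x. 0) \<in> poly_deg_le j"
  by (rule poly_deg_le_I [where c = "\<lambda>a. 0"]) simp

lemma poly_hom_zero: "(\<lambda>x. 0) \<in> poly_hom j"
  by (rule poly_hom_I [where c = "\<lambda>a. 0"]) simp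

lemma poly_deg_le_cmult: "p \<in> poly_deg_le j \<Longrightarrow> (\<lambda>x. c * p x) \<in> poly_deg_le j"
  using poly_deg_le_add_scaled [OF poly_deg_le_zero, of p j c] by simp

lemma poly_deg_le_diff: "p \<in> poly_deg_le j \<Longrightarrow> q \<in> poly_deg_le j \<Longrightarrow> (\<lambda>x. p x - q x) \<in> poly_deg_le j"
  using poly_deg_le_add_scaled [of p j q "-1"] by simp

lemma poly_deg_le_sum:
  "(\<And>a. a \<in> A \<Longrightarrow> p a \<in> poly_deg_le j) \<Longrightarrow> (\<lambda>x. \<Sum>a\<in>A. p a x) \<in> poly_deg_le j"
proof (induction A rule: infinite_finite_induct)
  case (insert a A)
  then show ?case
    using poly_deg_le_add_scaled [of "p a" j "\<lambda>x. \<Sum>a\<in>A. p a x" 1] by simp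
qed (simp_all add: poly_deg_le_zero)

lemma monomial_in_poly_deg_le:
  assumes "(\<Sum>i\<in>UNIV. a i) \<le> j"
  shows "monomial a \<in> poly_deg_le j"
proof -
  have "monomial a x = (\<Sum>b\<in>{b. (\<Sum>i\<in>UNIV. b i) \<le> j}. (if b = a then 1 else 0) * monomial b x)" for x
    using assms sum.delta [OF finite_exponents [of j], of a "\<lambda>b. monomial b x"]
    by (simp add: if_distrib [of "\<lambda>c. c * _"] cong: if_cong)
  then show ?thesis
    by (rule poly_deg_le_I)
qed

lemma smooth_monomial: "smooth (monomial a)"
  unfolding monomial_def [abs_def] by (intro smooth_prod smooth_power smooth_component)

lemma smooth_poly_deg_le: "p \<in> poly_deg_le j \<Longrightarrow> smooth p"
  by (auto simp: poly_deg_le_def intro!: smooth_sum smooth_cmult smooth_monomial)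

text \<open>For \<open>a i = 0\<close> the truncated exponent \<open>a i - 1\<close> is harmless,
  because the factor \<open>real (a i)\<close> vanishes.\<close>

lemma pderiv_monomial: "pderiv_at i (monomial a) = (\<lambda>x. real (a i) * monomial (a(i := a i - 1)) x)"
proof
  fix x
  have "((\<lambda>x::real^3. (x $ k) ^ a k) has_derivative (\<lambda>h. real (a k) * (x $ k) ^ (a k - 1) * (h $ k))) (at x)" for k
  proof -
    have "((\<lambda>x::real^3. x $ k) has_derivative (\<lambda>h. h $ k)) (at x)"
      by (rule bounded_linear_imp_has_derivative) (rule bounded_linear_vec_nth)
    from has_derivative_power [OF this, of "a k"] show ?thesis
      by (simp add: ac_simps)
  qed
  then have "(monomial a has_derivative (\<lambda>h. \<Sum>k\<in>UNIV. real (a k) * (x $ k) ^ (a k - 1) * (h $ k) *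
      (\<Prod>j\<in>UNIV - {k}. (x $ j) ^ a j))) (at x)"
    unfolding monomial_def [abs_def] by (rule has_derivative_prod)
  then have "pderiv_at i (monomial a) x = (\<Sum>k\<in>UNIV. real (a k) * (x $ k) ^ (a k - 1) * (axis i 1 $ k) *
      (\<Prod>j\<in>UNIV - {k}. (x $ j) ^ a j))"
    by (rule pderiv_at_eqI)
  also have "\<dots> = (\<Sum>k\<in>UNIV. if k = i then real (a k) * (x $ k) ^ (a k - 1) * (\<Prod>j\<in>UNIV - {k}. (x $ j) ^ a j) else 0)"
    by (intro sum.cong) (auto simp: axis_def)
  also have "\<dots> = real (a i) * (x $ i) ^ (a i - 1) * (\<Prod>j\<in>UNIV - {i}. (x $ j) ^ a j)"
    by simp
  also have "\<dots> = real (a i) * monomial (a(i := a i - 1)) x"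
    by (simp add: monomial_def prod.remove [of UNIV i] mult.assoc)
  finally show "pderiv_at i (monomial a) x = real (a i) * monomial (a(i := a i - 1)) x" .
qed

lemma pderiv_at_sum:
  assumes "finite A" "\<And>a. a \<in> A \<Longrightarrow> smooth (f a)"
  shows "pderiv_at i (\<lambda>x. \<Sum>a\<in>A. f a x) = (\<lambda>x. \<Sum>a\<in>A. pderiv_at i (f a) x)"
  using assms
proof (induction A rule: finite_induct)
  case (insert a A)
  then show ?case
    by (simp add: pderiv_at_add smooth_differentiable smooth_sum)
qed (simp add: pderiv_at_const)

lemma poly_deg_le_pderiv:
  assumes "p \<in> poly_deg_le j"
  shows "pderiv_at i p \<in> poly_deg_le (j - 1)"
proof -
  let ?A = "{a :: 3 \<Rightarrow> nat. (\<Sum>i\<in>UNIV. a i) \<le> j}"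
  obtain c where "p = (\<lambda>x. \<Sum>a\<in>?A. c a * monomial a x)"
    using assms by (auto simp: poly_deg_le_def)
  then have "pderiv_at i p = (\<lambda>x. \<Sum>a\<in>?A. pderiv_at i (\<lambda>x. c a * monomial a x) x)"
    by (simp only:) (intro pderiv_at_sum finite_exponents smooth_cmult smooth_monomial)
  also have "\<dots> = (\<lambda>x. \<Sum>a\<in>?A. (c a * real (a i)) * monomial (a(i := a i - 1)) x)"
    by (simp add: pderiv_at_cmult smooth_differentiable [OF smooth_monomial] pderiv_monomial mult.assoc)
  also have "\<dots> \<in> poly_deg_le (j - 1)"
  proof (rule poly_deg_le_sum)
    fix a assume a: "a \<in> ?A"
    \<comment> \<open>A positive exponent \<open>a i\<close> drops by one and takes the total degree
      with it; for \<open>a i = 0\<close> truncated subtraction leaves the degree unchanged, but the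
      term is zero.\<close>
    show "(\<lambda>x. (c a * real (a i)) * monomial (a(i := a i - 1)) x) \<in> poly_deg_le (j - 1)"
    proof (cases "a i = 0")
      case False
      have "(\<Sum>k\<in>UNIV. (a(i := a i - 1)) k) = (a i - 1) + (\<Sum>k\<in>UNIV - {i}. a k)"
        by (simp add: sum.remove [of UNIV i])
      moreover have "(\<Sum>k\<in>UNIV. a k) = a i + (\<Sum>k\<in>UNIV - {i}. a k)"
        by (simp add: sum.remove [of UNIV i])
      ultimately show ?thesis
        using a False by (intro poly_deg_le_cmult monomial_in_poly_deg_le) simp
    qed (simp add: poly_deg_le_zero)
  qed
  finally show ?thesis .
qed

section \<open>Geometry of the domain\<close>

text \<open>A Lipschitz domain lies on one side of its boundary, so it has no slits. In a local
  chart the points strictly below the graph form an open set disjoint from \<Omega>, hence from its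
  closure, and such points exist arbitrarily close to every boundary point.\<close>

lemma interior_closure_lipschitz_domain:
  assumes "lipschitz_domain \<Omega>"
  shows "interior (closure \<Omega>) = \<Omega>"
proof
  have op: "open \<Omega>"
    using assms by (simp add: lipschitz_domain_def)
  show "\<Omega> \<subseteq> interior (closure \<Omega>)"
    using op closure_subset by (rule interior_maximal [rotated])
  show "interior (closure \<Omega>) \<subseteq> \<Omega>"
  proof (rule ccontr)
    assume "\<not> interior (closure \<Omega>) \<subseteq> \<Omega>"
    then obtain x where x: "x \<in> interior (closure \<Omega>)" "x \<notin> \<Omega>"
      by blast
    then have "x \<in> frontier \<Omega>"
      using op interior_subset by (auto simp: frontier_def interior_open)
    then obtain r M and Q :: "real^3 \<Rightarrow> real^3" and \<zeta> :: "real^2 \<Rightarrow> real" where r: "r > 0" and Q: "orthogonal_transformation Q"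
      and \<zeta>: "M-lipschitz_on UNIV \<zeta>"
      and \<Omega>: "\<Omega> \<inter> ball x r = {y \<in> ball x r. \<zeta> (vector [Q (y - x) $ 1, Q (y - x) $ 2]) < Q (y - x) $ 3}"
      using assms unfolding lipschitz_domain_def by blast
    have linQ: "linear Q"
      using Q by (rule orthogonal_transformation_linear)
    let ?v = "\<lambda>y. vector [Q (y - x) $ 1, Q (y - x) $ 2] :: real^2"
    have v_eq: "vector [s, t] = s *\<^sub>R axis 1 1 + t *\<^sub>R (axis 2 1 :: real^2)" for s t :: real
      by (simp add: vec_eq_iff forall_2 vector_2 axis_def)
    have contQ: "continuous_on UNIV (\<lambda>y. Q (y - x))"
      by (intro continuous_on_compose2 [OF linear_continuous_on [OF linear_linear [THEN iffD2, OF linQ], of UNIV]]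
          continuous_intros) auto
    have cont\<zeta>: "continuous_on UNIV (\<lambda>y. \<zeta> (?v y))"
      unfolding v_eq
      by (intro continuous_on_compose2 [OF lipschitz_on_continuous_on [OF \<zeta>]] continuous_intros contQ) auto
    define V where "V = ball x r \<inter> {y. Q (y - x) $ 3 < \<zeta> (?v y)}"
    have "open V"
      unfolding V_def by (intro open_Int open_ball open_Collect_less cont\<zeta> continuous_intros contQ)
    moreover have "V \<inter> \<Omega> = {}"
      using \<Omega> unfolding V_def by force
    ultimately have V: "V \<inter> closure \<Omega> = {}"
      using open_Int_closure_eq_empty by blast
    \<comment> \<open>The upward direction of the chart: moving from \<open>x\<close> against it
      keeps the first two chart coordinates at 0 and makes the third negative.\<close>
    obtain e where e: "Q e = axis 3 1"
      using orthogonal_transformation_surj [OF Q] by (metis surj_def)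
    have "norm e = 1"
      using Q e by (metis norm_axis_1 orthogonal_transformation)
    \<comment> \<open>The chart does not state that the graph passes through \<open>x\<close>; this
      inequality follows from \<open>x\<close> lying outside \<Omega>, and it suffices.\<close>
    have "0 \<le> \<zeta> (vector [0, 0])"
    proof -
      have "x \<notin> \<Omega> \<inter> ball x r" using x by blast
      then show ?thesis
        using r \<Omega> linear_0 [OF linQ] by (auto simp: not_less)
    qed
    obtain d where d: "d > 0" "ball x d \<subseteq> interior (closure \<Omega>)"
      using x(1) open_interior open_contains_ball by blast
    define t where "t = min d r / 2"
    have t: "t > 0" "t < d" "t < r"
      using d r by (auto simp: t_def)
    have "x - t *\<^sub>R e \<in> ball x d" "x - t *\<^sub>R e \<in> ball x r"
      using t \<open>norm e = 1\<close> by (simp_all add: dist_norm)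
    moreover have "Q ((x - t *\<^sub>R e) - x) = (- t) *\<^sub>R axis 3 1"
      using linear_scale [OF linQ, of "- t" e] e by simp
    ultimately have "x - t *\<^sub>R e \<in> V"
      using t \<open>0 \<le> \<zeta> (vector [0, 0])\<close> by (simp add: V_def axis_def)
    moreover have "x - t *\<^sub>R e \<in> closure \<Omega>"
      using d(2) \<open>x - t *\<^sub>R e \<in> ball x d\<close> interior_subset by blast
    ultimately show False
      using V by blast
  qed
qed

text \<open>The set where \<open>f\<close> is nonzero is open, and a non-empty open set is never
  negligible.\<close>

lemma ae_zero_continuous_open:
  assumes "open U" "continuous_on U f" "AE x in lebesgue_on U. f x = 0" "x \<in> U"
  shows "f x = (0 :: 'a::real_normed_vector)"
proof (rule ccontr)
  assume nz: "f x \<noteq> 0"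
  have op: "open {x \<in> U. f x \<noteq> 0}"
  proof -
    have "{x \<in> U. f x \<noteq> 0} = U \<inter> f -` (- {0})" by auto
    then show ?thesis
      using continuous_open_preimage [OF assms(2,1) open_Compl [OF closed_singleton], of 0] by simp
  qed
  have "U \<in> sets lebesgue"
    using assms(1) by simp
  then have "AE x in lebesgue. x \<in> U \<longrightarrow> f x = 0"
    using assms(3) by (simp add: AE_restrict_space_iff)
  then have "AE x in lebesgue. x \<notin> {x \<in> U. f x \<noteq> 0}"
    by eventually_elim auto
  then have "{x \<in> U. f x \<noteq> 0} \<in> null_sets lebesgue"
    using op by (simp add: AE_iff_null_sets)
  then have "negligible {x \<in> U. f x \<noteq> 0}"
    by (simp add: negligible_iff_null_sets)
  then show False
    using open_not_negligible [OF op] nz assms(4) by blast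
qed

lemma zero_pderivs_imp_zero_derivative:
  assumes "f differentiable_on UNIV" "\<And>i. pderiv_at i f x = 0"
  shows "(f has_derivative (\<lambda>h. 0)) (at x)"
proof -
  let ?F = "frechet_derivative f (at x)"
  have F: "(f has_derivative ?F) (at x)"
    using assms(1) by (rule has_derivative_frechet)
  have "?F h = 0" for h
  proof -
    have "h = (\<Sum>i\<in>UNIV. h $ i *\<^sub>R axis i 1)"
      using basis_expansion [of h] by (simp add: scalar_mult_eq_scaleR)
    then have "?F h = ?F (\<Sum>i\<in>UNIV. h $ i *\<^sub>R axis i 1)"
      by simp
    also have "\<dots> = (\<Sum>i\<in>UNIV. h $ i *\<^sub>R ?F (axis i 1))"
      using has_derivative_linear [OF F] by (simp add: linear_sum linear_scale)
    also have "\<dots> = 0"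
      using assms(2) by (simp add: pderiv_at_def)
    finally show ?thesis .
  qed
  then have "?F = (\<lambda>h. 0)" by blast
  then show ?thesis using F by simp
qed

lemma L2_subset:
  assumes "f \<in> L2 \<Omega>" "U \<subseteq> \<Omega>" "U \<in> sets lebesgue" "\<Omega> \<in> sets lebesgue"
  shows "f \<in> L2 U"
proof -
  have "set_integrable lebesgue \<Omega> (\<lambda>x. (norm (f x))\<^sup>2)"
    using L2_integrable_square [OF assms(1)] assms(4) by (simp add: set_integrable_def integrable_restrict_space)
  then have "set_integrable lebesgue U (\<lambda>x. (norm (f x))\<^sup>2)"
    using assms(3,2) by (rule set_integrable_subset)
  then show ?thesis
    using assms(3) measurable_restrict_mono [OF L2_measurable [OF assms(1)] assms(2)]
    by (simp add: L2_def set_integrable_def integrable_restrict_space)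
qed

lemma ip_subset:
  assumes "U \<subseteq> \<Omega>" "U \<in> sets lebesgue" "\<Omega> \<in> sets lebesgue" "\<And>x. x \<notin> U \<Longrightarrow> g x = 0"
  shows "ip \<Omega> f g = ip U f g"
proof -
  have "(\<lambda>x. indicator \<Omega> x *\<^sub>R (f x \<bullet> g x)) = (\<lambda>x. indicator U x *\<^sub>R (f x \<bullet> g x))"
    using assms(1,4) by (auto simp: fun_eq_iff indicator_def)
  then show ?thesis
    using assms by (simp add: ip_def integral_restrict_space)
qed

section \<open>The finite element spaces\<close>

locale fe_mesh =
  fixes \<Omega> :: "(real^3) set" and \<T> :: "(real^3) set set"
  assumes bounded_dom: "bounded \<Omega>" and lipschitz: "lipschitz_domain \<Omega>"
    and partition: "tetrahedral_partition \<Omega> \<T>"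
begin

sublocale bounded_open \<Omega>
  using bounded_dom lipschitz by unfold_locales (simp_all add: lipschitz_domain_def)

lemma connected_domain: "connected \<Omega>"
  using lipschitz by (simp add: lipschitz_domain_def)

lemma finite_mesh: "finite \<T>" and Union_mesh: "\<Union>\<T> = closure \<Omega>"
  using partition by (simp_all add: tetrahedral_partition_def triangulation_def)

text \<open>A 3-simplex is full-dimensional in three-space, so its interior is non-empty and, by
  convexity, dense in it. The interior lies in \<Omega> because it lies in the interior of the
  closure.\<close>

lemma element:
  assumes "K \<in> \<T>"
  shows "convex K" "compact K" "K \<in> sets lebesgue" "closure (interior K) = K" "interior K \<subseteq> \<Omega>" "K \<subseteq> closure \<Omega>"
proof -
  have K: "3 simplex K"
    using assms partition by (simp add: tetrahedral_partition_def)
  show convex: "convex K" and compact: "compact K"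
    using K by (rule convex_simplex, rule compact_simplex)
  show "K \<in> sets lebesgue"
    using compact_imp_closed [OF compact] by simp
  have "aff_dim K = 3" "K \<noteq> {}"
    using aff_dim_simplex [OF K] K by auto
  then have "interior K \<noteq> {}"
    using convex rel_interior_eq_empty [OF convex] by (simp add: interior_rel_interior_gen)
  then show "closure (interior K) = K"
    using convex_closure_interior [OF convex] closure_closed [OF compact_imp_closed [OF compact]] by simp
  show "K \<subseteq> closure \<Omega>"
    using assms Union_mesh by blast
  then show "interior K \<subseteq> \<Omega>"
    using interior_mono interior_closure_lipschitz_domain [OF lipschitz] by metis
qed

text \<open>The frontier of a convex set is a null set. Comparisons may thus be made on the open
  interior, which stays inside \<Omega> even if the element touches the boundary.\<close>

lemma ae_interior_element:
  assumes K: "K \<in> \<T>" and "eq_ae (interior K) f g"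
  shows "eq_ae K f g"
proof -
  have "negligible (frontier K)"
    by (rule negligible_convex_frontier [OF element(1) [OF K]])
  then have "AE x in lebesgue. x \<notin> frontier K"
    unfolding negligible_iff_null_sets by (rule AE_not_in)
  moreover have "AE x in lebesgue. x \<in> interior K \<longrightarrow> f x = g x"
    using assms(2) by (simp add: eq_ae_def AE_restrict_space_iff)
  ultimately have "AE x in lebesgue. x \<in> K \<longrightarrow> f x = g x"
    by eventually_elim (use closure_subset [of K] in \<open>auto simp: frontier_def\<close>)
  then show ?thesis
    using element(3) [OF K] by (simp add: eq_ae_def AE_restrict_space_iff)
qed

lemma eq_ae_element:
  assumes "eq_ae \<Omega> f g" "K \<in> \<T>"
  shows "eq_ae K f g"
  by (rule ae_interior_element [OF assms(2) eq_ae_subset [OF assms(1) measurable_domain]])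
     (use element(5) [OF assms(2)] in auto)

text \<open>A test function supported in the interior of the element is also one for \<Omega>.
  Against such functions the weak gradient of \<open>f\<close> and the classical gradient of
  \<open>r\<close> have equal pairings, so they agree on the interior by the fundamental
  lemma.\<close>

lemma wgrad_on_element:
  assumes f: "f \<in> H1 \<Omega>" and K: "K \<in> \<T>" and r: "smooth r" "\<And>x. x \<in> K \<Longrightarrow> f x = r x"
  shows "eq_ae K (wgrad \<Omega> f) (classical_grad r)"
proof (rule ae_interior_element [OF K], rule eq_ae_componentI)
  let ?U = "interior K"
  have U: "?U \<subseteq> \<Omega>" "?U \<in> sets lebesgue"
    using element(5) [OF K] by auto
  interpret U: bounded_open ?U
    using bounded_subset [OF bounded_dom U(1)] by unfold_locales auto
  fix i
  show "eq_ae ?U (\<lambda>x. wgrad \<Omega> f x $ i) (\<lambda>x. classical_grad r x $ i)"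
  proof (rule U.eq_ae_if_ip_test_fun)
    show "(\<lambda>x. wgrad \<Omega> f x $ i) \<in> L2 ?U"
      by (rule L2_subset [OF L2_component [OF L2_wgrad [OF f]] U measurable_domain])
    show "(\<lambda>x. classical_grad r x $ i) \<in> L2 ?U"
      by (simp add: classical_grad_def U.L2_smooth smooth_pderiv r)
    fix \<phi> assume \<phi>: "\<phi> \<in> test_fun ?U"
    have zero: "\<psi> x = 0" if "\<psi> \<in> test_fun ?U" "x \<notin> ?U" for \<psi> x
      using that(1) by (rule test_funE) (use that(2) in blast)
    have "ip ?U (\<lambda>x. wgrad \<Omega> f x $ i) \<phi> = ip \<Omega> (\<lambda>x. wgrad \<Omega> f x $ i) \<phi>"
      using ip_subset [OF U measurable_domain zero [OF \<phi>]] by simp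
    also have "\<dots> = - ip \<Omega> f (pderiv_at i \<phi>)"
      using is_weak_grad_wgrad [OF f] test_fun_mono [OF \<phi> U(1)] by (simp add: is_weak_grad_def)
    also have "ip \<Omega> f (pderiv_at i \<phi>) = ip ?U f (pderiv_at i \<phi>)"
      by (rule ip_subset [OF U measurable_domain zero [OF test_fun_pderiv [OF \<phi>]]])
    also have "\<dots> = ip ?U r (pderiv_at i \<phi>)"
      using r(2) interior_subset by (intro ip_cong) auto
    also have "\<dots> = - ip ?U (\<lambda>x. classical_grad r x $ i) \<phi>"
      using integral_by_parts_test_fun [OF open_interior \<phi> smooth_differentiable [OF r(1)]
          smooth_continuous [OF smooth_pderiv [OF r(1)]]]
      by (simp add: ip_def classical_grad_def)
    finally show "ip ?U (\<lambda>x. wgrad \<Omega> f x $ i) \<phi> = ip ?U (\<lambda>x. classical_grad r x $ i) \<phi>"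
      by simp
  qed
qed

section \<open>Linear structure of the discrete spaces and the embedding of pressure
  gradients\<close>

lemma R2_I: "a \<in> poly_deg_le_vec 1 \<Longrightarrow> b \<in> S2 K \<Longrightarrow> r = (\<lambda>x. a x + b x) \<Longrightarrow> r \<in> R2 K"
  by (auto simp: R2_def)

lemma R2_add_scaled:
  assumes "p \<in> R2 K" "q \<in> R2 K"
  shows "(\<lambda>x. p x + c *\<^sub>R q x) \<in> R2 K"
proof -
  obtain a b where ab: "a \<in> poly_deg_le_vec 1" "b \<in> S2 K" "p = (\<lambda>x. a x + b x)"
    using assms(1) by (auto simp: R2_def)
  obtain a' b' where ab': "a' \<in> poly_deg_le_vec 1" "b' \<in> S2 K" "q = (\<lambda>x. a' x + b' x)"
    using assms(2) by (auto simp: R2_def)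
  have "(\<lambda>x. a x + c *\<^sub>R a' x) \<in> poly_deg_le_vec 1"
    using ab(1) ab'(1) by (simp add: poly_deg_le_vec_def poly_deg_le_add_scaled)
  moreover have "(\<lambda>x. b x + c *\<^sub>R b' x) \<in> S2 K"
    using ab(2) ab'(2) by (simp add: S2_def poly_hom_vec_def poly_hom_add_scaled inner_add_left)
  moreover have "(\<lambda>x. p x + c *\<^sub>R q x) = (\<lambda>x. (a x + c *\<^sub>R a' x) + (b x + c *\<^sub>R b' x))"
    using ab(3) ab'(3) by (simp add: algebra_simps)
  ultimately show ?thesis
    by (rule R2_I)
qed

lemma E_space_D: "D \<in> E_space \<Omega> \<T> \<Longrightarrow> D \<in> H_curl \<Omega>" "D \<in> E_space \<Omega> \<T> \<Longrightarrow> D \<in> L2 \<Omega>"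
  by (simp_all add: E_space_def H_curl_def)

lemma E_space_add_scaled:
  assumes D: "D \<in> E_space \<Omega> \<T>" "D' \<in> E_space \<Omega> \<T>"
  shows "(\<lambda>x. D x + c *\<^sub>R D' x) \<in> E_space \<Omega> \<T>"
proof -
  have "\<exists>r\<in>R2 K. eq_ae K (\<lambda>x. D x + c *\<^sub>R D' x) r" if K: "K \<in> \<T>" for K
  proof -
    have "\<exists>r\<in>R2 K. eq_ae K D r" "\<exists>r\<in>R2 K. eq_ae K D' r"
      using D K by (simp_all add: E_space_def)
    then obtain r r' where r: "r \<in> R2 K" "eq_ae K D r" "r' \<in> R2 K" "eq_ae K D' r'"
      by blast
    then show ?thesis
      using R2_add_scaled [OF r(1,3)] eq_ae_add [OF r(2) eq_ae_scaleR [OF r(4)]]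
      by (intro bexI [where x = "\<lambda>x. r x + c *\<^sub>R r' x"])
  qed
  then show ?thesis
    using D by (simp add: E_space_def H_curl_add_scaled zero_tangential_trace_def tangential_trace_add_scaled)
qed

text \<open>Every condition defining \<open>E_space\<close> is insensitive to null sets. This yields
  membership of fields that are given by the recovery formula alone.\<close>

lemma E_space_eq_ae:
  assumes "eq_ae \<Omega> D D'" "D \<in> E_space \<Omega> \<T>"
  shows "D' \<in> E_space \<Omega> \<T>"
proof -
  have "\<exists>r\<in>R2 K. eq_ae K D' r" if "K \<in> \<T>" for K
    using assms that eq_ae_trans [OF eq_ae_sym [OF eq_ae_element [OF assms(1) that]]]
    unfolding E_space_def by blast
  moreover have "zero_tangential_trace \<Omega> D'"
    using assms tangential_trace_eq_ae [OF assms(1)] by (auto simp: E_space_def zero_tangential_trace_def)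
  ultimately show ?thesis
    using assms H_curl_eq_ae by (auto simp: E_space_def)
qed

lemma E_space_diff:
  "D \<in> E_space \<Omega> \<T> \<Longrightarrow> D' \<in> E_space \<Omega> \<T> \<Longrightarrow> (\<lambda>x. D x - D' x) \<in> E_space \<Omega> \<T>"
  using E_space_add_scaled [of D D' "-1"] by simp

lemma P_space_H1: "q \<in> P_space \<Omega> \<T> \<Longrightarrow> q \<in> H1 \<Omega>"
  by (simp add: P_space_def H1_0_def)

lemma P_space_L2: "q \<in> P_space \<Omega> \<T> \<Longrightarrow> q \<in> L2 \<Omega>"
  using P_space_H1 by (auto simp: H1_def)

text \<open>Here the polynomial degrees match: a quadratic pressure has a gradient of degree one on
  each element, which is the first summand of \<open>R2\<close> with zero contribution from
  \<open>S2\<close>.\<close>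

lemma wgrad_P_space_in_E_space:
  assumes q: "q \<in> P_space \<Omega> \<T>"
  shows "wgrad \<Omega> q \<in> E_space \<Omega> \<T>"
proof -
  have "\<exists>r\<in>R2 K. eq_ae K (wgrad \<Omega> q) r" if K: "K \<in> \<T>" for K
  proof -
    obtain r where r: "r \<in> poly_deg_le 2" "\<And>x. x \<in> K \<Longrightarrow> q x = r x"
      using q K by (auto simp: P_space_def)
    have "classical_grad r \<in> poly_deg_le_vec 1"
      using poly_deg_le_pderiv [OF r(1)] by (simp add: poly_deg_le_vec_def classical_grad_def)
    moreover have "(\<lambda>x. 0) \<in> S2 K"
      by (simp add: S2_def poly_hom_vec_def poly_hom_zero)
    ultimately have "classical_grad r \<in> R2 K"
      by (rule R2_I) simp
    then show ?thesis
      using wgrad_on_element [OF P_space_H1 [OF q] K smooth_poly_deg_le [OF r(1)] r(2)] by blast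
  qed
  moreover have "zero_tangential_trace \<Omega> (wgrad \<Omega> q)"
    using q by (intro zero_tangential_trace_wgrad) (simp add: P_space_def)
  ultimately show ?thesis
    by (simp add: E_space_def wgrad_in_H_curl P_space_H1 [OF q])
qed

lemma H_space_diff:
  assumes "B \<in> H_space \<Omega> \<T>" "B' \<in> H_space \<Omega> \<T>"
  shows "(\<lambda>x. B x - B' x) \<in> H_space \<Omega> \<T>"
proof -
  have "\<exists>r\<in>poly_deg_le_vec 1. eq_ae K (\<lambda>x. B x - B' x) r" if K: "K \<in> \<T>" for K
  proof -
    have "\<exists>r\<in>poly_deg_le_vec 1. eq_ae K B r" "\<exists>r\<in>poly_deg_le_vec 1. eq_ae K B' r"
      using assms K by (simp_all add: H_space_def)
    then obtain r r' where r: "r \<in> poly_deg_le_vec 1" "eq_ae K B r" "r' \<in> poly_deg_le_vec 1" "eq_ae K B' r'"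
      by blast
    then have "(\<lambda>x. r x - r' x) \<in> poly_deg_le_vec 1"
      by (simp add: poly_deg_le_vec_def poly_deg_le_diff)
    then show ?thesis
      using eq_ae_diff [OF r(2,4)] by (intro bexI [where x = "\<lambda>x. r x - r' x"])
  qed
  then show ?thesis
    using assms by (simp add: H_space_def L2_diff)
qed

lemma H_space_eq_ae:
  assumes "eq_ae \<Omega> B B'" "B \<in> H_space \<Omega> \<T>"
  shows "B' \<in> H_space \<Omega> \<T>"
proof -
  have "\<exists>r\<in>poly_deg_le_vec 1. eq_ae K B' r" if "K \<in> \<T>" for K
    using assms that eq_ae_trans [OF eq_ae_sym [OF eq_ae_element [OF assms(1) that]]]
    unfolding H_space_def by blast
  then show ?thesis
    using assms L2_eq_ae [OF assms(1) _ measurable_domain] by (simp add: H_space_def)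
qed

lemma U_space_diff:
  assumes "u \<in> U_space \<Omega> \<Gamma> \<T>" "v \<in> U_space \<Omega> \<Gamma> \<T>"
  shows "(\<lambda>x. u x - v x) \<in> U_space \<Omega> \<Gamma> \<T>"
proof -
  have "\<exists>r\<in>poly_deg_le_vec 2. \<forall>x\<in>K. u x - v x = r x" if K: "K \<in> \<T>" for K
  proof -
    have "\<exists>r\<in>poly_deg_le_vec 2. \<forall>x\<in>K. u x = r x" "\<exists>r\<in>poly_deg_le_vec 2. \<forall>x\<in>K. v x = r x"
      using assms K by (simp_all add: U_space_def)
    then obtain r r' where r: "r \<in> poly_deg_le_vec 2" "\<forall>x\<in>K. u x = r x" "r' \<in> poly_deg_le_vec 2" "\<forall>x\<in>K. v x = r' x"
      by blast
    then have "(\<lambda>x. r x - r' x) \<in> poly_deg_le_vec 2"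
      by (simp add: poly_deg_le_vec_def poly_deg_le_diff)
    then show ?thesis
      by (rule bexI [rotated]) (simp add: r)
  qed
  then show ?thesis
    using assms by (simp add: U_space_def H1_vec_def H1_diff continuous_on_diff)
qed

lemma W_space_diff:
  assumes "u \<in> W_space \<Omega> \<T>" "v \<in> W_space \<Omega> \<T>"
  shows "(\<lambda>x. u x - v x) \<in> W_space \<Omega> \<T>"
proof -
  have "\<exists>r\<in>poly_deg_le 1. \<forall>x\<in>K. u x - v x = r x" if K: "K \<in> \<T>" for K
  proof -
    have "\<exists>r\<in>poly_deg_le 1. \<forall>x\<in>K. u x = r x" "\<exists>r\<in>poly_deg_le 1. \<forall>x\<in>K. v x = r x"
      using assms K by (simp_all add: W_space_def)
    then obtain r r' where r: "r \<in> poly_deg_le 1" "\<forall>x\<in>K. u x = r x" "r' \<in> poly_deg_le 1" "\<forall>x\<in>K. v x = r' x"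
      by blast
    then have "(\<lambda>x. r x - r' x) \<in> poly_deg_le 1"
      by (simp add: poly_deg_le_diff)
    then show ?thesis
      by (rule bexI [rotated]) (simp add: r)
  qed
  then show ?thesis
    using assms by (simp add: W_space_def continuous_on_diff)
qed

lemma W_space_L2: "w \<in> W_space \<Omega> \<T> \<Longrightarrow> w \<in> L2 \<Omega>"
  by (simp add: W_space_def L2_of_continuous)

section \<open>From almost everywhere statements to pointwise ones\<close>

lemma ae_zero_imp_zero_on_closure:
  assumes "continuous_on (closure \<Omega>) f" "eq_ae \<Omega> f (\<lambda>x. 0)" "x \<in> closure \<Omega>"
  shows "f x = 0"
proof (rule continuous_constant_on_closure [OF assms(1) _ assms(3)])
  fix x assume "x \<in> \<Omega>"
  then show "f x = 0"
    using assms(1,2) closure_subset open_domain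
    by (intro ae_zero_continuous_open [of \<Omega> f]) (auto simp: eq_ae_def intro: continuous_on_subset)
qed

text \<open>On every element \<open>f\<close> is a polynomial with vanishing gradient, hence
  constant. With finitely many elements \<open>f\<close> takes finitely many values, and a
  continuous function with finite range on the connected closure of \<Omega> is constant.\<close>

lemma constant_if_wgrad_zero:
  assumes f: "f \<in> H1 \<Omega>" "continuous_on (closure \<Omega>) f"
    and poly: "\<And>K. K \<in> \<T> \<Longrightarrow> \<exists>r\<in>poly_deg_le j. \<forall>x\<in>K. f x = r x"
    and grad: "eq_ae \<Omega> (wgrad \<Omega> f) (\<lambda>x. 0)"
  shows "\<exists>c. \<forall>x\<in>closure \<Omega>. f x = c"
proof -
  have const: "\<exists>c. \<forall>x\<in>K. f x = c" if K: "K \<in> \<T>" for K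
  proof -
    obtain r where r: "r \<in> poly_deg_le j" "\<And>x. x \<in> K \<Longrightarrow> f x = r x"
      using poly [OF K] by blast
    note s = smooth_poly_deg_le [OF r(1)]
    have "eq_ae K (classical_grad r) (\<lambda>x. 0)"
      using eq_ae_trans [OF eq_ae_sym [OF wgrad_on_element [OF f(1) K s r(2)]] eq_ae_element [OF grad K]] .
    then have "eq_ae (interior K) (classical_grad r) (\<lambda>x. 0)"
      using element(3) [OF K] by (rule eq_ae_subset) (auto simp: interior_subset)
    then have ae: "AE x in lebesgue_on (interior K). classical_grad r x = 0"
      by (simp add: eq_ae_def)
    have "pderiv_at i r x = 0" if "x \<in> interior K" for x i
    proof (rule ae_zero_continuous_open [OF open_interior _ _ that])
      show "continuous_on (interior K) (pderiv_at i r)"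
        using smooth_continuous [OF smooth_pderiv [OF s]] by (rule continuous_on_subset) auto
      show "AE x in lebesgue_on (interior K). pderiv_at i r x = 0"
        using ae by eventually_elim (simp add: classical_grad_def vec_eq_iff)
    qed
    then have "(r has_derivative (\<lambda>h. 0)) (at x within interior K)" if "x \<in> interior K" for x
      using that zero_pderivs_imp_zero_derivative [OF smooth_differentiable [OF s]]
      by (blast intro: has_derivative_at_withinI)
    then obtain c where c: "\<And>x. x \<in> interior K \<Longrightarrow> r x = c"
      using has_derivative_zero_constant [OF convex_interior [OF element(1) [OF K]]] by blast
    have "r x = c" if "x \<in> K" for x
    proof (rule continuous_constant_on_closure [of "interior K"])
      show "continuous_on (closure (interior K)) r"
        using smooth_continuous [OF s] by (rule continuous_on_subset) auto
    qed (use c that element(4) [OF K] in simp_all)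
    then show ?thesis
      using r(2) by auto
  qed
  \<comment> \<open>Counting values replaces an argument along chains of adjacent elements.\<close>
  have "finite (\<Union>K\<in>\<T>. f ` K)"
  proof (rule finite_UN_I [OF finite_mesh])
    fix K assume "K \<in> \<T>"
    then obtain c where "f ` K \<subseteq> {c}"
      using const by blast
    then show "finite (f ` K)"
      by (rule finite_subset) simp
  qed
  then have "finite (f ` closure \<Omega>)"
    unfolding Union_mesh [symmetric] by (simp add: image_Union)
  then show ?thesis
    using continuous_finite_range_constant [OF connected_imp_connected_closure [OF connected_domain] f(2)]
    by (auto simp: constant_on_def)
qed

end

section \<open>The two schemes\<close>

lemma L2_bdf2: "f \<in> L2 \<Omega> \<Longrightarrow> f1 \<in> L2 \<Omega> \<Longrightarrow> f2 \<in> L2 \<Omega> \<Longrightarrow> bdf2 \<tau> f f1 f2 \<in> L2 \<Omega>"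
  unfolding bdf2_def [abs_def] by (intro L2_scaleR L2_add L2_diff)

text \<open>The two quotients share their history \<open>f1\<close>, \<open>f2\<close>, so only the
  newest level survives in the difference, with the weight 3/(2\<tau>) that it has in BDF2.\<close>

lemma ip_bdf2_diff:
  assumes "f \<in> L2 \<Omega>" "g \<in> L2 \<Omega>" "f1 \<in> L2 \<Omega>" "f2 \<in> L2 \<Omega>" "k \<in> L2 \<Omega>"
  shows "ip \<Omega> (bdf2 \<tau> f f1 f2) k = ip \<Omega> (bdf2 \<tau> g f1 f2) k + 3 / (2 * \<tau>) * (ip \<Omega> f k - ip \<Omega> g k)"
proof -
  have "bdf2 \<tau> f f1 f2 = (\<lambda>x. bdf2 \<tau> g f1 f2 x + (3 / (2 * \<tau>)) *\<^sub>R (f x - g x))"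
    by (simp add: fun_eq_iff bdf2_def scaleR_diff_right scaleR_add_right)
  then have "ip \<Omega> (bdf2 \<tau> f f1 f2) k = ip \<Omega> (bdf2 \<tau> g f1 f2) k + 3 / (2 * \<tau>) * ip \<Omega> (\<lambda>x. f x - g x) k"
    using assms by (simp only: ip_add_left L2_bdf2 L2_scaleR L2_diff ip_scaleR_left)
  then show ?thesis
    using assms by (simp only: ip_diff_left)
qed

text \<open>The Dirichlet part supplies a point of the closure at which displacements vanish; it
  fixes the constants left by a vanishing gradient.\<close>

locale coupled_problem = fe_mesh \<Omega> \<T> for \<Omega> \<T> +
  fixes \<Gamma> :: "(real^3) set" and c :: coeffs and o1 o2 :: fields
  assumes admissible: "admissible c"
    and o1: "o1 \<in> S_space \<Omega> \<Gamma> \<T>" and o2: "o2 \<in> S_space \<Omega> \<Gamma> \<T>"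
    and dirichlet_part: "\<Gamma> \<noteq> {}" "\<Gamma> \<subseteq> closure \<Omega>"
begin

abbreviation m :: real where "m \<equiv> 3 / (2 * c_tau c)"

text \<open>Equals \<open>c_sigma c + c_eps c * m\<close>, the total coefficient of the new electric
  field in the electromagnetic step. Sequences of iterates are called \<open>sq\<close> in this
  locale.\<close>

abbreviation s :: real where "s \<equiv> c_sigma c + 3 * c_eps c / (2 * c_tau c)"

lemma pos: "c_eps c > 0" "c_sigma c > 0" "c_mu c > 0" "c_G c > 0" "c_lam c > 0" "c_alpha c > 0"
    "c_kappa c > 0" "c_0 c > 0" "m > 0" "s > 0"
  using admissible by (auto simp: admissible_def intro!: add_pos_pos)

lemma L2_old: "f_E o1 \<in> L2 \<Omega>" "f_E o2 \<in> L2 \<Omega>" "f_H o1 \<in> L2 \<Omega>" "f_H o2 \<in> L2 \<Omega>"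
    "f_xi o1 \<in> L2 \<Omega>" "f_xi o2 \<in> L2 \<Omega>" "f_p o1 \<in> L2 \<Omega>" "f_p o2 \<in> L2 \<Omega>"
  using o1 o2 by (auto simp: S_space_def E_space_D H_space_def W_space_L2 P_space_L2)

section \<open>The electromagnetic step under a change of pressure\<close>

lemma H_space_L2: "B \<in> H_space \<Omega> \<T> \<Longrightarrow> B \<in> L2 \<Omega>"
  by (simp add: H_space_def)

text \<open>Correcting the electric field by a pressure gradient leaves the magnetic equation
  unchanged, which is why the magnetic field stays the same throughout the iteration.\<close>

lemma wcurl_add_wgrad_diff:
  assumes "D \<in> E_space \<Omega> \<T>" "p \<in> P_space \<Omega> \<T>" "p' \<in> P_space \<Omega> \<T>"
  shows "eq_ae \<Omega> (wcurl \<Omega> (\<lambda>x. D x + t *\<^sub>R (wgrad \<Omega> p' x - wgrad \<Omega> p x))) (wcurl \<Omega> D)"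
proof -
  let ?g = "wgrad \<Omega> p" and ?g' = "wgrad \<Omega> p'"
  have g: "?g \<in> H_curl \<Omega>" "?g' \<in> H_curl \<Omega>" and D: "D \<in> H_curl \<Omega>"
    using assms by (auto intro: wgrad_in_H_curl P_space_H1 E_space_D)
  have w: "(\<lambda>x. ?g' x - ?g x) \<in> H_curl \<Omega>"
    using H_curl_add_scaled [OF g(2,1), of "-1"] by simp
  have "eq_ae \<Omega> (wcurl \<Omega> (\<lambda>x. ?g' x - ?g x)) (\<lambda>x. 0)"
    using wcurl_add_scaled [OF g(2,1), of "-1"] wcurl_wgrad [OF P_space_H1 [OF assms(2)]] wcurl_wgrad [OF P_space_H1 [OF assms(3)]]
    unfolding eq_ae_def by eventually_elim simp
  with wcurl_add_scaled [OF D w, of t] show ?thesis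
    unfolding eq_ae_def by eventually_elim simp
qed

text \<open>The field \<open>E' - E - \<theta> \<nabla>(p' - p)\<close> is an admissible test function because gradients of
  pressures lie in the edge element space; as they are curl free, testing with it and with \<open>H' - H\<close>
  makes the coupling terms cancel.\<close>

lemma em_step_difference:
  assumes p: "p \<in> P_space \<Omega> \<T>" and p': "p' \<in> P_space \<Omega> \<T>"
    and em: "em_step \<Omega> \<T> c o1 o2 hn p E H" and em': "em_step \<Omega> \<T> c o1 o2 hn p' E' H'"
  shows "eq_ae \<Omega> E' (\<lambda>x. E x + (c_L c / s) *\<^sub>R (wgrad \<Omega> p' x - wgrad \<Omega> p x))"
    and "eq_ae \<Omega> H' H"
proof -
  define \<theta> where "\<theta> = c_L c / s"
  define w where "w x = wgrad \<Omega> p' x - wgrad \<Omega> p x" for x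
  define d where "d x = E' x - E x" for x
  define e where "e x = d x + (- \<theta>) *\<^sub>R w x" for x
  define \<eta> where "\<eta> x = H' x - H x" for x
  note g = wgrad_P_space_in_E_space [OF p] wgrad_P_space_in_E_space [OF p']
  have E: "E \<in> E_space \<Omega> \<T>" "E' \<in> E_space \<Omega> \<T>" and H: "H \<in> H_space \<Omega> \<T>" "H' \<in> H_space \<Omega> \<T>"
    using em em' by (simp_all add: em_step_def)
  have w: "w \<in> E_space \<Omega> \<T>" and d: "d \<in> E_space \<Omega> \<T>"
    using g E unfolding w_def [abs_def] d_def [abs_def] by (simp_all add: E_space_diff)
  have e: "e \<in> E_space \<Omega> \<T>"
    unfolding e_def [abs_def] using d w by (rule E_space_add_scaled)
  have \<eta>: "\<eta> \<in> H_space \<Omega> \<T>"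
    unfolding \<eta>_def [abs_def] using H(2,1) by (rule H_space_diff)
  \<comment> \<open>The order matters: \<open>L(4)\<close> and \<open>L(19)\<close> are used below
    as the square integrability of \<eta> and of \<open>wcurl \<Omega> e\<close>.\<close>
  note L = E_space_D(2) [OF e] E_space_D(2) [OF d] E_space_D(2) [OF w] H_space_L2 [OF \<eta>]
    E_space_D(2) [OF E(1)] E_space_D(2) [OF E(2)] H_space_L2 [OF H(1)] H_space_L2 [OF H(2)]
    E_space_D(2) [OF g(1)] E_space_D(2) [OF g(2)] L2_old
    L2_wcurl [OF E_space_D(1) [OF e]] L2_wcurl [OF E_space_D(1) [OF E(1)]] L2_wcurl [OF E_space_D(1) [OF E(2)]]
  have diffs: "d = (\<lambda>x. E' x - E x)" "w = (\<lambda>x. wgrad \<Omega> p' x - wgrad \<Omega> p x)" "\<eta> = (\<lambda>x. H' x - H x)"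
    by (simp_all add: fun_eq_iff d_def w_def \<eta>_def)
  have ip_d: "ip \<Omega> d e = ip \<Omega> E' e - ip \<Omega> E e"
    by (subst diffs(1)) (intro ip_diff_left L)
  have ip_w: "ip \<Omega> w e = ip \<Omega> (wgrad \<Omega> p') e - ip \<Omega> (wgrad \<Omega> p) e"
    by (subst diffs(2)) (intro ip_diff_left L)
  have ip_\<eta>: "ip \<Omega> \<eta> k = ip \<Omega> H' k - ip \<Omega> H k" if "k \<in> L2 \<Omega>" for k
    by (subst diffs(3)) (intro ip_diff_left L that)
  have ip_e: "ip \<Omega> e e = ip \<Omega> d e - \<theta> * ip \<Omega> w e"
  proof -
    have "ip \<Omega> e e = ip \<Omega> (\<lambda>x. d x + (- \<theta>) *\<^sub>R w x) e"
      by (simp only: e_def [symmetric])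
    also have "\<dots> = ip \<Omega> d e + (- \<theta>) * ip \<Omega> w e"
      using L by (simp only: ip_add_left L2_scaleR ip_scaleR_left)
    finally show ?thesis by simp
  qed
  have "c_eps c * (m * (ip \<Omega> E' e - ip \<Omega> E e)) + c_sigma c * (ip \<Omega> E' e - ip \<Omega> E e)
      - (ip \<Omega> H' (wcurl \<Omega> e) - ip \<Omega> H (wcurl \<Omega> e))
      = c_L c * (ip \<Omega> (wgrad \<Omega> p') e - ip \<Omega> (wgrad \<Omega> p) e)"
  proof -
    have "c_eps c * ip \<Omega> (bdf2 (c_tau c) E (f_E o1) (f_E o2)) e + c_sigma c * ip \<Omega> E e
          - ip \<Omega> H (wcurl \<Omega> e) = c_L c * ip \<Omega> (wgrad \<Omega> p) e + ip \<Omega> hn e"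
      "c_eps c * ip \<Omega> (bdf2 (c_tau c) E' (f_E o1) (f_E o2)) e + c_sigma c * ip \<Omega> E' e
          - ip \<Omega> H' (wcurl \<Omega> e) = c_L c * ip \<Omega> (wgrad \<Omega> p') e + ip \<Omega> hn e"
      using em em' e by (simp_all add: em_step_def)
    moreover have "ip \<Omega> (bdf2 (c_tau c) E' (f_E o1) (f_E o2)) e =
        ip \<Omega> (bdf2 (c_tau c) E (f_E o1) (f_E o2)) e + m * (ip \<Omega> E' e - ip \<Omega> E e)"
      using L by (intro ip_bdf2_diff)
    ultimately show ?thesis
      by (simp only: distrib_left right_diff_distrib)
  qed
  then have "s * ip \<Omega> d e - ip \<Omega> \<eta> (wcurl \<Omega> e) = c_L c * ip \<Omega> w e"
    unfolding ip_d ip_w ip_\<eta> [OF L(19)] by (simp add: algebra_simps)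
  \<comment> \<open>This is the choice of \<theta>: the pressure term becomes \<open>s\<close> times
    \<theta> times the pairing of \<open>w\<close> with \<open>e\<close>, and it is absorbed on the
    left since \<open>e\<close> is \<open>d\<close> minus \<theta> times \<open>w\<close>.\<close>
  moreover have "s * \<theta> = c_L c"
    using pos by (simp add: \<theta>_def)
  ultimately have 1: "s * ip \<Omega> e e = ip \<Omega> \<eta> (wcurl \<Omega> e)"
    unfolding ip_e right_diff_distrib mult.assoc [symmetric] by simp
  have curl_e: "ip \<Omega> (wcurl \<Omega> e) \<eta> = ip \<Omega> (wcurl \<Omega> E') \<eta> - ip \<Omega> (wcurl \<Omega> E) \<eta>"
  proof -
    have "eq_ae \<Omega> (wcurl \<Omega> e) (wcurl \<Omega> d)"
      using wcurl_add_wgrad_diff [OF d p p', of "- \<theta>"] by (simp only: e_def [abs_def] w_def)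
    moreover have "eq_ae \<Omega> (wcurl \<Omega> d) (\<lambda>x. wcurl \<Omega> E' x - wcurl \<Omega> E x)"
      using wcurl_add_scaled [OF E_space_D(1) [OF E(2)] E_space_D(1) [OF E(1)], of "-1"] by (simp add: d_def [abs_def])
    ultimately have "eq_ae \<Omega> (wcurl \<Omega> e) (\<lambda>x. wcurl \<Omega> E' x - wcurl \<Omega> E x)"
      by (rule eq_ae_trans)
    then have "ip \<Omega> (wcurl \<Omega> e) \<eta> = ip \<Omega> (\<lambda>x. wcurl \<Omega> E' x - wcurl \<Omega> E x) \<eta>"
      using L by (intro ip_cong_ae eq_ae_refl L2_diff)
    then show ?thesis
      using L by (simp add: ip_diff_left)
  qed
  have 2: "c_mu c * (m * ip \<Omega> \<eta> \<eta>) + ip \<Omega> (wcurl \<Omega> e) \<eta> = 0"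
  proof -
    have "c_mu c * ip \<Omega> (bdf2 (c_tau c) H (f_H o1) (f_H o2)) \<eta> + ip \<Omega> (wcurl \<Omega> E) \<eta> = 0"
      "c_mu c * ip \<Omega> (bdf2 (c_tau c) H' (f_H o1) (f_H o2)) \<eta> + ip \<Omega> (wcurl \<Omega> E') \<eta> = 0"
      using em em' \<eta> by (simp_all add: em_step_def)
    moreover have "ip \<Omega> (bdf2 (c_tau c) H' (f_H o1) (f_H o2)) \<eta> =
        ip \<Omega> (bdf2 (c_tau c) H (f_H o1) (f_H o2)) \<eta> + m * (ip \<Omega> H' \<eta> - ip \<Omega> H \<eta>)"
      using L by (intro ip_bdf2_diff)
    ultimately show ?thesis
      unfolding curl_e ip_\<eta> [OF L(4)] by (simp only: distrib_left)
  qed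
  have "s * ip \<Omega> e e + (c_mu c * m) * ip \<Omega> \<eta> \<eta> = 0"
    using 1 2 ip_commute [of \<Omega> \<eta> "wcurl \<Omega> e"] by simp
  moreover have "s * ip \<Omega> e e \<ge> 0" "(c_mu c * m) * ip \<Omega> \<eta> \<eta> \<ge> 0"
    using pos by (intro mult_nonneg_nonneg ip_self_nonneg less_imp_le mult_pos_pos; simp)+
  ultimately have "s * ip \<Omega> e e = 0" "(c_mu c * m) * ip \<Omega> \<eta> \<eta> = 0"
    by linarith+
  then have "ip \<Omega> e e = 0" "ip \<Omega> \<eta> \<eta> = 0"
    using pos by auto
  then have "eq_ae \<Omega> e (\<lambda>x. 0)" "eq_ae \<Omega> \<eta> (\<lambda>x. 0)"
    using ip_self_eq_0 L by blast+
  then show "eq_ae \<Omega> E' (\<lambda>x. E x + (c_L c / s) *\<^sub>R (wgrad \<Omega> p' x - wgrad \<Omega> p x))" "eq_ae \<Omega> H' H"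
    by (simp_all add: eq_ae_def e_def d_def w_def \<eta>_def \<theta>_def algebra_simps)
qed

text \<open>Adding \<theta> times the difference of the gradients changes the left-hand side of the
  first equation by \<open>s * \<theta>\<close>, which is \<open>c_L c\<close>, times that
  difference, and changes no curl. This is how fields defined only by the formula are seen to solve
  the electromagnetic step.\<close>

lemma em_step_recover:
  assumes p: "p \<in> P_space \<Omega> \<T>" and p': "p' \<in> P_space \<Omega> \<T>"
    and em: "em_step \<Omega> \<T> c o1 o2 hn p E H"
    and E': "eq_ae \<Omega> E' (\<lambda>x. E x + (c_L c / s) *\<^sub>R (wgrad \<Omega> p' x - wgrad \<Omega> p x))"
    and H': "eq_ae \<Omega> H' H"
  shows "em_step \<Omega> \<T> c o1 o2 hn p' E' H'"
proof -
  define \<theta> where "\<theta> = c_L c / s"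
  define w where "w x = wgrad \<Omega> p' x - wgrad \<Omega> p x" for x
  note g = wgrad_P_space_in_E_space [OF p] wgrad_P_space_in_E_space [OF p']
  have E: "E \<in> E_space \<Omega> \<T>" and H: "H \<in> H_space \<Omega> \<T>"
    using em by (simp_all add: em_step_def)
  have w: "w \<in> E_space \<Omega> \<T>"
    using g E unfolding w_def [abs_def] by (simp add: E_space_diff)
  have F: "(\<lambda>x. E x + \<theta> *\<^sub>R w x) \<in> E_space \<Omega> \<T>"
    using E w by (rule E_space_add_scaled)
  have EF: "eq_ae \<Omega> E' (\<lambda>x. E x + \<theta> *\<^sub>R w x)"
    using E' by (simp add: \<theta>_def w_def)
  have E'_in: "E' \<in> E_space \<Omega> \<T>"
    using eq_ae_sym [OF EF] F by (rule E_space_eq_ae)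
  have H'_in: "H' \<in> H_space \<Omega> \<T>"
    using eq_ae_sym [OF H'] H by (rule H_space_eq_ae)
  have "eq_ae \<Omega> (wcurl \<Omega> E') (wcurl \<Omega> E)"
    using wcurl_eq_ae [OF EF E_space_D(1) [OF E'_in]] wcurl_add_wgrad_diff [OF E p p', of \<theta>]
    unfolding w_def by (rule eq_ae_trans)
  note L = E_space_D(2) [OF w] E_space_D(2) [OF E] E_space_D(2) [OF E'_in] E_space_D(2) [OF F]
    H_space_L2 [OF H] H_space_L2 [OF H'_in] E_space_D(2) [OF g(1)] E_space_D(2) [OF g(2)] L2_old
    L2_wcurl [OF E_space_D(1) [OF E]] L2_wcurl [OF E_space_D(1) [OF E'_in]]
  show ?thesis
    unfolding em_step_def
  proof (intro conjI ballI E'_in H'_in)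
    fix D assume D: "D \<in> E_space \<Omega> \<T>"
    note LD = E_space_D(2) [OF D] L2_wcurl [OF E_space_D(1) [OF D]]
    have "ip \<Omega> E' D = ip \<Omega> (\<lambda>x. E x + \<theta> *\<^sub>R w x) D"
      using L LD by (intro ip_cong_ae EF eq_ae_refl)
    also have "\<dots> = ip \<Omega> E D + \<theta> * ip \<Omega> w D"
      using L LD by (simp only: ip_add_left L2_scaleR ip_scaleR_left)
    finally have a: "ip \<Omega> E' D = ip \<Omega> E D + \<theta> * ip \<Omega> w D" .
    have b: "ip \<Omega> (bdf2 (c_tau c) E' (f_E o1) (f_E o2)) D =
        ip \<Omega> (bdf2 (c_tau c) E (f_E o1) (f_E o2)) D + m * (ip \<Omega> E' D - ip \<Omega> E D)"
      using L LD by (intro ip_bdf2_diff)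
    have h: "ip \<Omega> H' (wcurl \<Omega> D) = ip \<Omega> H (wcurl \<Omega> D)"
      using L LD by (intro ip_cong_ae H' eq_ae_refl)
    have "ip \<Omega> (wgrad \<Omega> p') D = ip \<Omega> w D + ip \<Omega> (wgrad \<Omega> p) D"
      unfolding w_def [abs_def] using L LD by (simp add: ip_diff_left)
    moreover have "s * \<theta> * ip \<Omega> w D = c_L c * ip \<Omega> w D"
      using pos by (simp add: \<theta>_def)
    moreover have "c_eps c * ip \<Omega> (bdf2 (c_tau c) E (f_E o1) (f_E o2)) D + c_sigma c * ip \<Omega> E D
        - ip \<Omega> H (wcurl \<Omega> D) = c_L c * ip \<Omega> (wgrad \<Omega> p) D + ip \<Omega> hn D"
      using em D by (simp add: em_step_def)
    ultimately show "c_eps c * ip \<Omega> (bdf2 (c_tau c) E' (f_E o1) (f_E o2)) D + c_sigma c * ip \<Omega> E' D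
        - ip \<Omega> H' (wcurl \<Omega> D) = c_L c * ip \<Omega> (wgrad \<Omega> p') D + ip \<Omega> hn D"
      unfolding a b h by (simp add: algebra_simps)
  next
    fix B assume B: "B \<in> H_space \<Omega> \<T>"
    note LB = H_space_L2 [OF B]
    have "ip \<Omega> (bdf2 (c_tau c) H' (f_H o1) (f_H o2)) B =
        ip \<Omega> (bdf2 (c_tau c) H (f_H o1) (f_H o2)) B + m * (ip \<Omega> H' B - ip \<Omega> H B)"
      using L LB by (intro ip_bdf2_diff)
    moreover have "ip \<Omega> H' B = ip \<Omega> H B"
      using L LB by (intro ip_cong_ae H' eq_ae_refl)
    moreover have "ip \<Omega> (wcurl \<Omega> E') B = ip \<Omega> (wcurl \<Omega> E) B"
      using L LB \<open>eq_ae \<Omega> (wcurl \<Omega> E') (wcurl \<Omega> E)\<close> by (intro ip_cong_ae eq_ae_refl)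
    ultimately show "c_mu c * ip \<Omega> (bdf2 (c_tau c) H' (f_H o1) (f_H o2)) B + ip \<Omega> (wcurl \<Omega> E') B = 0"
      using em B by (simp add: em_step_def)
  qed
qed

text \<open>Inserting the recovery formula multiplies the amplitude \<open>c_L c / s\<close> once
  more by \<open>c_L c\<close>; this is the origin of the coefficient of the extra diffusion term in
  the reduced scheme.\<close>

lemma pressure_coupling:
  assumes p: "p \<in> P_space \<Omega> \<T>" and p': "p' \<in> P_space \<Omega> \<T>" and q: "q \<in> P_space \<Omega> \<T>"
    and E: "E \<in> E_space \<Omega> \<T>"
    and E': "eq_ae \<Omega> E' (\<lambda>x. E x + (c_L c / s) *\<^sub>R (wgrad \<Omega> p' x - wgrad \<Omega> p x))"
  shows "c_L c * ip \<Omega> E' (wgrad \<Omega> q) = c_L c * ip \<Omega> E (wgrad \<Omega> q)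
    + (c_L c)\<^sup>2 / s * ip \<Omega> (\<lambda>x. wgrad \<Omega> p' x - wgrad \<Omega> p x) (wgrad \<Omega> q)"
proof -
  note L = E_space_D(2) [OF E] L2_wgrad [OF P_space_H1 [OF p]] L2_wgrad [OF P_space_H1 [OF p']] L2_wgrad [OF P_space_H1 [OF q]]
  have F: "(\<lambda>x. E x + (c_L c / s) *\<^sub>R (wgrad \<Omega> p' x - wgrad \<Omega> p x)) \<in> L2 \<Omega>"
    using L by (intro L2_add L2_scaleR L2_diff)
  have "ip \<Omega> E' (wgrad \<Omega> q) = ip \<Omega> (\<lambda>x. E x + (c_L c / s) *\<^sub>R (wgrad \<Omega> p' x - wgrad \<Omega> p x)) (wgrad \<Omega> q)"
    using L F L2_eq_ae [OF eq_ae_sym [OF E'] F measurable_domain] by (intro ip_cong_ae E' eq_ae_refl)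
  also have "\<dots> = ip \<Omega> E (wgrad \<Omega> q) + c_L c / s * ip \<Omega> (\<lambda>x. wgrad \<Omega> p' x - wgrad \<Omega> p x) (wgrad \<Omega> q)"
    using L by (simp only: ip_add_left L2_scaleR L2_diff ip_scaleR_left)
  finally show ?thesis
    by (simp add: distrib_left power2_eq_square)
qed

section \<open>Unique solvability of the poroelastic step\<close>

lemma U_space_component:
  assumes "u \<in> U_space \<Omega> \<Gamma> \<T>"
  shows "(\<lambda>x. u x $ i) \<in> H1 \<Omega>"
  using assms by (simp add: U_space_def H1_vec_def)

lemma L2_wgrad_vec: "u \<in> U_space \<Omega> \<Gamma> \<T> \<Longrightarrow> wgrad_vec \<Omega> u \<in> L2 \<Omega>"
  by (rule L2_vecI) (simp add: wgrad_vec_def L2_wgrad U_space_component)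

lemma L2_wdiv: "u \<in> U_space \<Omega> \<Gamma> \<T> \<Longrightarrow> wdiv \<Omega> u \<in> L2 \<Omega>"
  unfolding wdiv_def [abs_def] by (intro L2_sum L2_component L2_wgrad U_space_component)

lemma wgrad_vec_diff:
  assumes "u \<in> U_space \<Omega> \<Gamma> \<T>" "v \<in> U_space \<Omega> \<Gamma> \<T>"
  shows "eq_ae \<Omega> (wgrad_vec \<Omega> (\<lambda>x. u x - v x)) (\<lambda>x. wgrad_vec \<Omega> u x - wgrad_vec \<Omega> v x)"
proof (rule eq_ae_componentI)
  fix i
  show "eq_ae \<Omega> (\<lambda>x. wgrad_vec \<Omega> (\<lambda>x. u x - v x) x $ i) (\<lambda>x. (wgrad_vec \<Omega> u x - wgrad_vec \<Omega> v x) $ i)"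
    using wgrad_diff [OF U_space_component [OF assms(1)] U_space_component [OF assms(2)], of i i]
    by (simp add: wgrad_vec_def)
qed

lemma wdiv_wgrad_vec: "wdiv \<Omega> v x = (\<Sum>i\<in>UNIV. wgrad_vec \<Omega> v x $ i $ i)"
  by (simp add: wdiv_def wgrad_vec_def)

lemma wdiv_diff:
  assumes "u \<in> U_space \<Omega> \<Gamma> \<T>" "v \<in> U_space \<Omega> \<Gamma> \<T>"
  shows "eq_ae \<Omega> (wdiv \<Omega> (\<lambda>x. u x - v x)) (\<lambda>x. wdiv \<Omega> u x - wdiv \<Omega> v x)"
  using wgrad_vec_diff [OF assms] unfolding eq_ae_def
  by eventually_elim (simp add: wdiv_wgrad_vec sum_subtractf)

text \<open>A qualitative substitute for Friedrichs' inequality: each component is constant, and it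
  vanishes at a point of the Dirichlet part.\<close>

lemma U_space_zero_if_grad_zero:
  assumes u: "u \<in> U_space \<Omega> \<Gamma> \<T>" and grad: "eq_ae \<Omega> (wgrad_vec \<Omega> u) (\<lambda>x. 0)" and x: "x \<in> closure \<Omega>"
  shows "u x = 0"
proof -
  have "u x $ i = 0" for i
  proof -
    have "\<exists>a. \<forall>x\<in>closure \<Omega>. u x $ i = a"
    proof (rule constant_if_wgrad_zero [OF U_space_component [OF u]])
      show "continuous_on (closure \<Omega>) (\<lambda>x. u x $ i)"
        using u by (simp add: U_space_def continuous_on_component)
      show "eq_ae \<Omega> (wgrad \<Omega> (\<lambda>x. u x $ i)) (\<lambda>x. 0)"
        using grad unfolding eq_ae_def by eventually_elim (simp add: wgrad_vec_def vec_eq_iff)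
      fix K assume "K \<in> \<T>"
      then have "\<exists>r\<in>poly_deg_le_vec 2. \<forall>x\<in>K. u x = r x"
        using u by (simp add: U_space_def)
      then obtain r where "r \<in> poly_deg_le_vec 2" "\<forall>x\<in>K. u x = r x"
        by blast
      then show "\<exists>r\<in>poly_deg_le 2. \<forall>x\<in>K. u x $ i = r x"
        by (intro bexI [where x = "\<lambda>x. r x $ i"]) (simp_all add: poly_deg_le_vec_def)
    qed
    then obtain a where a: "\<And>x. x \<in> closure \<Omega> \<Longrightarrow> u x $ i = a"
      by blast
    obtain y where y: "y \<in> \<Gamma>"
      using dirichlet_part(1) by blast
    then have "u y = 0"
      using u by (simp add: U_space_def)
    then show ?thesis
      using a [of y] a [OF x] y dirichlet_part(2) by auto
  qed
  then show ?thesis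
    by (simp add: vec_eq_iff)
qed

text \<open>Energy identity for the difference of two solutions: the elastic equations, multiplied by the
  BDF2 factor \<open>m\<close>, and the pressure equation add up to
  \<open>m G |\<nabla>u|\<^sup>2 + m/\<lambda> |\<xi> - \<alpha> p|\<^sup>2 + m c\<^sub>0 |p|\<^sup>2 + \<kappa> |\<nabla>p|\<^sup>2 = 0\<close>.\<close>

lemma poroelastic_step_unique:
  assumes u: "u \<in> U_space \<Omega> \<Gamma> \<T>" "u' \<in> U_space \<Omega> \<Gamma> \<T>"
    and xi: "\<xi> \<in> W_space \<Omega> \<T>" "\<xi>' \<in> W_space \<Omega> \<T>"
    and p: "p \<in> P_space \<Omega> \<T>" "p' \<in> P_space \<Omega> \<T>"
    and el: "elasticity_eqs \<Omega> \<Gamma> \<T> c fn u \<xi> p" and el': "elasticity_eqs \<Omega> \<Gamma> \<T> c fn u' \<xi>' p'"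
    and pr: "\<And>q. q \<in> P_space \<Omega> \<T> \<Longrightarrow> pressure_lhs \<Omega> c o1 o2 \<xi> p q = pressure_lhs \<Omega> c o1 o2 \<xi>' p' q"
    and x: "x \<in> closure \<Omega>"
  shows "u x = u' x \<and> \<xi> x = \<xi>' x \<and> p x = p' x"
proof -
  define U where "U x = u x - u' x" for x
  define X where "X x = \<xi> x - \<xi>' x" for x
  define P where "P x = p x - p' x" for x
  \<comment> \<open>The difference of the two chosen representatives stands in for the gradient of
    \<open>P\<close>, with which it agrees almost everywhere; the two pressure equations then
    subtract by linearity alone.\<close>
  define g where "g x = wgrad \<Omega> p x - wgrad \<Omega> p' x" for x
  have U: "U \<in> U_space \<Omega> \<Gamma> \<T>" and X: "X \<in> W_space \<Omega> \<T>"
    unfolding U_def [abs_def] X_def [abs_def] using u xi by (simp_all add: U_space_diff W_space_diff)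
  note Lp = P_space_L2 [OF p(1)] P_space_L2 [OF p(2)] and Lg = L2_wgrad [OF P_space_H1 [OF p(1)]] L2_wgrad [OF P_space_H1 [OF p(2)]]
    and Lu = L2_wgrad_vec [OF u(1)] L2_wgrad_vec [OF u(2)] L2_wgrad_vec [OF U]
    and Ld = L2_wdiv [OF u(1)] L2_wdiv [OF u(2)] L2_wdiv [OF U]
    and Lx = W_space_L2 [OF xi(1)] W_space_L2 [OF xi(2)] W_space_L2 [OF X]
  have LP: "P \<in> L2 \<Omega>"
    unfolding P_def [abs_def] using Lp by (rule L2_diff)
  have Lgg: "g \<in> L2 \<Omega>"
    unfolding g_def [abs_def] using Lg by (rule L2_diff)
  have gradU: "ip \<Omega> (wgrad_vec \<Omega> u) k - ip \<Omega> (wgrad_vec \<Omega> u') k = ip \<Omega> (wgrad_vec \<Omega> U) k" if k: "k \<in> L2 \<Omega>" for k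
  proof -
    have "ip \<Omega> (wgrad_vec \<Omega> U) k = ip \<Omega> (\<lambda>x. wgrad_vec \<Omega> u x - wgrad_vec \<Omega> u' x) k"
      using Lu k wgrad_vec_diff [OF u] by (intro ip_cong_ae eq_ae_refl L2_diff) (simp_all add: U_def [abs_def])
    then show ?thesis
      using Lu k by (simp add: ip_diff_left)
  qed
  have divU: "ip \<Omega> (wdiv \<Omega> u) k - ip \<Omega> (wdiv \<Omega> u') k = ip \<Omega> (wdiv \<Omega> U) k" if k: "k \<in> L2 \<Omega>" for k
  proof -
    have "ip \<Omega> (wdiv \<Omega> U) k = ip \<Omega> (\<lambda>x. wdiv \<Omega> u x - wdiv \<Omega> u' x) k"
      using Ld k wdiv_diff [OF u] by (intro ip_cong_ae eq_ae_refl L2_diff) (simp_all add: U_def [abs_def])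
    then show ?thesis
      using Ld k by (simp add: ip_diff_left)
  qed
  have ipX: "ip \<Omega> X k = ip \<Omega> \<xi> k - ip \<Omega> \<xi>' k" and ipP: "ip \<Omega> P k = ip \<Omega> p k - ip \<Omega> p' k" if "k \<in> L2 \<Omega>" for k
    unfolding X_def [abs_def] P_def [abs_def] using Lx Lp that by (simp_all only: ip_diff_left)
  have 1: "c_G c * ip \<Omega> (wgrad_vec \<Omega> U) (wgrad_vec \<Omega> U) - ip \<Omega> X (wdiv \<Omega> U) = 0"
  proof -
    have "c_G c * ip \<Omega> (wgrad_vec \<Omega> u) (wgrad_vec \<Omega> U) - ip \<Omega> \<xi> (wdiv \<Omega> U) = ip \<Omega> fn U"
      "c_G c * ip \<Omega> (wgrad_vec \<Omega> u') (wgrad_vec \<Omega> U) - ip \<Omega> \<xi>' (wdiv \<Omega> U) = ip \<Omega> fn U"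
      using el el' U by (simp_all add: elasticity_eqs_def)
    then show ?thesis
      unfolding gradU [OF Lu(3), symmetric] ipX [OF Ld(3)] by (simp add: right_diff_distrib)
  qed
  have 2: "ip \<Omega> (wdiv \<Omega> U) X + (1 / c_lam c) * ip \<Omega> X X - (c_alpha c / c_lam c) * ip \<Omega> P X = 0"
  proof -
    have "ip \<Omega> (wdiv \<Omega> u) X + (1 / c_lam c) * ip \<Omega> \<xi> X - (c_alpha c / c_lam c) * ip \<Omega> p X = 0"
      "ip \<Omega> (wdiv \<Omega> u') X + (1 / c_lam c) * ip \<Omega> \<xi>' X - (c_alpha c / c_lam c) * ip \<Omega> p' X = 0"
      using el el' X by (simp_all add: elasticity_eqs_def)
    then show ?thesis
      unfolding divU [OF Lx(3), symmetric] ipX [OF Lx(3)] ipP [OF Lx(3)] by (simp add: right_diff_distrib)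
  qed
  define a where "a = c_0 c + (c_alpha c)\<^sup>2 / c_lam c"
  define b where "b = c_alpha c / c_lam c"
  have 3: "a * (m * ip \<Omega> P q) - b * (m * ip \<Omega> X q) + c_kappa c * ip \<Omega> g (wgrad \<Omega> q) = 0"
    if q: "q \<in> P_space \<Omega> \<T>" for q
  proof -
    note Lq = P_space_L2 [OF q] L2_wgrad [OF P_space_H1 [OF q]]
    have "ip \<Omega> (bdf2 (c_tau c) p (f_p o1) (f_p o2)) q = ip \<Omega> (bdf2 (c_tau c) p' (f_p o1) (f_p o2)) q + m * (ip \<Omega> p q - ip \<Omega> p' q)"
      using Lp L2_old Lq by (intro ip_bdf2_diff)
    moreover have "ip \<Omega> (bdf2 (c_tau c) \<xi> (f_xi o1) (f_xi o2)) q = ip \<Omega> (bdf2 (c_tau c) \<xi>' (f_xi o1) (f_xi o2)) q + m * (ip \<Omega> \<xi> q - ip \<Omega> \<xi>' q)"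
      using Lx L2_old Lq by (intro ip_bdf2_diff)
    moreover have "ip \<Omega> (wgrad \<Omega> p) (wgrad \<Omega> q) = ip \<Omega> g (wgrad \<Omega> q) + ip \<Omega> (wgrad \<Omega> p') (wgrad \<Omega> q)"
      unfolding g_def [abs_def] using Lg Lq by (simp add: ip_diff_left)
    ultimately show ?thesis
      using pr [OF q] unfolding pressure_lhs_def a_def [symmetric] b_def [symmetric] ipX [OF Lq(1)] ipP [OF Lq(1)]
      by (simp add: algebra_simps)
  qed
  \<comment> \<open>Testing with \<open>P\<close> is replaced by subtracting the equations tested
    with \<open>p\<close> and \<open>p'\<close>, so membership of \<open>P\<close> in
    \<open>P_space\<close> does not have to be established.\<close>
  have 4: "a * (m * ip \<Omega> P P) - b * (m * ip \<Omega> X P) + c_kappa c * ip \<Omega> g g = 0"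
  proof -
    have "ip \<Omega> P P = ip \<Omega> P p - ip \<Omega> P p'" "ip \<Omega> X P = ip \<Omega> X p - ip \<Omega> X p'"
      using LP Lp Lx ip_diff_right [OF Lp LP] ip_diff_right [OF Lp Lx(3)] by (simp_all only: P_def [symmetric])
    moreover have "ip \<Omega> g g = ip \<Omega> g (wgrad \<Omega> p) - ip \<Omega> g (wgrad \<Omega> p')"
      using ip_diff_right [OF Lg Lgg] by (simp only: g_def [symmetric])
    ultimately show ?thesis
      using 3 [OF p(1)] 3 [OF p(2)] by (simp only: right_diff_distrib)
  qed
  \<comment> \<open>Completes the square: one mixed term comes from the volumetric equation, the
    other from the pressure equation, and the \<alpha>-dependent part of \<open>a\<close> supplies
    the square of \<open>P\<close>, leaving \<open>c_0 c\<close> for the separate pressure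
    term.\<close>
  define Y where "Y x = X x - c_alpha c *\<^sub>R P x" for x
  have Y: "ip \<Omega> Y Y = ip \<Omega> X X - 2 * c_alpha c * ip \<Omega> X P + (c_alpha c)\<^sup>2 * ip \<Omega> P P"
  proof -
    have LY: "(\<lambda>x. c_alpha c *\<^sub>R P x) \<in> L2 \<Omega>" "(\<lambda>x. X x - c_alpha c *\<^sub>R P x) \<in> L2 \<Omega>"
      using L2_scaleR [OF LP] L2_diff [OF Lx(3) L2_scaleR [OF LP]] by blast+
    have "ip \<Omega> Y Y = ip \<Omega> (\<lambda>x. X x - c_alpha c *\<^sub>R P x) (\<lambda>x. X x - c_alpha c *\<^sub>R P x)"
      by (simp only: Y_def [abs_def])
    also have "\<dots> = (ip \<Omega> X X - c_alpha c * ip \<Omega> X P) - c_alpha c * (ip \<Omega> P X - c_alpha c * ip \<Omega> P P)"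
      using LY LP Lx by (simp only: ip_diff_left ip_diff_right ip_scaleR_left ip_scaleR_right)
    finally show ?thesis
      by (simp add: ip_commute [of \<Omega> P X] power2_eq_square algebra_simps)
  qed
  have energy: "m * c_G c * ip \<Omega> (wgrad_vec \<Omega> U) (wgrad_vec \<Omega> U) + m / c_lam c * ip \<Omega> Y Y
      + m * c_0 c * ip \<Omega> P P + c_kappa c * ip \<Omega> g g = 0"
  proof -
    have "m * (c_G c * ip \<Omega> (wgrad_vec \<Omega> U) (wgrad_vec \<Omega> U) + (1 / c_lam c) * ip \<Omega> X X - b * ip \<Omega> X P) = 0"
      using 1 2 by (simp add: b_def ip_commute [of \<Omega> "wdiv \<Omega> U"] ip_commute [of \<Omega> P X])
    with 4 show ?thesis
      unfolding Y a_def b_def by (simp add: algebra_simps add_divide_distrib diff_divide_distrib)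
  qed
  have nonneg: "0 \<le> m * c_G c * ip \<Omega> (wgrad_vec \<Omega> U) (wgrad_vec \<Omega> U)" "0 \<le> m / c_lam c * ip \<Omega> Y Y"
      "0 \<le> m * c_0 c * ip \<Omega> P P" "0 \<le> c_kappa c * ip \<Omega> g g"
    using pos by (intro mult_nonneg_nonneg divide_nonneg_nonneg ip_self_nonneg; simp)+
  have "m * c_G c * ip \<Omega> (wgrad_vec \<Omega> U) (wgrad_vec \<Omega> U) = 0" "m / c_lam c * ip \<Omega> Y Y = 0" "m * c_0 c * ip \<Omega> P P = 0"
    using energy nonneg by linarith+
  then have zero: "ip \<Omega> (wgrad_vec \<Omega> U) (wgrad_vec \<Omega> U) = 0" "ip \<Omega> Y Y = 0" "ip \<Omega> P P = 0"
    using pos by auto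
  have P0: "eq_ae \<Omega> P (\<lambda>x. 0)"
    using LP zero(3) by (rule ip_self_eq_0)
  \<comment> \<open>The energy controls the total pressure only through \<open>Y\<close>; once
    \<open>P\<close> is known to vanish, the expansion of \<open>Y\<close> reduces to the norm of
    \<open>X\<close>.\<close>
  have "ip \<Omega> X P = ip \<Omega> X (\<lambda>x. 0)"
    using Lx LP by (intro ip_cong_ae P0 eq_ae_refl L2_zero)
  then have "ip \<Omega> X X = 0"
    using Y zero by (simp add: ip_zero_right)
  with Lx(3) have X0: "eq_ae \<Omega> X (\<lambda>x. 0)"
    by (rule ip_self_eq_0)
  have "P x = 0"
    using P0 x p by (intro ae_zero_imp_zero_on_closure) (auto simp: P_def [abs_def] P_space_def intro: continuous_on_diff)
  moreover have "X x = 0"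
    using X0 x X by (intro ae_zero_imp_zero_on_closure) (simp_all add: W_space_def)
  moreover have "U x = 0"
    using U ip_self_eq_0 [OF Lu(3) zero(1)] x by (rule U_space_zero_if_grad_zero)
  ultimately show ?thesis
    by (simp add: P_def X_def U_def)
qed

section \<open>Equivalence of the two schemes and uniqueness of the iterates\<close>

lemma pressure_in_P_space:
  assumes "p0 \<in> P_space \<Omega> \<T>" "\<And>i. 1 \<le> i \<Longrightarrow> f_p (sq i) \<in> P_space \<Omega> \<T>"
  shows "pressure p0 sq i \<in> P_space \<Omega> \<T>"
  using assms by (simp add: pressure_def)

text \<open>The recovery formula takes the weak gradient of a difference, whereas the
  electromagnetic step produces a difference of weak gradients. The chosen representatives may
  differ, but only on a null set.\<close>

lemma recovery_formula_iff:
  assumes "p0 \<in> P_space \<Omega> \<T>" "p \<in> P_space \<Omega> \<T>"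
  shows "eq_ae \<Omega> E' (\<lambda>x. E x + t *\<^sub>R wgrad \<Omega> (\<lambda>y. p y - p0 y) x)
    \<longleftrightarrow> eq_ae \<Omega> E' (\<lambda>x. E x + t *\<^sub>R (wgrad \<Omega> p x - wgrad \<Omega> p0 x))"
proof -
  have "eq_ae \<Omega> (\<lambda>x. E x + t *\<^sub>R wgrad \<Omega> (\<lambda>y. p y - p0 y) x) (\<lambda>x. E x + t *\<^sub>R (wgrad \<Omega> p x - wgrad \<Omega> p0 x))"
    by (intro eq_ae_add eq_ae_refl eq_ae_scaleR wgrad_diff P_space_H1 assms)
  then show ?thesis
    using eq_ae_trans eq_ae_sym by blast
qed

text \<open>Each iterate is compared directly with the first one, whose step uses \<open>p0\<close>,
  and not with its predecessor. Hence no induction on \<open>i\<close> is involved and no sum of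
  increments appears.\<close>

lemma iterative_scheme_em_recovery:
  assumes p0: "p0 \<in> P_space \<Omega> \<T>" and it: "iterative_scheme \<Omega> \<Gamma> \<T> c o1 o2 hn fn gn p0 sq" and i: "i \<ge> 1"
  shows "em_recovery \<Omega> c p0 sq i"
proof -
  have it: "em_step \<Omega> \<T> c o1 o2 hn (pressure p0 sq (i - 1)) (f_E (sq i)) (f_H (sq i))"
    "f_p (sq i) \<in> P_space \<Omega> \<T>" if "i \<ge> 1" for i
    using it that by (simp_all add: iterative_scheme_def)
  have "em_step \<Omega> \<T> c o1 o2 hn p0 (f_E (sq 1)) (f_H (sq 1))"
    using it(1) [of 1] by (simp add: pressure_def)
  moreover have P: "pressure p0 sq (i - 1) \<in> P_space \<Omega> \<T>"
    using it(2) by (intro pressure_in_P_space [OF p0])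
  ultimately show ?thesis
    unfolding em_recovery_def recovery_formula_iff [OF p0 P]
    using em_step_difference [OF p0 P _ it(1) [OF i]] by simp
qed

text \<open>Both directions use the recovery formula for the same sequence: the iterative scheme
  implies it, the reduced scheme contains it. It equates the right-hand sides of the pressure
  equations and, in the converse direction, restores the electromagnetic step for every
  \<open>i\<close>.\<close>

lemma iterative_scheme_iff_reduced_scheme:
  assumes p0: "p0 \<in> P_space \<Omega> \<T>"
  shows "iterative_scheme \<Omega> \<Gamma> \<T> c o1 o2 hn fn gn p0 sq \<longleftrightarrow> reduced_scheme \<Omega> \<Gamma> \<T> c o1 o2 hn fn gn p0 sq"
    (is "?it \<longleftrightarrow> ?red")
proof -
  let ?p = "\<lambda>i. pressure p0 sq (i - 1)"
  have coupling: "c_L c * ip \<Omega> (f_E (sq i)) (wgrad \<Omega> q) = c_L c * ip \<Omega> (f_E (sq 1)) (wgrad \<Omega> q)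
      + (c_L c)\<^sup>2 / s * ip \<Omega> (\<lambda>x. wgrad \<Omega> (?p i) x - wgrad \<Omega> p0 x) (wgrad \<Omega> q)"
    if "em_recovery \<Omega> c p0 sq i" "?p i \<in> P_space \<Omega> \<T>" "f_E (sq 1) \<in> E_space \<Omega> \<T>" "q \<in> P_space \<Omega> \<T>" for i q
    using that(1) unfolding em_recovery_def recovery_formula_iff [OF p0 that(2)]
    by (intro pressure_coupling [OF p0 that(2,4,3)]) simp
  show ?thesis
  proof
    assume it: ?it
    note rec = iterative_scheme_em_recovery [OF p0 it]
    have it1: "em_step \<Omega> \<T> c o1 o2 hn p0 (f_E (sq 1)) (f_H (sq 1))"
      using it [unfolded iterative_scheme_def, rule_format, of 1] by (simp add: pressure_def)
    have P: "?p i \<in> P_space \<Omega> \<T>" for i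
      using it by (intro pressure_in_P_space [OF p0]) (simp add: iterative_scheme_def)
    have E1: "f_E (sq 1) \<in> E_space \<Omega> \<T>"
      using it1 by (simp add: em_step_def)
    show ?red
      unfolding reduced_scheme_def
    proof (intro conjI allI impI it1)
      fix i :: nat assume i: "1 \<le> i"
      note iti = it [unfolded iterative_scheme_def, rule_format, OF i]
      show "f_u (sq i) \<in> U_space \<Omega> \<Gamma> \<T>" "f_xi (sq i) \<in> W_space \<Omega> \<T>" "f_p (sq i) \<in> P_space \<Omega> \<T>"
        "elasticity_eqs \<Omega> \<Gamma> \<T> c fn (f_u (sq i)) (f_xi (sq i)) (f_p (sq i))"
        using iti by simp_all
      show "em_recovery \<Omega> c p0 sq i"
        using i by (rule rec)
      show "\<forall>q\<in>P_space \<Omega> \<T>. pressure_lhs \<Omega> c o1 o2 (f_xi (sq i)) (f_p (sq i)) q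
           = c_L c * ip \<Omega> (f_E (sq 1)) (wgrad \<Omega> q)
             + (c_L c)\<^sup>2 / s * ip \<Omega> (\<lambda>x. wgrad \<Omega> (?p i) x - wgrad \<Omega> p0 x) (wgrad \<Omega> q) + ip \<Omega> gn q"
        using iti coupling [OF rec [OF i] P E1] by simp
    qed
  next
    assume red: ?red
    have em1: "em_step \<Omega> \<T> c o1 o2 hn p0 (f_E (sq 1)) (f_H (sq 1))"
      using red by (simp add: reduced_scheme_def)
    have P: "?p i \<in> P_space \<Omega> \<T>" for i
      using red by (intro pressure_in_P_space [OF p0]) (simp add: reduced_scheme_def)
    have E1: "f_E (sq 1) \<in> E_space \<Omega> \<T>"
      using em1 by (simp add: em_step_def)
    show ?it
      unfolding iterative_scheme_def
    proof (intro conjI allI impI)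
      fix i :: nat assume i: "1 \<le> i"
      note redi = red [unfolded reduced_scheme_def, THEN conjunct2, rule_format, OF i]
      show "f_u (sq i) \<in> U_space \<Omega> \<Gamma> \<T>" "f_xi (sq i) \<in> W_space \<Omega> \<T>" "f_p (sq i) \<in> P_space \<Omega> \<T>"
        "elasticity_eqs \<Omega> \<Gamma> \<T> c fn (f_u (sq i)) (f_xi (sq i)) (f_p (sq i))"
        using redi by simp_all
      have rec: "em_recovery \<Omega> c p0 sq i"
        using redi by simp
      then show "em_step \<Omega> \<T> c o1 o2 hn (?p i) (f_E (sq i)) (f_H (sq i))"
        unfolding em_recovery_def recovery_formula_iff [OF p0 P]
        by (intro em_step_recover [OF p0 P em1]) simp_all
      show "\<forall>q\<in>P_space \<Omega> \<T>. pressure_lhs \<Omega> c o1 o2 (f_xi (sq i)) (f_p (sq i)) q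
           = c_L c * ip \<Omega> (f_E (sq i)) (wgrad \<Omega> q) + ip \<Omega> gn q"
        using redi coupling [OF rec P E1] by simp
    qed
  qed
qed

text \<open>One iteration depends on the previous one only through the gradient of its pressure.
  Pressures that agree pointwise have the same \<open>wgrad\<close>, so uniqueness of the two linear
  steps propagates by induction, starting from the common \<open>p0\<close>.\<close>

lemma iterative_scheme_unique:
  assumes p0: "p0 \<in> P_space \<Omega> \<T>"
    and it: "iterative_scheme \<Omega> \<Gamma> \<T> c o1 o2 hn fn gn p0 sq"
    and it': "iterative_scheme \<Omega> \<Gamma> \<T> c o1 o2 hn fn gn p0 sq'"
    and i: "i \<ge> 1"
  shows "same_fields \<Omega> (sq i) (sq' i)"
  using i
proof (induction i rule: less_induct)
  case (less i)
  note iti = it [unfolded iterative_scheme_def, rule_format, OF less.prems]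
  note iti' = it' [unfolded iterative_scheme_def, rule_format, OF less.prems]
  let ?p = "pressure p0 sq (i - 1)" and ?p' = "pressure p0 sq' (i - 1)"
  have P: "?p \<in> P_space \<Omega> \<T>" "?p' \<in> P_space \<Omega> \<T>"
    using it it' by (auto intro!: pressure_in_P_space [OF p0] simp: iterative_scheme_def)
  have "?p' x = ?p x" if "x \<in> \<Omega>" for x
  proof (cases "i = 1")
    case False
    then have "same_fields \<Omega> (sq (i - 1)) (sq' (i - 1))"
      using less by simp
    then show ?thesis
      using that closure_subset [of \<Omega>] False less.prems by (auto simp: same_fields_def pressure_def)
  qed (simp add: pressure_def)
  then have g: "wgrad \<Omega> ?p' = wgrad \<Omega> ?p"
    by (rule wgrad_cong)
  have em: "em_step \<Omega> \<T> c o1 o2 hn ?p (f_E (sq i)) (f_H (sq i))"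
    "em_step \<Omega> \<T> c o1 o2 hn ?p' (f_E (sq' i)) (f_H (sq' i))"
    using iti iti' by simp_all
  \<comment> \<open>With equal gradients the correction term is zero, and the difference lemma
    becomes uniqueness of the electromagnetic step.\<close>
  have E: "eq_ae \<Omega> (f_E (sq' i)) (f_E (sq i))" and H: "eq_ae \<Omega> (f_H (sq' i)) (f_H (sq i))"
    using em_step_difference [OF P em, unfolded g] by simp_all
  have "pressure_lhs \<Omega> c o1 o2 (f_xi (sq i)) (f_p (sq i)) q = pressure_lhs \<Omega> c o1 o2 (f_xi (sq' i)) (f_p (sq' i)) q"
    if q: "q \<in> P_space \<Omega> \<T>" for q
  proof -
    have "ip \<Omega> (f_E (sq' i)) (wgrad \<Omega> q) = ip \<Omega> (f_E (sq i)) (wgrad \<Omega> q)"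
      using em q by (intro ip_cong_ae E eq_ae_refl L2_wgrad P_space_H1) (auto simp: em_step_def E_space_D)
    then show ?thesis
      using iti iti' q by simp
  qed
  then have "f_u (sq i) x = f_u (sq' i) x \<and> f_xi (sq i) x = f_xi (sq' i) x \<and> f_p (sq i) x = f_p (sq' i) x"
    if "x \<in> closure \<Omega>" for x
    using iti iti' that by (intro poroelastic_step_unique [where fn = fn]) simp_all
  then show ?case
    using E H by (simp add: same_fields_def eq_ae_sym)
qed

end

theorem mainTheorem4:
  fixes \<Omega> \<Gamma>D \<Gamma>N :: "(real^3) set"
    and \<H> :: "real set" and \<T> :: "real \<Rightarrow> (real^3) set set" and h :: real
    and c :: coeffs
    and hs fs :: "nat \<Rightarrow> vector_field" and gs :: "nat \<Rightarrow> scalar_field"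
    and sol :: "nat \<Rightarrow> fields" and p0 :: scalar_field and n :: nat
  assumes "bounded_lipschitz_polyhedron \<Omega>"
    and "boundary_parts \<Omega> \<Gamma>D \<Gamma>N"
    and "stable_mesh_family \<Omega> \<Gamma>D \<H> \<T>" and "h \<in> \<H>"
    and "admissible c"
    and "n \<ge> 2"
    and "hs n \<in> L2 \<Omega>" and "fs n \<in> L2 \<Omega>" and "gs n \<in> L2 \<Omega>"
    and "sol (n - 1) \<in> S_space \<Omega> \<Gamma>D (\<T> h)" and "sol (n - 2) \<in> S_space \<Omega> \<Gamma>D (\<T> h)"
    and "p0 \<in> P_space \<Omega> (\<T> h)" and "\<forall>x\<in>closure \<Omega>. p0 x = f_p (sol (n - 1)) x"
  shows
    "(\<forall>s. iterative_scheme \<Omega> \<Gamma>D (\<T> h) c (sol (n - 1)) (sol (n - 2)) (hs n) (fs n) (gs n) p0 s \<longrightarrow>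
        (\<forall>i\<ge>1.
           eq_ae \<Omega> (f_E (s i))
             (\<lambda>x. f_E (s 1) x + (c_L c / (c_sigma c + 3 * c_eps c / (2 * c_tau c))) *\<^sub>R
                    wgrad \<Omega> (\<lambda>y. pressure p0 s (i - 1) y - p0 y) x) \<and>
           eq_ae \<Omega> (f_H (s i)) (f_H (s 1)))) \<and>
     (\<forall>s. iterative_scheme \<Omega> \<Gamma>D (\<T> h) c (sol (n - 1)) (sol (n - 2)) (hs n) (fs n) (gs n) p0 s \<longleftrightarrow>
          reduced_scheme \<Omega> \<Gamma>D (\<T> h) c (sol (n - 1)) (sol (n - 2)) (hs n) (fs n) (gs n) p0 s) \<and>
     (\<forall>s s'. iterative_scheme \<Omega> \<Gamma>D (\<T> h) c (sol (n - 1)) (sol (n - 2)) (hs n) (fs n) (gs n) p0 s \<longrightarrow>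
        reduced_scheme \<Omega> \<Gamma>D (\<T> h) c (sol (n - 1)) (sol (n - 2)) (hs n) (fs n) (gs n) p0 s' \<longrightarrow>
        (\<forall>i\<ge>1. same_fields \<Omega> (s i) (s' i)))"
proof -
  have "\<Gamma>D \<subseteq> frontier \<Omega>"
    using assms(2) openin_imp_subset unfolding boundary_parts_def by blast
  then have "\<Gamma>D \<subseteq> closure \<Omega>"
    by (auto simp: frontier_def)
  then interpret coupled_problem \<Omega> "\<T> h" \<Gamma>D c "sol (n - 1)" "sol (n - 2)"
    using assms
    by unfold_locales (auto simp: bounded_lipschitz_polyhedron_def boundary_parts_def stable_mesh_family_def)
  \<comment> \<open>For the last claim, the equivalence turns the reduced sequence into an iterative
    one with the same data, so uniqueness for the iterative scheme applies.\<close>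
  show ?thesis
    using iterative_scheme_em_recovery [OF assms(12)] iterative_scheme_iff_reduced_scheme [OF assms(12)]
      iterative_scheme_unique [OF assms(12)]
    unfolding em_recovery_def by blast
qed

end
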